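(* Let $N \ge 1$ be an integer, $1 \le p < +\infty$, $\gamma > 0$, and let $u \in L^1_{\mathrm{loc}}(\mathbb{R}^N)$. Then $$\frac{K_{N,p}}{\gamma + p}\, \Phi(u) \le \limsup_{\lambda \to +\infty} \Phi_\lambda(u).$$ In particular, if $u \in L^p(\mathbb{R}^N)$ and the right-hand side is finite, then $u \in W^{1,p}(\mathbb{R}^N)$ if $p>1$, and $u \in BV(\mathbb{R}^N)$ if $p=1$.
   Context: Functions are real-valued. For $u \in L^1_{\mathrm{loc}}(\mathbb{R}^N)$: if $p>1$, $\Phi(u) = \int_{\mathbb{R}^N} |\nabla u|^p\,dx$ when the distributional gradient $\nabla u$ belongs to $L^p(\mathbb{R}^N)$, and $\Phi(u)=+\infty$ otherwise; if $p=1$, $\Phi(u) = \|\nabla u\|_{\mathcal{M}(\mathbb{R}^N)} := \sup\{ |\int_{\mathbb{R}^N} u\, \mathrm{div}\,\varphi\,dx| : \varphi \in C_c^\infty(\mathbb{R}^N;\mathbb{R}^N),\ \|\varphi\|_{L^\infty} \le 1\} \in [0,+\infty]$ (the total variation). $K_{N,p} = \int_{\mathbb{S}^{N-1}} |e\cdot\sigma|^p\,d\sigma$ for any $e \in \mathbb{S}^{N-1}$ (surface measure on the unit sphere; for $N=1$ counting measure on $\{\pm 1\}$). For $\lambda>0$, and for the given $p$ and $\gamma$, $$\Phi_\lambda(u) = \lambda^p \iint_{\{(x,y)\in \mathbb{R}^N\times\mathbb{R}^N:\ |u(x)-u(y)|/|x-y|^{1+\gamma/p} > \lambda\}} |x-y|^{-N+\gamma}\,dx\,dy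 \in [0,+\infty].$$ *)

theory Defs
  imports "HOL-Analysis.Analysis"
begin

text \<open>
  The space \<open>\<real>\<^sup>N\<close> is an arbitrary Euclidean space \<open>'a\<close>, with \<open>N = DIM('a)\<close>. Functions are
  Lebesgue measurable representatives, and every integral over the space (or over its square)
  is with respect to \<^const>\<open>lebesgue\<close>.
\<close>

definition L1_loc :: "('a::euclidean_space \<Rightarrow> 'b::euclidean_space) \<Rightarrow> bool" where
  "L1_loc f \<longleftrightarrow> f \<in> borel_measurable lebesgue \<and> (\<forall>K. compact K \<longrightarrow> f absolutely_integrable_on K)"

definition Lp :: "real \<Rightarrow> ('a::euclidean_space \<Rightarrow> 'b::euclidean_space) \<Rightarrow> bool" where
  "Lp p f \<longleftrightarrow> f \<in> borel_measurable lebesgue \<and> integrable lebesgue (\<lambda>x. norm (f x) powr p)"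

primrec Ck :: "nat \<Rightarrow> ('a::euclidean_space \<Rightarrow> 'b::euclidean_space) \<Rightarrow> bool" where
  "Ck 0 f \<longleftrightarrow> continuous_on UNIV f"
| "Ck (Suc k) f \<longleftrightarrow>
     (\<forall>x. f differentiable (at x)) \<and> (\<forall>v. Ck k (\<lambda>x. frechet_derivative f (at x) v))"

definition test_function :: "('a::euclidean_space \<Rightarrow> 'b::euclidean_space) \<Rightarrow> bool" where
  "test_function \<phi> \<longleftrightarrow> (\<forall>k. Ck k \<phi>) \<and> compact (closure {x. \<phi> x \<noteq> 0})"

definition divergence :: "('a::euclidean_space \<Rightarrow> 'a) \<Rightarrow> 'a \<Rightarrow> real" where
  "divergence \<phi> x = (\<Sum>b\<in>Basis. frechet_derivative \<phi> (at x) b \<bullet> b)"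

definition distributional_gradient :: "('a::euclidean_space \<Rightarrow> real) \<Rightarrow> ('a \<Rightarrow> 'a) \<Rightarrow> bool" where
  "distributional_gradient u g \<longleftrightarrow> L1_loc g \<and>
     (\<forall>\<phi> :: 'a \<Rightarrow> real. test_function \<phi> \<longrightarrow> (\<forall>b\<in>Basis.
        (LINT x|lebesgue. u x * frechet_derivative \<phi> (at x) b) =
        - (LINT x|lebesgue. (g x \<bullet> b) * \<phi> x)))"

definition total_variation :: "('a::euclidean_space \<Rightarrow> real) \<Rightarrow> ennreal" where
  "total_variation u =
     (SUP \<phi> \<in> {\<phi> :: 'a \<Rightarrow> 'a. test_function \<phi> \<and> (AE x in lebesgue. norm (\<phi> x) \<le> 1)}.
        ennreal \<bar>LINT x|lebesgue. u x * divergence \<phi> x\<bar>)"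

text \<open>
  A distributional gradient is determined only up to a null set, so the choice made by \<open>SOME\<close>
  does not affect the value of the integral.
\<close>

definition Phi :: "real \<Rightarrow> ('a::euclidean_space \<Rightarrow> real) \<Rightarrow> ennreal" where
  "Phi p u =
     (if p > 1 then
        (if \<exists>g. distributional_gradient u g \<and> Lp p g
         then \<integral>\<^sup>+ x. ennreal (norm ((SOME g. distributional_gradient u g \<and> Lp p g) x) powr p) \<partial>lebesgue
         else \<infinity>)
      else total_variation u)"

text \<open>
  Surface measure on the unit sphere in its cone form: by polar coordinates the surface measure
  of \<open>A\<close> is \<open>N\<close> times the volume of the cone over \<open>A\<close>, that is, of the set of points \<open>x\<close> of the
  punctured unit ball with \<open>x / \<bar>x\<bar> \<in> A\<close> (here \<open>sgn x = x / \<bar>x\<bar>\<close>). For \<open>N = 1\<close> this is the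
  counting measure on \<open>{-1, 1}\<close>.
\<close>

definition sphere_measure :: "'a::euclidean_space measure" where
  "sphere_measure = scale_measure (of_nat DIM('a))
     (distr (restrict_space lborel (ball 0 1 - {0})) (restrict_space borel (sphere 0 1)) sgn)"

text \<open>
  The constant \<open>K\<^bsub>N,p\<^esub>\<close>, computed with the unit vector \<open>e\<close>; by rotation invariance it does not
  depend on \<open>e\<close>.
\<close>

definition K_const :: "'a::euclidean_space \<Rightarrow> real \<Rightarrow> ennreal" where
  "K_const e p = (\<integral>\<^sup>+ \<sigma>. ennreal (\<bar>e \<bullet> \<sigma>\<bar> powr p) \<partial>sphere_measure)"

text \<open>
  On the diagonal the quotient is \<open>0 / 0 = 0\<close>, so the diagonal, a null set, is not part of the
  domain of integration.
\<close>

definition Phi_lambda :: "real \<Rightarrow> real \<Rightarrow> real \<Rightarrow> ('a::euclidean_space \<Rightarrow> real) \<Rightarrow> ennreal" where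
  "Phi_lambda p \<gamma> l u = ennreal (l powr p) *
     (\<integral>\<^sup>+ z \<in> {(x, y). \<bar>u x - u y\<bar> / norm (x - y) powr (1 + \<gamma> / p) > l}.
        (case z of (x, y) \<Rightarrow> ennreal (norm (x - y) powr (- real DIM('a) + \<gamma>)))
      \<partial>(lebesgue :: ('a \<times> 'a) measure))"

definition W1p :: "real \<Rightarrow> ('a::euclidean_space \<Rightarrow> real) \<Rightarrow> bool" where
  "W1p p u \<longleftrightarrow> Lp p u \<and> (\<exists>g. distributional_gradient u g \<and> Lp p g)"

definition BV :: "('a::euclidean_space \<Rightarrow> real) \<Rightarrow> bool" where
  "BV u \<longleftrightarrow> integrable lebesgue u \<and> total_variation u < \<infinity>"

end

theory Submission
  imports Defs
begin

text \<open>
  If the limsup is at most \<open>M\<close>, then \<open>\<Phi>\<^sub>\<lambda>(u)\<close> is essentially at most \<open>M\<close> for all large \<open>\<lambda>\<close>. Let \<open>q < p\<close>.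
  Integrating this bound against \<open>\<lambda>\<^sup>q\<^sup>-\<^sup>p\<^sup>-\<^sup>1 d\<lambda>\<close> controls the integral of the \<open>q\<close>-th power of
  \<open>\<bar>u(x) - u(y)\<bar> / \<bar>x - y\<bar>\<^bsup>1 + \<gamma>/p\<^esup>\<close>. When \<open>\<bar>u(x) - u(y)\<bar> \<le> A\<close>, the
  inequality \<open>\<bar>u(x) - u(y)\<bar>\<^sup>p \<le> A\<^sup>p\<^sup>-\<^sup>q \<bar>u(x) - u(y)\<bar>\<^sup>q\<close> turns this into a bound for the convex
  functional of Bourgain, Brezis and Mironescu with \<open>\<epsilon> = (p - q)(p + \<gamma>)/p\<close>; this choice of \<open>\<epsilon>\<close>
  is what produces the constant \<open>1/(\<gamma> + p)\<close>. By convexity the bound passes to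
  mollifications, and \<open>q \<rightarrow> p\<close> yields \<open>K \<integral>\<bar>\<nabla>u\<^sub>\<eta>\<bar>\<^sup>p \<le> (\<gamma> + p) M\<close>, first for bounded \<open>u\<close> and then, by
  truncation, in general. For \<open>p = 1\<close> duality concludes. For \<open>p > 1\<close> the energies of \<open>\<nabla>u\<^sub>\<eta>\<close>
  and of midpoints \<open>(\<nabla>u\<^sub>\<eta> + \<nabla>u\<^sub>\<eta>\<^sub>')/2\<close> approach the same supremum, so by uniform
  convexity \<open>\<nabla>u\<^sub>\<eta>\<close> is Cauchy in \<open>L\<^sup>p\<close>, and its limit is the weak gradient.
\<close>

section \<open>Integration over Euclidean space\<close>

text \<open>\<open>Phi_lambda\<close> sees u only through superlevel sets, so Jensen's inequality
  does not apply to it and its bound cannot be mollified directly; this forces the detour through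
  p-th powers of differences. The value of \<epsilon> is the one for which the exponents of |h|
  agree: \<gamma> - N - q(1 + \<gamma>/p) = \<epsilon> - N - p. The limsup says nothing about
  \<lambda> below some threshold \<Lambda>. The low quotients are therefore integrated only over |h|
  < 1 and x in a ball, where they cost a finite amount, and the factor \<epsilon> that comes with
  polar coordinates removes this amount as q \<rightarrow> p. The tail costs \<epsilon> q M / (p -
  q) up to factors tending to 1, and \<epsilon> / (p - q) = (p + \<gamma>)/p, whence (\<gamma> + p)
  M in the limit. Boundedness of u serves twice: it exchanges the power p for q at the price of a
  factor \<open>A powr (p - q)\<close> that tends to 1, and it makes the Taylor error of the
  mollified function uniform in x. The final constant does not contain the bound A, which is why
  truncation costs nothing.\<close>

lemma nn_integral_lborel_affine:
  fixes f :: "'a::euclidean_space \<Rightarrow> ennreal"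
  assumes [measurable]: "f \<in> borel_measurable borel" and c: "c \<noteq> 0"
  shows "(\<integral>\<^sup>+x. f x \<partial>lborel) = ennreal (\<bar>c\<bar> ^ DIM('a)) * (\<integral>\<^sup>+x. f (t + c *\<^sub>R x) \<partial>lborel)"
  by (subst lborel_affine[OF c, of t])
     (simp add: nn_integral_density nn_integral_distr nn_integral_cmult)

lemma nn_integral_lborel_shift:
  fixes f :: "'a::euclidean_space \<Rightarrow> ennreal"
  assumes [measurable]: "f \<in> borel_measurable borel"
  shows "(\<integral>\<^sup>+x. f (x + t) \<partial>lborel) = (\<integral>\<^sup>+x. f x \<partial>lborel)"
  using nn_integral_lborel_affine[OF assms, of 1 t] by (simp add: add.commute)

lemma nn_integral_lborel_reflect:
  fixes f :: "'a::euclidean_space \<Rightarrow> ennreal"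
  assumes [measurable]: "f \<in> borel_measurable borel"
  shows "(\<integral>\<^sup>+x. f (t - x) \<partial>lborel) = (\<integral>\<^sup>+x. f x \<partial>lborel)"
  using nn_integral_lborel_affine[OF assms, of "-1" t] by simp

lemma lborel_distr_shift:
  "distr lborel borel (\<lambda>x. x + t) = (lborel :: 'a::euclidean_space measure)"
  using lborel_distr_plus[of t] by (simp add: add.commute[of _ t])

lemma integral_lborel_shift:
  fixes f :: "'a::euclidean_space \<Rightarrow> 'b::euclidean_space"
  assumes [measurable]: "f \<in> borel_measurable borel"
  shows "(LINT x|lborel. f (x + t)) = (LINT x|lborel. f x)"
proof -
  have "(LINT x|lborel. f x) = (LINT x|distr lborel borel (\<lambda>x. x + t). f x)"
    by (simp add: lborel_distr_shift)
  also have "\<dots> = (LINT x|lborel. f (x + t))" by (rule integral_distr) auto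
  finally show ?thesis by simp
qed

lemma integrable_lborel_shift:
  fixes f :: "'a::euclidean_space \<Rightarrow> 'b::euclidean_space"
  assumes "integrable lborel f"
  shows "integrable lborel (\<lambda>x. f (x + t))"
proof -
  have [measurable]: "f \<in> borel_measurable borel" using assms by auto
  have "integrable (distr lborel borel (\<lambda>x. x + t)) f" using assms by (simp add: lborel_distr_shift)
  then show ?thesis by (subst (asm) integrable_distr_eq) auto
qed

lemma continuous_supp_bounded:
  fixes f :: "'a::euclidean_space \<Rightarrow> 'b::euclidean_space"
  assumes f: "continuous_on UNIV f" and supp: "\<And>x. norm x \<ge> R \<Longrightarrow> f x = 0"
  obtains B where "B \<ge> 0" "\<And>x. norm (f x) \<le> B * indicat_real (cball 0 R) x"
proof -
  have "bounded (f ` cball 0 R)"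
    by (intro compact_imp_bounded compact_continuous_image continuous_on_subset[OF f]) auto
  then obtain B where B: "\<And>x. x \<in> cball 0 R \<Longrightarrow> norm (f x) \<le> B"
    unfolding bounded_iff by blast
  show thesis
  proof (rule that[of "max 0 B"])
    fix x show "norm (f x) \<le> max 0 B * indicat_real (cball 0 R) x"
    proof (cases "x \<in> cball 0 R")
      case True then show ?thesis using B[of x] by simp
    next
      case False then show ?thesis using supp[of x] by simp
    qed
  qed simp
qed

lemma integrable_indicator_cball:
  "integrable lborel (\<lambda>x::'a::euclidean_space. B * indicat_real (cball c R) x)"
  using emeasure_bounded_finite[OF bounded_cball, of c R]
  by (intro integrable_mult_right integrable_real_indicator) auto

lemma continuous_supp_integrable:
  fixes f :: "'a::euclidean_space \<Rightarrow> 'b::euclidean_space"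
  assumes f: "continuous_on UNIV f" and supp: "\<And>x. norm x \<ge> R \<Longrightarrow> f x = 0"
  shows "integrable lborel f"
proof -
  obtain B where B: "B \<ge> 0" "\<And>x. norm (f x) \<le> B * indicat_real (cball 0 R) x"
    using continuous_supp_bounded[OF f supp] by blast
  show ?thesis
    by (rule Bochner_Integration.integrable_bound[OF integrable_indicator_cball[of B 0 R]])
       (use B f in \<open>auto intro!: AE_I2 borel_measurable_continuous_onI order_trans[OF _ abs_ge_self]\<close>)
qed

text \<open>Translation invariance makes the integral of every difference quotient zero, and
  dominated convergence passes to the derivative. This divergence theorem in a single direction
  supplies the integration by parts.\<close>

lemma integral_directional_derivative_eq_0:
  fixes F F' :: "'a::euclidean_space \<Rightarrow> real"
  assumes F: "continuous_on UNIV F" and F': "continuous_on UNIV F'"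
    and supp: "\<And>x. norm x \<ge> R \<Longrightarrow> F x = 0"
    and der: "\<And>x. ((\<lambda>t. F (x + t *\<^sub>R b)) has_real_derivative F' x) (at 0)"
  shows "(LINT x|lborel. F' x) = 0"
proof -
  define q where "q n x = (F (x + inverse (real (Suc n)) *\<^sub>R b) - F x) / inverse (real (Suc n))" for n x
  have [measurable]: "F \<in> borel_measurable borel" "F' \<in> borel_measurable borel"
    using F F' by (auto intro: borel_measurable_continuous_onI)
  have Fi: "integrable lborel F" using continuous_supp_integrable[OF F supp] .
  have q0: "(LINT x|lborel. q n x) = 0" for n
    unfolding q_def using Fi
    by (simp add: integrable_lborel_shift[OF Fi] integral_lborel_shift)
  \<comment> \<open>The quotients vanish beyond radius R + |b| because the step is at most 1, and
    the mean value theorem may evaluate \<open>F'\<close> up to |b| further out.\<close>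
  have "bounded (F' ` cball 0 (R + 2 * norm b))"
    by (intro compact_imp_bounded compact_continuous_image continuous_on_subset[OF F']) auto
  then obtain B where B: "\<And>x. x \<in> cball 0 (R + 2 * norm b) \<Longrightarrow> \<bar>F' x\<bar> \<le> B"
    unfolding bounded_iff real_norm_def by blast
  have der': "((\<lambda>t. F (x + t *\<^sub>R b)) has_real_derivative F' (x + s *\<^sub>R b)) (at s)" for x s
    using der[of "x + s *\<^sub>R b"] DERIV_shift[of "\<lambda>t. F (x + t *\<^sub>R b)" "F' (x + s *\<^sub>R b)" 0 s]
    by (simp add: algebra_simps)
  have bd: "\<bar>q n x\<bar> \<le> max 0 B * indicat_real (cball 0 (R + norm b)) x" for n x
  proof -
    define t where "t = inverse (real (Suc n))"
    have t: "0 < t" "t \<le> 1" by (auto simp: t_def field_simps)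
    have tb: "norm (s *\<^sub>R b) \<le> norm b" if "0 \<le> s" "s \<le> t" for s
      using that t by (simp add: mult_left_le_one_le)
    show ?thesis
    proof (cases "x \<in> cball 0 (R + norm b)")
      case True
      have "\<exists>z>0. z < t \<and> F (x + t *\<^sub>R b) - F (x + 0 *\<^sub>R b) = (t - 0) * F' (x + z *\<^sub>R b)"
        by (rule MVT2[OF t(1)]) (rule der')
      then obtain z where z: "0 < z" "z < t" "F (x + t *\<^sub>R b) - F x = t * F' (x + z *\<^sub>R b)" by auto
      have "norm (x + z *\<^sub>R b) \<le> R + 2 * norm b"
        using norm_triangle_ineq[of x "z *\<^sub>R b"] tb[of z] z True by (simp add: dist_norm)
      then have "\<bar>F' (x + z *\<^sub>R b)\<bar> \<le> B" using B by (simp add: dist_norm)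
      then show ?thesis using z t True unfolding q_def t_def[symmetric] by simp
    next
      case False
      then have "norm x > R + norm b" by (simp add: dist_norm)
      moreover have "norm (x + t *\<^sub>R b) \<ge> norm x - norm b"
        using norm_triangle_ineq4[of "x + t *\<^sub>R b" "t *\<^sub>R b"] tb[of t] t by simp
      ultimately have "F x = 0" "F (x + t *\<^sub>R b) = 0"
        using supp[of x] supp[of "x + t *\<^sub>R b"] norm_ge_zero[of b] by auto
      then show ?thesis unfolding q_def t_def[symmetric] by simp
    qed
  qed
  have lim: "(\<lambda>n. q n x) \<longlonglongrightarrow> F' x" for x
  proof -
    have "(\<lambda>h. (F (x + h *\<^sub>R b) - F x) / h) \<midarrow>0\<rightarrow> F' x"
      using der[of x] by (simp add: DERIV_def)
    then show ?thesis unfolding q_def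
      by (rule filterlim_compose)
         (use LIMSEQ_inverse_real_of_nat in \<open>auto simp: filterlim_at\<close>)
  qed
  have "(\<lambda>n. LINT x|lborel. q n x) \<longlonglongrightarrow> (LINT x|lborel. F' x)"
    by (rule integral_dominated_convergence[OF _ _ integrable_indicator_cball[of "max 0 B" 0 "R + norm b"]])
       (use lim bd in \<open>auto simp: q_def[abs_def]\<close>)
  then show ?thesis using q0 by (simp add: LIMSEQ_const_iff)
qed

section \<open>The mollifier\<close>

definition kern0 :: "'a::euclidean_space \<Rightarrow> real" where
  "kern0 x = (max 0 (1 - (norm x)\<^sup>2))\<^sup>2"

text \<open>Minus the gradient of \<^const>\<open>kern0\<close>, which is of class \<open>C\<^sup>1\<^sup>,\<^sup>1\<close>: this makes the Taylor bound below explicit.\<close>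

definition kernG0 :: "'a::euclidean_space \<Rightarrow> 'a" where
  "kernG0 x = (4 * max 0 (1 - (norm x)\<^sup>2)) *\<^sub>R x"

lemma kern0_nonneg: "0 \<le> kern0 x" by (simp add: kern0_def)
lemma kern0_supp: "norm x \<ge> 1 \<Longrightarrow> kern0 x = 0" using one_le_power[of "norm x" 2] by (simp add: kern0_def)
lemma kernG0_supp: "norm x \<ge> 1 \<Longrightarrow> kernG0 x = 0" using one_le_power[of "norm x" 2] by (simp add: kernG0_def)
lemma kern0_cont: "continuous_on UNIV kern0"
  unfolding kern0_def by (intro continuous_intros)
lemma kernG0_cont: "continuous_on UNIV kernG0"
  unfolding kernG0_def by (intro continuous_intros)
lemma kern0_even: "kern0 (- x) = kern0 x" by (simp add: kern0_def)

text \<open>The function \<open>(max 0 (1 - t))^2\<close> has derivative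
  \<open>- 2 * max 0 (1 - t)\<close>, which is Lipschitz with constant 2. Its first-order Taylor
  remainder is thus at most the square of the increment, even across t = 1, where the second
  derivative jumps.\<close>

lemma quad_remainder:
  fixes s t :: real
  shows "\<bar>(max 0 (1 - t))\<^sup>2 - (max 0 (1 - s))\<^sup>2 + 2 * max 0 (1 - s) * (t - s)\<bar> \<le> (t - s)\<^sup>2"
proof -
  consider "s \<le> 1" "t \<le> 1" | "s \<le> 1" "t > 1" | "s > 1" "t \<le> 1" | "s > 1" "t > 1" by linarith
  then show ?thesis
  proof cases
    case 1
    have "(1 - t)\<^sup>2 - (1 - s)\<^sup>2 + 2 * (1 - s) * (t - s) = (t - s)\<^sup>2" by algebra
    with 1 show ?thesis by (simp add: max_def)
  next
    case 2
    have "(1-s) * (2 * (t - s) - (1 - s)) \<ge> 0" using 2 by (intro mult_nonneg_nonneg) auto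
    moreover have "(t - s)\<^sup>2 - (1-s) * (2 * (t - s) - (1 - s)) = (t-1)\<^sup>2" by algebra
    moreover have "- (1 - s)\<^sup>2 + 2 * (1 - s) * (t - s) = (1-s) * (2 * (t - s) - (1 - s))" by algebra
    ultimately have "0 \<le> - (1 - s)\<^sup>2 + 2 * (1 - s) * (t - s)" "- (1 - s)\<^sup>2 + 2 * (1 - s) * (t - s) \<le> (t - s)\<^sup>2"
      using zero_le_power2[of "t-1"] by linarith+
    then show ?thesis using 2 by (simp add: max_def)
  next
    case 3
    then have "(1 - t)\<^sup>2 \<le> (s - t)\<^sup>2" by (intro power_mono) auto
    then show ?thesis using 3 by (simp add: max_def power2_commute)
  next
    case 4 then show ?thesis by (simp add: max_def)
  qed
qed

text \<open>The profile is the scalar function of \<open>quad_remainder\<close> composed with the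
  squared norm. For |h| \<le> 1 and |z| \<le> 2 the squared norm changes by at most 5|h|, which
  gives 25|h|^2; the other 2|h|^2 comes from the quadratic part of that change. For |h| \<le> 1 and
  |z| > 2 everything vanishes, and for |h| > 1 the crude bounds 1 and 4|h| suffice.\<close>

lemma kern0_taylor: "\<bar>kern0 (z - h) - kern0 z - kernG0 z \<bullet> h\<bar> \<le> 27 * (norm h)\<^sup>2"
proof -
  define m where "m = max 0 (1 - (norm z)\<^sup>2)"
  define s where "s = (norm z)\<^sup>2"
  define t where "t = (norm (z - h))\<^sup>2"
  have m: "0 \<le> m" "m \<le> 1" by (auto simp: m_def)
  have ts: "t - s = - 2 * (z \<bullet> h) + (norm h)\<^sup>2"
    unfolding s_def t_def by (simp add: power2_norm_eq_inner inner_diff_left inner_diff_right inner_commute)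
  have zh: "\<bar>z \<bullet> h\<bar> \<le> norm z * norm h" by (rule Cauchy_Schwarz_ineq2)
  have eq: "kern0 (z - h) - kern0 z - kernG0 z \<bullet> h =
     ((max 0 (1 - t))\<^sup>2 - (max 0 (1 - s))\<^sup>2 + 2 * max 0 (1 - s) * (t - s)) - 2 * m * (norm h)\<^sup>2"
    unfolding ts by (simp add: kern0_def kernG0_def m_def s_def t_def algebra_simps)
  have mh: "0 \<le> 2 * m * (norm h)\<^sup>2" "2 * m * (norm h)\<^sup>2 \<le> 2 * (norm h)\<^sup>2" using m
    by (auto simp: mult_left_le_one_le)
  have le: "\<bar>kern0 (z - h) - kern0 z - kernG0 z \<bullet> h\<bar> \<le> (t - s)\<^sup>2 + 2 * (norm h)\<^sup>2"
    unfolding eq using quad_remainder[of t s] mh by linarith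
  show ?thesis
  proof (cases "norm h \<le> 1")
    case h: True
    show ?thesis
    proof (cases "norm z \<le> 2")
      case True
      have "\<bar>t - s\<bar> \<le> 2 * (norm z * norm h) + norm h * norm h"
        unfolding ts using zh norm_ge_zero[of h] zero_le_power2[of "norm h"] unfolding power2_eq_square by linarith
      also have "\<dots> \<le> 2 * (2 * norm h) + 1 * norm h"
        using True h by (intro add_mono mult_left_mono mult_right_mono) auto
      finally have "(t - s)\<^sup>2 \<le> (5 * norm h)\<^sup>2" by (intro power2_le_iff_abs_le[THEN iffD2]) auto
      then show ?thesis using le by (simp add: power_mult_distrib)
    next
      case False
      have "norm (z - h) \<ge> 1" using norm_triangle_ineq2[of z h] False h by linarith
      then show ?thesis using False by (simp add: kern0_supp kernG0_supp)
    qed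
  next
    case h: False
    have k: "0 \<le> kern0 y \<and> kern0 y \<le> 1" for y :: 'a
      unfolding kern0_def by (auto intro!: power_le_one)
    have "norm (kernG0 z) \<le> 4"
    proof (cases "norm z \<le> 1")
      case True
      have "4 * m * norm z \<le> 4 * 1 * 1" using m True by (intro mult_mono) auto
      then show ?thesis using m by (simp add: kernG0_def m_def)
    qed (simp add: kernG0_supp)
    then have "\<bar>kernG0 z \<bullet> h\<bar> \<le> 4 * norm h"
      using Cauchy_Schwarz_ineq2[of "kernG0 z" h] mult_right_mono[of "norm (kernG0 z)" 4 "norm h"] by simp
    moreover have "norm h \<le> (norm h)\<^sup>2" using h self_le_power[of "norm h" 2] by simp
    then have "1 \<le> (norm h)\<^sup>2" "norm h \<le> (norm h)\<^sup>2" using h by linarith+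
    ultimately show ?thesis using k[of "z-h"] k[of z] by linarith
  qed
qed

lemma kern0_integral_pos: "0 < (LINT x|lborel. kern0 (x::'a::euclidean_space))"
proof -
  have "9/16 * measure lborel (ball (0::'a) (1/2)) = (LINT x|lborel. 9/16 * indicat_real (ball (0::'a) (1/2)) x)"
    by simp
  also have "\<dots> \<le> (LINT x|lborel. kern0 (x::'a))"
  proof (rule integral_mono)
    show "integrable lborel (\<lambda>x. 9/16 * indicat_real (ball (0::'a) (1/2)) x)"
      using emeasure_bounded_finite[OF bounded_ball, of "0::'a" "1/2"]
      by (intro integrable_mult_right integrable_real_indicator) auto
    show "integrable lborel (kern0 :: 'a \<Rightarrow> real)"
      by (rule continuous_supp_integrable[OF kern0_cont kern0_supp])
    fix x :: 'a
    show "9/16 * indicat_real (ball 0 (1/2)) x \<le> kern0 x"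
    proof (cases "x \<in> ball 0 (1/2)")
      case True
      then have "(norm x)\<^sup>2 \<le> (1/2)\<^sup>2" by (intro power_mono) auto
      then have "3/4 \<le> 1 - (norm x)\<^sup>2" by (simp add: power2_eq_square)
      then have "3/4 \<le> max 0 (1 - (norm x)\<^sup>2)"
        by (rule max.coboundedI2)
      then have "(3/4)\<^sup>2 \<le> kern0 x" unfolding kern0_def by (rule power_mono) simp
      then show ?thesis using True by (simp add: power2_eq_square)
    qed (simp add: kern0_nonneg)
  qed
  finally show ?thesis using content_ball_pos[of "1/2" "0::'a"] by linarith
qed

definition kern :: "real \<Rightarrow> 'a::euclidean_space \<Rightarrow> real" where
  "kern \<eta> x = kern0 (x /\<^sub>R \<eta>) / ((LINT y|lborel. kern0 (y::'a)) * \<eta> ^ DIM('a))"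

text \<open>Minus the gradient of \<open>kern \<eta>\<close>; the additional factor \<eta> is the
  chain rule. With this sign, \<open>kernG \<eta> (y - x)\<close> is the gradient of
  \<open>kern \<eta> (y - x)\<close> in x.\<close>

definition kernG :: "real \<Rightarrow> 'a::euclidean_space \<Rightarrow> 'a" where
  "kernG \<eta> x = kernG0 (x /\<^sub>R \<eta>) /\<^sub>R ((LINT y|lborel. kern0 (y::'a)) * \<eta> ^ DIM('a) * \<eta>)"

lemma kern_nonneg: "0 < \<eta> \<Longrightarrow> 0 \<le> kern \<eta> x"
  using kern0_integral_pos[where 'a='a] by (auto simp: kern_def kern0_nonneg intro!: divide_nonneg_nonneg mult_nonneg_nonneg)

lemma kern_supp: "0 < \<eta> \<Longrightarrow> norm x \<ge> \<eta> \<Longrightarrow> kern \<eta> x = 0"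
  by (simp add: kern_def kern0_supp field_simps)

lemma kernG_supp: "0 < \<eta> \<Longrightarrow> norm x \<ge> \<eta> \<Longrightarrow> kernG \<eta> x = 0"
  by (simp add: kernG_def kernG0_supp field_simps)

lemma kern_cont: "continuous_on UNIV (kern \<eta>)"
proof -
  have "continuous_on UNIV (\<lambda>x::'a. kern0 (x /\<^sub>R \<eta>))"
    by (rule continuous_on_compose2[OF kern0_cont]) (auto intro!: continuous_intros)
  then show ?thesis unfolding kern_def[abs_def] divide_inverse by (intro continuous_intros)
qed

lemma kernG_cont: "continuous_on UNIV (kernG \<eta>)"
proof -
  have "continuous_on UNIV (\<lambda>x::'a. kernG0 (x /\<^sub>R \<eta>))"
    by (rule continuous_on_compose2[OF kernG0_cont]) (auto intro!: continuous_intros)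
  then show ?thesis unfolding kernG_def[abs_def] by (intro continuous_intros)
qed

lemma kern_measurable [measurable]: "kern \<eta> \<in> borel_measurable borel"
  by (intro borel_measurable_continuous_onI kern_cont)

lemma kernG_measurable [measurable]: "kernG \<eta> \<in> borel_measurable borel"
  by (intro borel_measurable_continuous_onI kernG_cont)

lemma kern_even: "kern \<eta> (x - y) = kern \<eta> (y - x)"
  using kern0_even[of "(y - x) /\<^sub>R \<eta>"]
  by (simp add: kern_def scaleR_diff_right)

lemma kern_integrable: "0 < \<eta> \<Longrightarrow> integrable lborel (kern \<eta>)"
  by (rule continuous_supp_integrable[OF kern_cont kern_supp])

lemma kern_integral:
  assumes "0 < \<eta>"
  shows "(LINT x|lborel. kern \<eta> (x::'a::euclidean_space)) = 1"
proof -
  define c where "c = (LINT y|lborel. kern0 (y::'a))"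
  have c: "c > 0" using kern0_integral_pos by (simp add: c_def)
  have [measurable]: "kern0 \<in> borel_measurable (borel :: 'a measure)"
    by (intro borel_measurable_continuous_onI kern0_cont)
  have 1: "ennreal c = (\<integral>\<^sup>+x. ennreal (kern0 x) \<partial>(lborel :: 'a measure))"
    unfolding c_def
    by (subst nn_integral_eq_integral)
       (auto simp: kern0_nonneg intro: continuous_supp_integrable[OF kern0_cont kern0_supp])
  have "(\<integral>\<^sup>+x. ennreal (kern \<eta> x) \<partial>(lborel :: 'a measure)) =
      ennreal (\<eta> ^ DIM('a)) * (\<integral>\<^sup>+x. ennreal (kern \<eta> (\<eta> *\<^sub>R x)) \<partial>(lborel :: 'a measure))"
    using nn_integral_lborel_affine[of "\<lambda>x::'a. ennreal (kern \<eta> x)" \<eta> 0] assms by simp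
  also have "\<dots> = ennreal (\<eta> ^ DIM('a)) * (\<integral>\<^sup>+x. ennreal (1 / (c * \<eta> ^ DIM('a))) * ennreal (kern0 x) \<partial>(lborel :: 'a measure))"
    using assms c by (simp add: kern_def c_def[symmetric] ennreal_mult'[symmetric])
  also have "\<dots> = ennreal (\<eta> ^ DIM('a)) * (ennreal (1 / (c * \<eta> ^ DIM('a))) * (\<integral>\<^sup>+x. ennreal (kern0 x) \<partial>(lborel :: 'a measure)))"
    by (subst nn_integral_cmult) auto
  also have "\<dots> = 1" unfolding 1[symmetric] using assms c by (simp add: ennreal_mult'[symmetric])
  finally have "(\<integral>\<^sup>+x. ennreal (kern \<eta> x) \<partial>(lborel :: 'a measure)) = 1" .
  then show ?thesis using assms by (subst integral_eq_nn_integral) (auto simp: kern_nonneg)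
qed

lemma kern_nn_integral:
  fixes y :: "'a::euclidean_space"
  assumes "0 < \<eta>"
  shows "(\<integral>\<^sup>+x. ennreal (kern \<eta> (x - y)) \<partial>lborel) = 1" "(\<integral>\<^sup>+x. ennreal (kern \<eta> (y - x)) \<partial>lborel) = 1"
proof -
  have "(\<integral>\<^sup>+x. ennreal (kern \<eta> (x - y)) \<partial>lborel) = (\<integral>\<^sup>+x. ennreal (kern \<eta> x) \<partial>(lborel :: 'a measure))"
    using nn_integral_lborel_shift[of "\<lambda>x. ennreal (kern \<eta> x)" "- y"] by simp
  also have "\<dots> = ennreal (LINT x|lborel. kern \<eta> (x::'a))"
    by (rule nn_integral_eq_integral) (use assms in \<open>auto simp: kern_nonneg kern_integrable\<close>)
  finally show "(\<integral>\<^sup>+x. ennreal (kern \<eta> (x - y)) \<partial>lborel) = 1" by (simp add: kern_integral assms)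
  then show "(\<integral>\<^sup>+x. ennreal (kern \<eta> (y - x)) \<partial>lborel) = 1" by (simp add: kern_even[of _ y])
qed

lemma kern_taylor:
  assumes "0 < \<eta>"
  obtains C where "C \<ge> 0"
    "\<And>z h :: 'a::euclidean_space. \<bar>kern \<eta> (z - h) - kern \<eta> z - kernG \<eta> z \<bullet> h\<bar> \<le> C * (norm h)\<^sup>2"
proof -
  define d where "d = (LINT y|lborel. kern0 (y::'a)) * \<eta> ^ DIM('a)"
  have d: "d > 0" using kern0_integral_pos[where 'a='a] assms by (simp add: d_def)
  show thesis
  proof (rule that[of "27 / \<eta>\<^sup>2 / d"])
    fix z h :: 'a
    have "kern \<eta> (z - h) - kern \<eta> z - kernG \<eta> z \<bullet> h =
      (kern0 (z /\<^sub>R \<eta> - h /\<^sub>R \<eta>) - kern0 (z /\<^sub>R \<eta>) - kernG0 (z /\<^sub>R \<eta>) \<bullet> (h /\<^sub>R \<eta>)) / d"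
      using d assms by (simp add: kern_def kernG_def d_def[symmetric] scaleR_diff_right field_simps)
    also have "\<bar>\<dots>\<bar> \<le> 27 * (norm (h /\<^sub>R \<eta>))\<^sup>2 / d"
      using kern0_taylor[of "z /\<^sub>R \<eta>" "h /\<^sub>R \<eta>"] d by (simp add: divide_right_mono)
    also have "\<dots> = 27 / \<eta>\<^sup>2 / d * (norm h)\<^sup>2" using assms by (simp add: power_mult_distrib field_simps)
    finally show "\<bar>kern \<eta> (z - h) - kern \<eta> z - kernG \<eta> z \<bullet> h\<bar> \<le> 27 / \<eta>\<^sup>2 / d * (norm h)\<^sup>2" .
  qed (use d in simp)
qed

lemma kern_deriv:
  assumes "0 < \<eta>"
  shows "((\<lambda>t. kern \<eta> (z - (x + t *\<^sub>R b))) has_real_derivative kernG \<eta> (z - x) \<bullet> b) (at 0)"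
proof -
  obtain C where C: "C \<ge> 0"
    "\<And>z h :: 'a. \<bar>kern \<eta> (z - h) - kern \<eta> z - kernG \<eta> z \<bullet> h\<bar> \<le> C * (norm h)\<^sup>2"
    using kern_taylor[OF assms] by blast
  have "((\<lambda>h. (kern \<eta> (z - (x + h *\<^sub>R b)) - kern \<eta> (z - x)) / h - kernG \<eta> (z - x) \<bullet> b) \<longlongrightarrow> 0) (at 0)"
  proof (rule Lim_null_comparison)
    show "\<forall>\<^sub>F h in at 0. norm ((kern \<eta> (z - (x + h *\<^sub>R b)) - kern \<eta> (z - x)) / h - kernG \<eta> (z - x) \<bullet> b)
      \<le> C * (norm b)\<^sup>2 * \<bar>h\<bar>"
    proof (rule eventually_at_topological[THEN iffD2], intro exI[of _ UNIV] conjI ballI impI)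
      fix h :: real assume h: "h \<noteq> 0"
      have "norm ((kern \<eta> (z - (x + h *\<^sub>R b)) - kern \<eta> (z - x)) / h - kernG \<eta> (z - x) \<bullet> b)
         = \<bar>kern \<eta> (z - x - h *\<^sub>R b) - kern \<eta> (z - x) - kernG \<eta> (z - x) \<bullet> (h *\<^sub>R b)\<bar> / \<bar>h\<bar>"
      proof -
        have "(kern \<eta> (z - (x + h *\<^sub>R b)) - kern \<eta> (z - x)) / h - kernG \<eta> (z - x) \<bullet> b
          = (kern \<eta> (z - x - h *\<^sub>R b) - kern \<eta> (z - x) - kernG \<eta> (z - x) \<bullet> (h *\<^sub>R b)) / h"
          using h by (simp add: field_simps diff_diff_eq)
        then show ?thesis by (simp only: real_norm_def abs_divide)
      qed
      also have "\<dots> \<le> C * (norm (h *\<^sub>R b))\<^sup>2 / \<bar>h\<bar>" by (intro divide_right_mono C) auto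
      also have "\<dots> = C * (norm b)\<^sup>2 * \<bar>h\<bar>" using h by (simp add: power_mult_distrib power2_eq_square)
      finally show "norm ((kern \<eta> (z - (x + h *\<^sub>R b)) - kern \<eta> (z - x)) / h - kernG \<eta> (z - x) \<bullet> b)
        \<le> C * (norm b)\<^sup>2 * \<bar>h\<bar>" .
    qed auto
    have "((\<lambda>h. C * (norm b)\<^sup>2 * \<bar>h\<bar>) \<longlongrightarrow> C * (norm b)\<^sup>2 * \<bar>0\<bar>) (at (0::real))"
      by (intro tendsto_intros)
    then show "((\<lambda>h. C * (norm b)\<^sup>2 * \<bar>h\<bar>) \<longlongrightarrow> 0) (at (0::real))" by simp
  qed
  then show ?thesis unfolding DERIV_def by (simp add: LIM_zero_iff)
qed

section \<open>Convolution of locally integrable functions\<close>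

text \<open>The Borel counterpart of \<open>L1_loc\<close>: Borel representatives stay jointly
  measurable on products, where Tonelli's theorem is applied, and balls suffice because they absorb
  every compact set.\<close>

definition loc_int :: "('a::euclidean_space \<Rightarrow> 'b::euclidean_space) \<Rightarrow> bool" where
  "loc_int u \<longleftrightarrow> u \<in> borel_measurable borel \<and> (\<forall>R. integrable lborel (\<lambda>x. indicat_real (cball 0 R) x *\<^sub>R u x))"

lemma loc_int_measurable: "loc_int u \<Longrightarrow> u \<in> borel_measurable borel"
  by (simp add: loc_int_def)

lemma loc_int_dom:
  assumes "loc_int u"
  shows "integrable lborel (\<lambda>x. B * (indicat_real (cball 0 R) x * norm (u x)))"
proof -
  have "integrable lborel (\<lambda>x. norm (indicat_real (cball 0 R) x *\<^sub>R u x))"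
    using assms by (intro integrable_norm) (auto simp: loc_int_def)
  then show ?thesis by (simp add: abs_mult)
qed

lemma loc_int_integrable:
  fixes F :: "'a::euclidean_space \<Rightarrow> 'c::euclidean_space"
  assumes "loc_int u" and [measurable]: "F \<in> borel_measurable borel"
    and "\<And>x. norm (F x) \<le> B * (indicat_real (cball 0 R) x * norm (u x))"
  shows "integrable lborel F"
  by (rule Bochner_Integration.integrable_bound[OF loc_int_dom[OF assms(1), of B R]])
     (use assms in \<open>auto intro!: AE_I2 intro: order_trans[OF _ abs_ge_self]\<close>)

lemma continuous_loc_int:
  assumes "continuous_on UNIV u"
  shows "loc_int u"
  unfolding loc_int_def
proof safe
  show "u \<in> borel_measurable borel" using assms by (rule borel_measurable_continuous_onI)
  fix R
  show "integrable lborel (\<lambda>x. indicat_real (cball 0 R) x *\<^sub>R u x)"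
    using borel_integrable_compact[of "cball 0 R" u] continuous_on_subset[OF assms] by simp
qed

text \<open>The bound is uniform for x in a ball, so that one multiple of |u| on a larger ball
  dominates all integrands of the convolution at once; both continuity and Fubini rest on
  it.\<close>

lemma shifted_supp_bound:
  fixes k :: "'a::euclidean_space \<Rightarrow> 'b::euclidean_space"
  assumes k: "continuous_on UNIV k" "\<And>x. norm x \<ge> \<eta> \<Longrightarrow> k x = 0"
  obtains B where "B \<ge> 0" "\<And>x y R. norm x \<le> R \<Longrightarrow> norm (k (y - x)) \<le> B * indicat_real (cball 0 (R + \<eta>)) y"
proof -
  obtain B where B: "B \<ge> 0" "\<And>x. norm (k x) \<le> B * indicat_real (cball 0 \<eta>) x"
    using continuous_supp_bounded[OF k] by blast
  show thesis
  proof (rule that[OF B(1)])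
    fix x y :: 'a and R assume "norm x \<le> R"
    have "norm y \<le> norm x + norm (y - x)" using norm_triangle_ineq[of x "y - x"] by simp
    then have "indicat_real (cball 0 \<eta>) (y - x) \<le> indicat_real (cball 0 (R + \<eta>)) y"
      using \<open>norm x \<le> R\<close> by (auto simp: indicator_def)
    then show "norm (k (y - x)) \<le> B * indicat_real (cball 0 (R + \<eta>)) y"
      using B(2)[of "y - x"] mult_left_mono[OF _ B(1)] by (blast intro: order_trans)
  qed
qed

lemma conv_bound:
  fixes k :: "'a::euclidean_space \<Rightarrow> 'b::euclidean_space" and u :: "'a \<Rightarrow> real"
  assumes "norm (k (y - x)) \<le> B * indicat_real (cball 0 R) y"
  shows "norm (u y *\<^sub>R k (y - x)) \<le> B * (indicat_real (cball 0 R) y * norm (u y))"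
  using mult_right_mono[OF assms norm_ge_zero[of "u y"]] by (simp add: mult_ac)

lemma conv_integrable:
  fixes k :: "'a::euclidean_space \<Rightarrow> 'b::euclidean_space" and u :: "'a \<Rightarrow> real"
  assumes u: "loc_int u" and k: "continuous_on UNIV k" "\<And>x. norm x \<ge> \<eta> \<Longrightarrow> k x = 0"
  shows "integrable lborel (\<lambda>y. u y *\<^sub>R k (y - x))"
proof -
  obtain B where B: "B \<ge> 0" "\<And>x y R. norm x \<le> R \<Longrightarrow> norm (k (y - x)) \<le> B * indicat_real (cball 0 (R + \<eta>)) y"
    using shifted_supp_bound[OF k] by blast
  have [measurable]: "u \<in> borel_measurable borel" "k \<in> borel_measurable borel"
    using u k(1) by (auto intro: borel_measurable_continuous_onI loc_int_measurable)
  show ?thesis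
    by (rule loc_int_integrable[OF u, of _ B "norm x + \<eta>"], measurable) (intro conv_bound B order_refl)
qed

lemma conv_continuous:
  fixes k :: "'a::euclidean_space \<Rightarrow> 'b::euclidean_space" and u :: "'a \<Rightarrow> real"
  assumes u: "loc_int u" and k: "continuous_on UNIV k" "\<And>x. norm x \<ge> \<eta> \<Longrightarrow> k x = 0"
  shows "continuous_on UNIV (\<lambda>x. LINT y|lborel. u y *\<^sub>R k (y - x))"
proof -
  obtain B where B: "B \<ge> 0" "\<And>x y R. norm x \<le> R \<Longrightarrow> norm (k (y - x)) \<le> B * indicat_real (cball 0 (R + \<eta>)) y"
    using shifted_supp_bound[OF k] by blast
  have [measurable]: "u \<in> borel_measurable borel" "k \<in> borel_measurable borel"
    using u k(1) by (auto intro: borel_measurable_continuous_onI loc_int_measurable)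
  show ?thesis
  proof (rule continuous_on_sequentiallyI)
    fix X :: "nat \<Rightarrow> 'a" and a assume X: "X \<longlonglongrightarrow> a"
    then obtain R where R: "\<And>n. norm (X n) \<le> R"
      using convergent_imp_bounded[OF X] by (auto simp: bounded_iff)
    show "(\<lambda>n. LINT y|lborel. u y *\<^sub>R k (y - X n)) \<longlonglongrightarrow> (LINT y|lborel. u y *\<^sub>R k (y - a))"
    proof (rule integral_dominated_convergence[OF _ _ loc_int_dom[OF u, of B "R + \<eta>"]])
      show "AE y in lborel. (\<lambda>n. u y *\<^sub>R k (y - X n)) \<longlonglongrightarrow> u y *\<^sub>R k (y - a)"
        by (intro AE_I2 tendsto_intros continuous_on_tendsto_compose[OF k(1)] X) auto
      show "AE y in lborel. norm (u y *\<^sub>R k (y - X n)) \<le> B * (indicat_real (cball 0 (R + \<eta>)) y * norm (u y))" for n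
        by (intro AE_I2 conv_bound B R)
    qed auto
  qed
qed

definition mollify :: "real \<Rightarrow> ('a::euclidean_space \<Rightarrow> real) \<Rightarrow> 'a \<Rightarrow> real" where
  "mollify \<eta> u x = (LINT y|lborel. u y *\<^sub>R kern \<eta> (y - x))"

text \<open>The gradient of \<open>mollify \<eta> u\<close>, with the derivative already moved onto
  the kernel.\<close>

definition mollifyG :: "real \<Rightarrow> ('a::euclidean_space \<Rightarrow> real) \<Rightarrow> 'a \<Rightarrow> 'a" where
  "mollifyG \<eta> u x = (LINT y|lborel. u y *\<^sub>R kernG \<eta> (y - x))"

lemma mollifyG_cont: "loc_int u \<Longrightarrow> 0 < \<eta> \<Longrightarrow> continuous_on UNIV (mollifyG \<eta> u)"
  unfolding mollifyG_def[abs_def] by (rule conv_continuous[OF _ kernG_cont kernG_supp])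

lemma mollify_cont: "loc_int u \<Longrightarrow> 0 < \<eta> \<Longrightarrow> continuous_on UNIV (mollify \<eta> u)"
  unfolding mollify_def[abs_def] by (rule conv_continuous[OF _ kern_cont kern_supp])

section \<open>Approximation, integration by parts and Jensen's inequality for the kernel\<close>

text \<open>The graph of the p-th power lies above its tangent at m. Convexity is available on the
  positive reals, so f = 0 is treated apart, where the claim reduces to (1 - p) m^p \<le> 0.\<close>

lemma powr_tangent:
  fixes p m f :: real
  assumes "1 \<le> p" "0 \<le> f" "0 < m"
  shows "m powr p + p * m powr (p - 1) * (f - m) \<le> f powr p"
proof (cases "f = 0")
  case True
  have "m powr p = m powr (p - 1) * m" using assms powr_mult_base[of m "p - 1"] by (simp add: mult.commute)
  then have "m powr p + p * m powr (p - 1) * (f - m) = (1 - p) * (m powr (p - 1) * m)"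
    using True by (simp add: algebra_simps)
  also have "\<dots> \<le> 0" using assms by (intro mult_nonpos_nonneg) auto
  finally show ?thesis using True by simp
next
  case False
  have "convex_on {0<..} (\<lambda>x. x powr p)" using powr_convex[OF assms(1)] .
  then have "p * m powr (p - 1) * (f - m) \<le> f powr p - m powr p"
    by (rule convex_on_imp_above_tangent)
       (use assms False in \<open>auto intro!: derivative_eq_intros simp: interior_open\<close>)
  then show ?thesis by (simp add: algebra_simps)
qed

lemma integrable_prod_mult:
  fixes a b :: "'a::euclidean_space \<Rightarrow> real"
  assumes a: "integrable lborel a" and b: "integrable lborel b"
  shows "integrable (lborel \<Otimes>\<^sub>M lborel) (\<lambda>(x, y). a x * b y)"
proof (rule lborel_pair.Fubini_integrable)
  have [measurable]: "a \<in> borel_measurable borel" "b \<in> borel_measurable borel" using a b by auto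
  show "(\<lambda>(x, y). a x * b y) \<in> borel_measurable (lborel \<Otimes>\<^sub>M lborel)" by measurable
  have "integrable lborel (\<lambda>x. norm (a x) * (LINT y|lborel. norm (b y)))"
    using a by (intro integrable_mult_left integrable_norm)
  then show "integrable lborel (\<lambda>x. LINT y|lborel. norm (case (x, y) of (x, y) \<Rightarrow> a x * b y))"
    by (simp add: abs_mult)
  show "AE x in lborel. integrable lborel (\<lambda>y. case (x, y) of (x, y) \<Rightarrow> a x * b y)"
    using b by simp
qed

lemma kern_shift_integrable:
  assumes "0 < \<eta>" and F: "continuous_on UNIV (F :: 'a::euclidean_space \<Rightarrow> 'b::euclidean_space)"
  shows "integrable lborel (\<lambda>x. kern \<eta> (x - y) *\<^sub>R F x)"
proof -
  have "continuous_on UNIV (\<lambda>x. kern \<eta> (x - y) *\<^sub>R F x)"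
    by (intro continuous_intros F continuous_on_compose2[OF kern_cont]) auto
  then show ?thesis
  proof (rule continuous_supp_integrable)
    fix x :: 'a assume "norm x \<ge> norm y + \<eta>"
    then have "norm (x - y) \<ge> \<eta>" using norm_triangle_ineq2[of x y] by simp
    then show "kern \<eta> (x - y) *\<^sub>R F x = 0" using assms by (simp add: kern_supp)
  qed
qed

lemma kern_integral_shift:
  assumes "0 < \<eta>"
  shows "(LINT x|lborel. kern \<eta> (x - (y::'a::euclidean_space))) = 1"
  using integral_lborel_shift[of "\<lambda>x::'a. kern \<eta> x" "-y"] kern_integral[OF assms, where 'a='a] by simp

lemma kern_approx_at:
  fixes F :: "'a::euclidean_space \<Rightarrow> 'b::euclidean_space"
  assumes F: "continuous_on UNIV F"
  shows "(\<lambda>n. LINT x|lborel. kern (inverse (real (Suc n))) (x - y) *\<^sub>R F x) \<longlonglongrightarrow> F y"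
proof (rule LIMSEQ_I)
  fix e :: real assume e: "0 < e"
  have "isCont F y" using F by (simp add: continuous_on_eq_continuous_at)
  then obtain d where d: "d > 0" "\<And>x. norm (x - y) < d \<Longrightarrow> norm (F x - F y) < e / 2"
    using e by (auto simp: continuous_at_eps_delta dist_norm dest!: spec[of _ "e/2"])
  obtain N where N: "inverse (real (Suc N)) < d" using d(1) reals_Archimedean by blast
  show "\<exists>no. \<forall>n\<ge>no. norm ((LINT x|lborel. kern (inverse (real (Suc n))) (x - y) *\<^sub>R F x) - F y) < e"
  proof (intro exI allI impI)
    fix n assume n: "N \<le> n"
    define \<eta> where "\<eta> = inverse (real (Suc n))"
    have "\<eta> \<le> inverse (real (Suc N))" using n unfolding \<eta>_def by (intro le_imp_inverse_le) auto
    then have \<eta>: "0 < \<eta>" "\<eta> < d" using N unfolding \<eta>_def by (simp, linarith)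
    have i1: "integrable lborel (\<lambda>x. kern \<eta> (x - y) *\<^sub>R F x)"
      and i2: "integrable lborel (\<lambda>x. kern \<eta> (x - y) *\<^sub>R F y)"
      and i3: "integrable lborel (\<lambda>x. kern \<eta> (x - y) * (e/2))"
      and i4: "integrable lborel (\<lambda>x. kern \<eta> (x - y) *\<^sub>R (F x - F y))"
      using kern_shift_integrable[OF \<eta>(1), of F y] kern_shift_integrable[OF \<eta>(1), of "\<lambda>_. F y" y]
        kern_shift_integrable[OF \<eta>(1), of "\<lambda>_. e/2" y] kern_shift_integrable[OF \<eta>(1), of "\<lambda>x. F x - F y" y]
        continuous_on_diff[OF F continuous_on_const[of _ "F y"]]
      by (auto intro: F continuous_on_const)
    have i0: "integrable lborel (\<lambda>x. kern \<eta> (x - y))"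
      using kern_shift_integrable[OF \<eta>(1), of "\<lambda>_. 1::real" y] by simp
    have "(LINT x|lborel. kern \<eta> (x - y) *\<^sub>R F x) - F y =
      (LINT x|lborel. kern \<eta> (x - y) *\<^sub>R F x) - (LINT x|lborel. kern \<eta> (x - y) *\<^sub>R F y)"
      using i0 by (simp add: kern_integral_shift[OF \<eta>(1)])
    also have "\<dots> = (LINT x|lborel. kern \<eta> (x - y) *\<^sub>R (F x - F y))"
      by (subst Bochner_Integration.integral_diff[OF i1 i2, symmetric]) (simp add: scaleR_diff_right)
    also have "norm \<dots> \<le> (LINT x|lborel. kern \<eta> (x - y) * (e/2))"
    proof (rule Bochner_Integration.integral_norm_bound_integral[OF i4 i3])
      fix x
      show "norm (kern \<eta> (x - y) *\<^sub>R (F x - F y)) \<le> kern \<eta> (x - y) * (e/2)"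
      proof (cases "norm (x - y) < d")
        case True
        show ?thesis using mult_left_mono[OF less_imp_le[OF d(2)[OF True]] kern_nonneg[OF \<eta>(1), of "x-y"]]
            kern_nonneg[OF \<eta>(1), of "x-y"] by simp
      next
        case False then show ?thesis using \<eta> by (simp add: kern_supp)
      qed
    qed
    also have "\<dots> = e/2" by (simp add: kern_integral_shift[OF \<eta>(1)])
    also have "\<dots> < e" using e by simp
    finally show "norm ((LINT x|lborel. kern \<eta> (x - y) *\<^sub>R F x) - F y) < e" .
  qed
qed

text \<open>Integration by parts moves the derivative from the kernel to the test function.\<close>

lemma mollifyG_weak_limit:
  fixes u f f' :: "'a::euclidean_space \<Rightarrow> real"
  assumes u: "loc_int u"
    and f: "continuous_on UNIV f" and f': "continuous_on UNIV f'"
    and supp: "\<And>x. norm x \<ge> R \<Longrightarrow> f x = 0" "\<And>x. norm x \<ge> R \<Longrightarrow> f' x = 0"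
    and der: "\<And>x. ((\<lambda>t. f (x + t *\<^sub>R b)) has_real_derivative f' x) (at 0)"
  shows "(\<lambda>n. LINT x|lborel. (mollifyG (inverse (real (Suc n))) u x \<bullet> b) * f x) \<longlonglongrightarrow>
     - (LINT x|lborel. u x * f' x)"
proof -
  have [measurable]: "u \<in> borel_measurable borel" "f \<in> borel_measurable borel" "f' \<in> borel_measurable borel"
    using u f f' by (auto intro: borel_measurable_continuous_onI loc_int_measurable)
  define \<eta> where "\<eta> n = inverse (real (Suc n))" for n
  have \<eta>: "0 < \<eta> n" "\<eta> n \<le> 1" for n by (auto simp: \<eta>_def field_simps)
  obtain Bf where Bf: "Bf \<ge> 0" "\<And>x. norm (f x) \<le> Bf * indicat_real (cball 0 R) x"
    using continuous_supp_bounded[OF f supp(1)] by blast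
  obtain B' where B': "B' \<ge> 0" "\<And>x. norm (f' x) \<le> B' * indicat_real (cball 0 R) x"
    using continuous_supp_bounded[OF f' supp(2)] by blast
  define c where "c n y = (LINT x|lborel. kern (\<eta> n) (x - y) * f' x)" for n y
  have c_meas [measurable]: "c n \<in> borel_measurable borel" for n unfolding c_def by measurable
  \<comment> \<open>For fixed y the product of \<open>kern (\<eta> n) (x - y)\<close> and f has
    compact support, so its derivative along b integrates to zero; evenness of the kernel turns this
    into an exchange of \<open>kernG\<close> against f for \<open>kern\<close> against
    \<open>f'\<close>.\<close>
  have inner: "(LINT x|lborel. u y * (kernG (\<eta> n) (y - x) \<bullet> b) * f x) = - (u y * c n y)" for n y
  proof -
    have "(LINT x|lborel. (kernG (\<eta> n) (y - x) \<bullet> b) * f x + kern (\<eta> n) (x - y) * f' x) = 0"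
    proof (rule integral_directional_derivative_eq_0[where F = "\<lambda>x. kern (\<eta> n) (x - y) * f x" and R = R and b = b])
      show "continuous_on UNIV (\<lambda>x. kern (\<eta> n) (x - y) * f x)"
        by (intro continuous_intros f continuous_on_compose2[OF kern_cont]) auto
      show "continuous_on UNIV (\<lambda>x. (kernG (\<eta> n) (y - x) \<bullet> b) * f x + kern (\<eta> n) (x - y) * f' x)"
        by (intro continuous_intros f f' continuous_on_compose2[OF kern_cont] continuous_on_compose2[OF kernG_cont]) auto
      fix x
      show "((\<lambda>t. kern (\<eta> n) (x + t *\<^sub>R b - y) * f (x + t *\<^sub>R b)) has_real_derivative
         (kernG (\<eta> n) (y - x) \<bullet> b) * f x + kern (\<eta> n) (x - y) * f' x) (at 0)"
        unfolding kern_even[of _ _ y]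
        using DERIV_mult[OF kern_deriv[OF \<eta>(1)] der[of x], of n y x] by (simp add: mult.commute)
    qed (use supp in auto)
    moreover have "integrable lborel (\<lambda>x. kern (\<eta> n) (x - y) * f' x)"
      using kern_shift_integrable[OF \<eta>(1) f', of n y] by simp
    moreover have "integrable lborel (\<lambda>x. (kernG (\<eta> n) (y - x) \<bullet> b) * f x)"
      by (rule continuous_supp_integrable[where R=R])
         (use supp in \<open>auto intro!: continuous_intros f continuous_on_compose2[OF kernG_cont]\<close>)
    ultimately have "(LINT x|lborel. (kernG (\<eta> n) (y - x) \<bullet> b) * f x) = - c n y"
      by (simp add: c_def)
    then show ?thesis by (simp add: mult.assoc)
  qed
  have eq: "(LINT x|lborel. (mollifyG (\<eta> n) u x \<bullet> b) * f x) = (LINT y|lborel. - (u y * c n y))" for n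
  proof -
    define F where "F x y = u y * (kernG (\<eta> n) (y - x) \<bullet> b) * f x" for x y
    obtain B where B: "B \<ge> 0" "\<And>(x::'a) y R. norm x \<le> R \<Longrightarrow> norm (kernG (\<eta> n) (y - x)) \<le> B * indicat_real (cball 0 (R + \<eta> n)) y"
      using shifted_supp_bound[OF kernG_cont kernG_supp[OF \<eta>(1)]] by blast
    \<comment> \<open>Fubini applies because f confines x to a ball, and the kernel then confines y
      to a larger ball on which u is integrable.\<close>
    have "integrable (lborel \<Otimes>\<^sub>M lborel) (\<lambda>(x, y). F x y)"
    proof (rule Bochner_Integration.integrable_bound[OF integrable_prod_mult[OF integrable_indicator_cball[of "Bf * norm b" 0 R]
          loc_int_dom[OF u, of B "R + \<eta> n"]]], goal_cases)
      case 1 show ?case unfolding F_def by measurable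
    next
      case 2
      have "norm (F x y) \<le> Bf * norm b * indicat_real (cball 0 R) x * (B * (indicat_real (cball 0 (R + \<eta> n)) y * norm (u y)))" for x y
      proof (cases "x \<in> cball 0 R")
        case True
        have "\<bar>kernG (\<eta> n) (y - x) \<bullet> b\<bar> \<le> norm (kernG (\<eta> n) (y - x)) * norm b" by (rule Cauchy_Schwarz_ineq2)
        also have "\<dots> \<le> B * indicat_real (cball 0 (R + \<eta> n)) y * norm b"
          using B(2)[of x R y] True by (intro mult_right_mono) (auto simp: dist_norm)
        finally have k: "\<bar>kernG (\<eta> n) (y - x) \<bullet> b\<bar> \<le> B * indicat_real (cball 0 (R + \<eta> n)) y * norm b" .
        have "norm (F x y) = \<bar>u y\<bar> * (\<bar>kernG (\<eta> n) (y - x) \<bullet> b\<bar> * \<bar>f x\<bar>)"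
          by (simp add: F_def abs_mult mult_ac)
        also have "\<dots> \<le> \<bar>u y\<bar> * (B * indicat_real (cball 0 (R + \<eta> n)) y * norm b * Bf)"
          using Bf(2)[of x] True k B(1) by (intro mult_left_mono mult_mono) auto
        finally show ?thesis using True by (simp add: mult_ac)
      next
        case False then show ?thesis using Bf(2)[of x] by (simp add: F_def)
      qed
      then show ?case by (auto intro!: AE_I2 order_trans[OF _ abs_ge_self])
    qed
    then have "(LINT y|lborel. LINT x|lborel. F x y) = (LINT x|lborel. LINT y|lborel. F x y)"
      by (rule lborel_pair.Fubini_integral)
    moreover have "(LINT y|lborel. F x y) = (mollifyG (\<eta> n) u x \<bullet> b) * f x" for x
    proof -
      have "(LINT y|lborel. F x y) = (LINT y|lborel. (u y *\<^sub>R kernG (\<eta> n) (y - x)) \<bullet> b) * f x"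
        by (simp add: F_def)
      also have "(LINT y|lborel. (u y *\<^sub>R kernG (\<eta> n) (y - x)) \<bullet> b) = mollifyG (\<eta> n) u x \<bullet> b"
        unfolding mollifyG_def
        by (rule integral_inner_left) (intro conv_integrable[OF u kernG_cont kernG_supp[OF \<eta>(1)]])
      finally show ?thesis .
    qed
    ultimately have "(LINT x|lborel. (mollifyG (\<eta> n) u x \<bullet> b) * f x) = (LINT y|lborel. LINT x|lborel. F x y)"
      by presburger
    also have "\<dots> = (LINT y|lborel. - (u y * c n y))" unfolding F_def inner ..
    finally show ?thesis .
  qed
  have "(\<lambda>n. LINT y|lborel. - (u y * c n y)) \<longlonglongrightarrow> (LINT y|lborel. - (u y * f' y))"
  proof (rule integral_dominated_convergence[OF _ _ loc_int_dom[OF u, of B' "R + 1"]])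
    show "AE y in lborel. (\<lambda>n. - (u y * c n y)) \<longlonglongrightarrow> - (u y * f' y)"
      using kern_approx_at[OF f'] by (intro AE_I2 tendsto_intros) (simp add: c_def \<eta>_def)
    fix n
    \<comment> \<open>Averaging preserves the bound on \<open>f'\<close> and, since the scales are
      at most 1, enlarges the support by at most 1: a dominating function independent of n.\<close>
    have "norm (c n y) \<le> B' * indicat_real (cball 0 (R + 1)) y" for y :: 'a
    proof (cases "y \<in> cball 0 (R + 1)")
      case True
      have "norm (c n y) \<le> (LINT x::'a|lborel. kern (\<eta> n) (x - y) * B')"
        unfolding c_def
      proof (rule Bochner_Integration.integral_norm_bound_integral)
        show "integrable lborel (\<lambda>x. kern (\<eta> n) (x - y) * f' x)" "integrable lborel (\<lambda>x. kern (\<eta> n) (x - y) * B')"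
          using kern_shift_integrable[OF \<eta>(1) f', of n y] kern_shift_integrable[OF \<eta>(1), of "\<lambda>_. B'" n y] by auto
        fix x
        have "\<bar>f' x\<bar> \<le> B'" using B'(2)[of x] B'(1) by (cases "x \<in> cball 0 R") auto
        then show "norm (kern (\<eta> n) (x - y) * f' x) \<le> kern (\<eta> n) (x - y) * B'"
          using kern_nonneg[OF \<eta>(1), of n "x-y"] by (simp add: abs_mult mult_left_mono)
      qed
      also have "\<dots> = B'" by (simp add: kern_integral_shift[OF \<eta>(1)])
      finally show ?thesis using True by simp
    next
      case False
      have "(\<lambda>x. kern (\<eta> n) (x - y) * f' x) = (\<lambda>x. 0)"
      proof
        fix x
        show "kern (\<eta> n) (x - y) * f' x = 0"
      proof (cases "norm x \<ge> R")
        case False2: False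
        have "norm (x - y) \<ge> norm y - norm x" using norm_triangle_ineq2[of y x] by (simp add: norm_minus_commute)
        then have "norm (x - y) \<ge> \<eta> n" using False False2 \<eta>(2)[of n] by simp
        then show ?thesis by (simp add: kern_supp[OF \<eta>(1)])
        qed (simp add: supp)
      qed
      then have "c n y = 0" unfolding c_def by simp
      then show ?thesis using False by simp
    qed
    then show "AE y in lborel. norm (- (u y * c n y)) \<le> B' * (indicat_real (cball 0 (R + 1)) y * norm (u y))"
    proof (intro AE_I2)
      fix y
      assume le: "\<And>y. norm (c n y) \<le> B' * indicat_real (cball 0 (R + 1)) y"
      show "norm (- (u y * c n y)) \<le> B' * (indicat_real (cball 0 (R + 1)) y * norm (u y))"
        using mult_right_mono[OF le[of y] norm_ge_zero[of "u y"]] by (simp add: abs_mult mult_ac)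
    qed
  qed auto
  then show ?thesis using eq by (simp add: \<eta>_def)
qed

text \<open>The tangent inequality at the mean m is integrated against the kernel, a probability
  density; the linear term cancels. An infinite right-hand side is trivial, a finite one supplies
  integrability, and m = 0 is apart because the tangent is taken at a positive point.\<close>

lemma kern_jensen:
  fixes f :: "'a::euclidean_space \<Rightarrow> real"
  assumes p: "1 \<le> p" and \<eta>: "0 < \<eta>" and f: "\<And>y. 0 \<le> f y"
    and fi: "integrable lborel (\<lambda>y. kern \<eta> (y - x) * f y)" and [measurable]: "f \<in> borel_measurable borel"
  shows "ennreal ((LINT y|lborel. kern \<eta> (y - x) * f y) powr p) \<le> (\<integral>\<^sup>+y. ennreal (kern \<eta> (y - x) * f y powr p) \<partial>lborel)"
proof (cases "(\<integral>\<^sup>+y. ennreal (kern \<eta> (y - x) * f y powr p) \<partial>lborel) = \<infinity>")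
  case False
  define m where "m = (LINT y|lborel. kern \<eta> (y - x) * f y)"
  have k: "0 \<le> kern \<eta> (y - x)" for y by (rule kern_nonneg[OF \<eta>])
  have m: "m \<ge> 0" unfolding m_def by (intro integral_nonneg_AE AE_I2 mult_nonneg_nonneg k f)
  have fpi: "integrable lborel (\<lambda>y. kern \<eta> (y - x) * f y powr p)"
    using False k by (intro integrableI_nonneg) (auto simp: less_top)
  have ki: "integrable lborel (\<lambda>y. kern \<eta> (y - x))"
    using kern_shift_integrable[OF \<eta>, of "\<lambda>_. 1::real" x] by simp
  have "m powr p \<le> (LINT y|lborel. kern \<eta> (y - x) * f y powr p)"
  proof (cases "m = 0")
    case True
    then show ?thesis using k by (auto intro!: integral_nonneg_AE)
  next
    case False
    define a where "a = p * m powr (p - 1)"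
    have "m powr p = (LINT y|lborel. kern \<eta> (y - x) * (m powr p - a * m) + a * (kern \<eta> (y - x) * f y))"
      using ki fi by (simp add: kern_integral_shift[OF \<eta>] m_def[symmetric])
    also have "\<dots> \<le> (LINT y|lborel. kern \<eta> (y - x) * f y powr p)"
    proof (rule integral_mono)
      show "integrable lborel (\<lambda>y. kern \<eta> (y - x) * (m powr p - a * m) + a * (kern \<eta> (y - x) * f y))"
        using ki fi by auto
      fix y
      have "kern \<eta> (y - x) * (m powr p + a * (f y - m)) \<le> kern \<eta> (y - x) * f y powr p"
        using powr_tangent[OF p f, of m y] False m k unfolding a_def by (intro mult_left_mono) auto
      then show "kern \<eta> (y - x) * (m powr p - a * m) + a * (kern \<eta> (y - x) * f y) \<le> kern \<eta> (y - x) * f y powr p"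
        by (simp add: algebra_simps)
    qed (rule fpi)
    finally show ?thesis .
  qed
  then have "ennreal (m powr p) \<le> ennreal (LINT y|lborel. kern \<eta> (y - x) * f y powr p)"
    by (rule ennreal_leI)
  also have "ennreal (LINT y|lborel. kern \<eta> (y - x) * f y powr p) = (\<integral>\<^sup>+y. ennreal (kern \<eta> (y - x) * f y powr p) \<partial>lborel)"
    by (rule nn_integral_eq_integral[symmetric, OF fpi]) (use k in auto)
  finally show ?thesis unfolding m_def by simp
qed simp

text \<open>Tonelli and the unit mass of the kernel. The sets A and B keep the estimate local,
  because the differences of u are controlled only for base points in balls.\<close>

lemma kern_conv_nn_integral_le:
  fixes g :: "'a::euclidean_space \<Rightarrow> ennreal"
  assumes \<eta>: "0 < \<eta>" and [measurable]: "g \<in> borel_measurable borel" "A \<in> sets borel" "B \<in> sets borel"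
    and AB: "\<And>x y. x \<in> A \<Longrightarrow> norm (y - x) < \<eta> \<Longrightarrow> y \<in> B"
  shows "(\<integral>\<^sup>+x\<in>A. (\<integral>\<^sup>+y. ennreal (kern \<eta> (y - x)) * g y \<partial>lborel) \<partial>lborel) \<le> (\<integral>\<^sup>+y\<in>B. g y \<partial>lborel)"
proof -
  have "(\<integral>\<^sup>+x\<in>A. (\<integral>\<^sup>+y. ennreal (kern \<eta> (y - x)) * g y \<partial>lborel) \<partial>lborel)
      = (\<integral>\<^sup>+x. (\<integral>\<^sup>+y. ennreal (kern \<eta> (y - x)) * g y * indicator A x \<partial>lborel) \<partial>lborel)"
    by (subst nn_integral_multc) auto
  also have "\<dots> \<le> (\<integral>\<^sup>+x. (\<integral>\<^sup>+y. ennreal (kern \<eta> (y - x)) * (g y * indicator B y) \<partial>lborel) \<partial>lborel)"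
  proof (intro nn_integral_mono)
    fix x y
    show "ennreal (kern \<eta> (y - x)) * g y * indicator A x \<le> ennreal (kern \<eta> (y - x)) * (g y * indicator B y)"
      using AB[of x y] kern_supp[OF \<eta>, of "y - x"] by (cases "norm (y - x) < \<eta>") (auto simp: indicator_def)
  qed
  also have "\<dots> = (\<integral>\<^sup>+y. (\<integral>\<^sup>+x. ennreal (kern \<eta> (y - x)) * (g y * indicator B y) \<partial>lborel) \<partial>lborel)"
    by (rule lborel_pair.Fubini') measurable
  also have "\<dots> = (\<integral>\<^sup>+y. 1 * (g y * indicator B y) \<partial>lborel)"
    by (subst nn_integral_multc) (auto simp: kern_nn_integral[OF \<eta>])
  finally show ?thesis by simp
qed

section \<open>Rotation invariance and polar coordinates\<close>

lemma cball_sets_borel [measurable]: "cball c r \<in> sets (borel :: 'a::euclidean_space measure)"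
  by simp

lemma ball_sets_borel [measurable]: "ball c r \<in> sets (borel :: 'a::euclidean_space measure)"
  by simp

text \<open>Uniqueness of Haar measure: the image measure is translation invariant, and computing
  the measure of \<open>{(x, y). T x \<in> A \<and> T x - y \<in> ball 0 1}\<close> in two ways identifies it.\<close>

lemma emeasure_lborel_vimage_isometry:
  fixes T :: "'a::euclidean_space \<Rightarrow> 'a"
  assumes "linear T" and inv: "\<And>x. T (T x) = x" and nrm: "\<And>x. norm (T x) = norm x"
    and [measurable]: "A \<in> sets borel"
  shows "emeasure lborel (T -` A) = emeasure lborel A"
proof -
  interpret T: linear T by fact
  have [measurable]: "T \<in> borel_measurable borel"
    using linear_continuous_on[OF linear_conv_bounded_linear[THEN iffD1, OF \<open>linear T\<close>], of UNIV]
    by (rule borel_measurable_continuous_onI)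
  define B where "B = ball (0::'a) 1"
  have TA: "T -` A \<in> sets borel" using measurable_sets_borel[of T borel A] by simp
  have indT: "(indicator C (T x) :: ennreal) = indicator (T -` C) x" for C x by (simp add: indicator_def)
  have [measurable]: "B \<in> sets borel" by (simp add: B_def)
  have TB: "T -` B = B" by (auto simp: B_def nrm)
  have symB: "(indicator B (- y) :: ennreal) = indicator B y" for y by (simp add: B_def indicator_def)
  have "emeasure lborel (T -` A) * emeasure lborel B =
     (\<integral>\<^sup>+x. indicator A (T x) * (\<integral>\<^sup>+y. indicator B (T x - y) \<partial>lborel) \<partial>lborel)"
    using TA by (simp add: nn_integral_lborel_reflect[of "indicator B :: 'a \<Rightarrow> ennreal"] nn_integral_multc indT)
  also have "\<dots> = (\<integral>\<^sup>+x. (\<integral>\<^sup>+y. indicator A (T x) * indicator B (T x - y) \<partial>lborel) \<partial>lborel)"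
    by (simp add: nn_integral_cmult)
  also have "\<dots> = (\<integral>\<^sup>+y. (\<integral>\<^sup>+x. indicator A (T x) * indicator B (T x - y) \<partial>lborel) \<partial>lborel)"
    by (rule lborel_pair.Fubini') measurable
  \<comment> \<open>Translating x by T y turns T x - y into T x, since T (T y) = y; the dependence
    on y moves from the ball to A.\<close>
  also have "\<dots> = (\<integral>\<^sup>+y. (\<integral>\<^sup>+x. indicator A (T x + y) * indicator B (T x) \<partial>lborel) \<partial>lborel)"
    by (subst nn_integral_lborel_shift[of "\<lambda>x. indicator A (T x) * indicator B (T x - y)" "T y" for y, symmetric])
       (auto simp: T.add inv)
  also have "\<dots> = (\<integral>\<^sup>+x. (\<integral>\<^sup>+y. indicator A (T x + y) * indicator B (T x) \<partial>lborel) \<partial>lborel)"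
    by (rule lborel_pair.Fubini') measurable
  also have "\<dots> = (\<integral>\<^sup>+x. emeasure lborel A * indicator B (T x) \<partial>lborel)"
    by (simp add: nn_integral_multc add.commute[of "T _"] nn_integral_lborel_shift[of "indicator A :: 'a \<Rightarrow> ennreal"])
  also have "\<dots> = emeasure lborel A * emeasure lborel B"
    by (simp add: nn_integral_cmult indT TB)
  finally have "emeasure lborel B * emeasure lborel (T -` A) = emeasure lborel B * emeasure lborel A"
    by (simp only: mult.commute)
  moreover have "emeasure lborel B \<noteq> 0" "emeasure lborel B \<noteq> top"
    using emeasure_lborel_ball_finite[of "0::'a" 1] content_ball_pos[of 1 "0::'a"]
    by (auto simp: B_def emeasure_eq_ennreal_measure)
  ultimately show ?thesis by (simp add: ennreal_mult_cancel_left)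
qed

lemma nn_integral_lborel_isometry:
  fixes T :: "'a::euclidean_space \<Rightarrow> 'a"
  assumes "linear T" and inv: "\<And>x. T (T x) = x" and nrm: "\<And>x. norm (T x) = norm x"
    and [measurable]: "f \<in> borel_measurable borel"
  shows "(\<integral>\<^sup>+x. f (T x) \<partial>lborel) = (\<integral>\<^sup>+x. f x \<partial>lborel)"
proof -
  have [measurable]: "T \<in> borel_measurable borel"
    using linear_continuous_on[OF linear_conv_bounded_linear[THEN iffD1, OF \<open>linear T\<close>], of UNIV]
    by (rule borel_measurable_continuous_onI)
  have "distr lborel borel T = lborel"
    by (rule measure_eqI)
       (simp_all add: emeasure_distr emeasure_lborel_vimage_isometry[OF assms(1-3)])
  then have "(\<integral>\<^sup>+x. f x \<partial>lborel) = (\<integral>\<^sup>+x. f x \<partial>distr lborel borel T)" by simp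
  also have "\<dots> = (\<integral>\<^sup>+x. f (T x) \<partial>lborel)" by (rule nn_integral_distr) auto
  finally show ?thesis by simp
qed

text \<open>The reflection in the hyperplane orthogonal to e - w exchanges e and w because they have
  equal length. Being its own inverse, it can be used where
  \<open>emeasure_lborel_vimage_isometry\<close> asks for an involution, so general rotations are
  avoided.\<close>

lemma reflection_exists:
  fixes e w :: "'a::euclidean_space"
  assumes "norm e = norm w"
  obtains T where "linear T" "\<And>x. T (T x) = x" "\<And>x. norm (T x) = norm x"
    "\<And>x y. T x \<bullet> y = x \<bullet> T y" "T e = w"
proof (cases "e = w")
  case True
  then show thesis using that[of id] by (auto intro: linear_id)
next
  case False
  define v where "v = e - w"
  have v: "v \<noteq> 0" using False by (simp add: v_def)
  define T where "T x = x - (2 * (x \<bullet> v) / (v \<bullet> v)) *\<^sub>R v" for x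
  show thesis
  proof (rule that[of T])
    show "linear T" unfolding T_def
      by (rule linearI) (auto simp: inner_simps algebra_simps add_divide_distrib)
    have Tv: "T x \<bullet> v = - (x \<bullet> v)" for x using v by (simp add: T_def inner_simps)
    show "T (T x) = x" for x
    proof -
      have "T (T x) = T x - (2 * (T x \<bullet> v) / (v \<bullet> v)) *\<^sub>R v" by (simp only: T_def)
      also have "\<dots> = x" unfolding Tv by (simp add: T_def)
      finally show ?thesis .
    qed
    show sa: "T x \<bullet> y = x \<bullet> T y" for x y by (simp add: T_def inner_simps inner_commute)
    show "norm (T x) = norm x" for x
      using sa[of x "T x"] \<open>\<And>x. T (T x) = x\<close> by (simp add: norm_eq_sqrt_inner)
    have "v \<bullet> v = 2 * (e \<bullet> v)"
      using assms by (simp add: v_def inner_simps inner_commute norm_eq_sqrt_inner)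
    then have "2 * (e \<bullet> v) / (v \<bullet> v) = 1" using v by (metis divide_self inner_eq_zero_iff)
    then have "T e = e - v" by (simp only: T_def) simp
    then show "T e = w" by (simp add: v_def)
  qed
qed

section \<open>The constant K as an integral over the unit ball\<close>

text \<open>Since the integrand is constant along rays, this is the sphere integral divided by N.
  The argument w need not be a unit vector: it will be the gradient at a point.\<close>

definition K_ball :: "'a::euclidean_space \<Rightarrow> real \<Rightarrow> ennreal" where
  "K_ball w p = (\<integral>\<^sup>+h\<in>ball 0 1. ennreal (\<bar>w \<bullet> sgn h\<bar> powr p) \<partial>lborel)"

lemma sgn_measurable [measurable]: "(sgn :: 'a::euclidean_space \<Rightarrow> 'a) \<in> borel_measurable borel"
  unfolding sgn_div_norm[abs_def] by measurable

lemma K_ball_eq: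
  fixes e w :: "'a::euclidean_space"
  assumes "norm e = norm w"
  shows "K_ball e p = K_ball w p"
proof -
  obtain T :: "'a \<Rightarrow> 'a" where T: "linear T" "\<And>x. T (T x) = x" "\<And>x. norm (T x) = norm x"
    "\<And>x y. T x \<bullet> y = x \<bullet> T y" "T e = w" using reflection_exists[OF assms] by blast
  have "T (sgn h) = sgn (T h)" for h
    by (simp add: sgn_div_norm T linear_scale[OF T(1)])
  then have w: "w \<bullet> sgn h = e \<bullet> sgn (T h)" for h using T(4)[of e "sgn h"] T(5) by simp
  have "K_ball w p = (\<integral>\<^sup>+h. (\<lambda>h. ennreal (\<bar>e \<bullet> sgn h\<bar> powr p) * indicator (ball 0 1) h) (T h) \<partial>lborel)"
    unfolding K_ball_def w by (intro nn_integral_cong) (simp add: T indicator_def)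
  also have "\<dots> = K_ball e p"
    unfolding K_ball_def by (rule nn_integral_lborel_isometry) (use T in auto)
  finally show ?thesis ..
qed

text \<open>Rotation invariance reduces w to a multiple of e, and homogeneity extracts the factor.
  This is what converts an average of directional derivatives into the norm of the gradient.\<close>

lemma K_ball_scale:
  fixes e w :: "'a::euclidean_space"
  assumes "norm e = 1" and p: "1 \<le> p"
  shows "K_ball w p = ennreal (norm w powr p) * K_ball e p"
proof -
  have "K_ball w p = K_ball (norm w *\<^sub>R e) p" by (rule K_ball_eq) (simp add: assms)
  also have "\<dots> = (\<integral>\<^sup>+h. ennreal (norm w powr p) * (ennreal (\<bar>e \<bullet> sgn h\<bar> powr p) * indicator (ball 0 1) h) \<partial>lborel)"
    unfolding K_ball_def
    by (intro nn_integral_cong) (simp add: abs_mult powr_mult ennreal_mult mult.assoc)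
  also have "\<dots> = ennreal (norm w powr p) * K_ball e p"
    unfolding K_ball_def by (rule nn_integral_cmult) measurable
  finally show ?thesis .
qed

lemma K_ball_finite:
  fixes e :: "'a::euclidean_space"
  assumes "norm e = 1" and p: "1 \<le> p"
  shows "K_ball e p < \<infinity>"
proof -
  have "K_ball e p \<le> (\<integral>\<^sup>+h. indicator (ball (0::'a) 1) h \<partial>lborel)"
    unfolding K_ball_def
  proof (intro nn_integral_mono)
    fix h :: 'a
    have "\<bar>e \<bullet> sgn h\<bar> \<le> 1" using Cauchy_Schwarz_ineq2[of e "sgn h"] assms(1)
      by (cases "h = 0") (auto simp: norm_sgn)
    then have "\<bar>e \<bullet> sgn h\<bar> powr p \<le> 1" using p by (intro powr_le1) auto
    then show "ennreal (\<bar>e \<bullet> sgn h\<bar> powr p) * indicator (ball 0 1) h \<le> indicator (ball 0 1) h"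
      by (auto simp: indicator_def)
  qed
  also have "\<dots> < \<infinity>" using emeasure_lborel_ball_finite[of "0::'a" 1] by simp
  finally show ?thesis .
qed

text \<open>The integrand is positive on the open half ball where e and h have positive inner
  product. Positivity is what later permits dividing by K to bound the energy of the
  gradient.\<close>

lemma K_ball_pos:
  fixes e :: "'a::euclidean_space"
  assumes "norm e = 1"
  shows "0 < K_ball e p"
proof -
  define U where "U = ball (0::'a) 1 \<inter> {h. 0 < e \<bullet> h}"
  have "open U" unfolding U_def by (intro open_Int open_ball open_halfspace_gt)
  moreover have "(1/2) *\<^sub>R e \<in> U" using assms norm_eq_1[of e] by (simp add: U_def)
  ultimately have "\<not> negligible U" using open_not_negligible by blast
  then have U: "emeasure lborel U \<noteq> 0" using \<open>open U\<close>
    by (simp add: negligible_iff_null_sets null_sets_def)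
  have [measurable]: "U \<in> sets borel" using \<open>open U\<close> by simp
  have "\<not> (AE h in lborel. h \<notin> U)"
    using U \<open>open U\<close> AE_iff_measurable[of U lborel "\<lambda>h. h \<notin> U"] by simp
  moreover have "AE h in lborel. h \<notin> U" if "K_ball e p = 0"
  proof -
    have "AE h in lborel. ennreal (\<bar>e \<bullet> sgn h\<bar> powr p) * indicator (ball 0 1) h = 0"
      using that unfolding K_ball_def by (subst (asm) nn_integral_0_iff_AE) auto
    then show ?thesis
      by eventually_elim (auto simp: U_def sgn_div_norm indicator_def split: if_splits)
  qed
  ultimately show ?thesis by (auto simp: zero_less_iff_neq_zero)
qed

lemma K_const_eq: "K_const (e::'a::euclidean_space) p = of_nat DIM('a) * K_ball e p"
proof -
  have [measurable]: "sgn \<in> measurable (restrict_space lborel (ball 0 1 - {0})) (restrict_space borel (sphere (0::'a) 1))"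
    by (intro measurable_restrict_space2 measurable_restrict_space1) (auto simp: norm_sgn)
  have m: "(\<lambda>\<sigma>. ennreal (\<bar>e \<bullet> \<sigma>\<bar> powr p)) \<in> borel_measurable (restrict_space borel (sphere 0 1))"
    by (intro measurable_restrict_space1) measurable
  have "K_const e p = of_nat DIM('a) * (\<integral>\<^sup>+h\<in>ball 0 1 - {0}. ennreal (\<bar>e \<bullet> sgn h\<bar> powr p) \<partial>lborel)"
    unfolding K_const_def sphere_measure_def using m
    by (subst nn_integral_scale_measure) (auto simp: nn_integral_distr nn_integral_restrict_space)
  also have "(\<integral>\<^sup>+h\<in>ball 0 1 - {0}. ennreal (\<bar>e \<bullet> sgn h\<bar> powr p) \<partial>lborel) = K_ball e p"
    unfolding K_ball_def
    by (rule nn_integral_cong_AE, rule AE_mp[OF AE_lborel_singleton[of 0]]) (auto simp: indicator_def)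
  finally show ?thesis .
qed

lemma nn_integral_ball_sgn:
  fixes f :: "'a::euclidean_space \<Rightarrow> ennreal"
  assumes [measurable]: "f \<in> borel_measurable borel" and t: "0 < t"
  shows "(\<integral>\<^sup>+h\<in>ball 0 t. f (sgn h) \<partial>lborel) = ennreal (t ^ DIM('a)) * (\<integral>\<^sup>+h\<in>ball 0 1. f (sgn h) \<partial>lborel)"
proof -
  have "(\<integral>\<^sup>+h\<in>ball 0 t. f (sgn h) \<partial>lborel) =
     ennreal (\<bar>t\<bar> ^ DIM('a)) * (\<integral>\<^sup>+h. f (sgn (0 + t *\<^sub>R h)) * indicator (ball 0 t) (0 + t *\<^sub>R h) \<partial>lborel)"
    by (rule nn_integral_lborel_affine) (use t in auto)
  also have "(\<integral>\<^sup>+h. f (sgn (0 + t *\<^sub>R h)) * indicator (ball 0 t) (0 + t *\<^sub>R h) \<partial>lborel) = (\<integral>\<^sup>+h\<in>ball 0 1. f (sgn h) \<partial>lborel)"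
    using t by (intro nn_integral_cong) (auto simp: sgn_scaleR indicator_def)
  finally show ?thesis using t by simp
qed

lemma nn_integral_powr_from_0:
  assumes "0 < \<epsilon>" "0 < \<delta>"
  shows "(\<integral>\<^sup>+t\<in>{0<..<\<delta>}. ennreal (t powr (\<epsilon> - 1)) \<partial>lborel) = ennreal (\<delta> powr \<epsilon> / \<epsilon>)"
proof -
  have "((\<lambda>t. t powr (\<epsilon> - 1)) has_integral (\<delta> powr \<epsilon> / \<epsilon>)) {0..\<delta>}"
    using has_integral_powr_from_0[of "\<epsilon> - 1" \<delta>] assms by simp
  then have "(\<integral>\<^sup>+t. ennreal (t powr (\<epsilon> - 1)) * indicator {0..\<delta>} t \<partial>lborel) = ennreal (\<delta> powr \<epsilon> / \<epsilon>)"
    by (intro nn_integral_has_integral_lebesgue') auto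
  also have "(\<integral>\<^sup>+t. ennreal (t powr (\<epsilon> - 1)) * indicator {0..\<delta>} t \<partial>lborel) = (\<integral>\<^sup>+t\<in>{0<..<\<delta>}. ennreal (t powr (\<epsilon> - 1)) \<partial>lborel)"
    by (rule nn_integral_cong_AE, rule AE_mp[OF AE_lborel_singleton[of \<delta>]]) (auto simp: indicator_def)
  finally show ?thesis by simp
qed

text \<open>Polar coordinates for the kernel \<open>\<bar>h\<bar>\<^sup>\<epsilon>\<^sup>-\<^sup>N\<close>, by writing it as a superposition of indicators of balls.\<close>

lemma polar_kernel:
  fixes f :: "'a::euclidean_space \<Rightarrow> ennreal"
  assumes [measurable]: "f \<in> borel_measurable borel" and \<epsilon>: "0 < \<epsilon>" "\<epsilon> < 1" and \<delta>: "0 < \<delta>"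
  shows "ennreal \<epsilon> * (\<integral>\<^sup>+h\<in>ball 0 \<delta>. ennreal (norm h powr (\<epsilon> - real DIM('a))) * f (sgn h) \<partial>lborel)
     = ennreal (\<delta> powr \<epsilon>) * (of_nat DIM('a) * (\<integral>\<^sup>+h\<in>ball 0 1. f (sgn h) \<partial>lborel))"
proof -
  define N where "N = real DIM('a)"
  have N: "N \<ge> 1" by (simp add: N_def Suc_leI DIM_positive)
  define c where "c = (\<integral>\<^sup>+h\<in>ball (0::'a) 1. f (sgn h) \<partial>lborel)"
  \<comment> \<open>\<open>?k\<close> is minus the derivative of t^(\<epsilon> - N), nonnegative
    since \<epsilon> < 1 \<le> N. The power of |h| is thus its value at \<delta> plus the integral
    of \<open>?k\<close> over all radii t < \<delta> whose ball contains h.\<close>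
  let ?k = "\<lambda>t. ennreal ((N - \<epsilon>) * t powr (\<epsilon> - N - 1))"
  have split: "ennreal (r powr (\<epsilon> - N)) = ennreal (\<delta> powr (\<epsilon> - N)) + (\<integral>\<^sup>+t. ?k t * indicator {r<..<\<delta>} t \<partial>lborel)"
    if r: "0 < r" "r < \<delta>" for r
  proof -
    have "(\<integral>\<^sup>+t. ?k t * indicator {r..\<delta>} t \<partial>lborel) = ennreal (- (\<delta> powr (\<epsilon> - N)) - - (r powr (\<epsilon> - N)))"
      by (rule nn_integral_FTC_Icc)
         (use r \<epsilon> N in \<open>auto intro!: derivative_eq_intros simp: algebra_simps\<close>)
    also have "(\<integral>\<^sup>+t. ?k t * indicator {r..\<delta>} t \<partial>lborel) =
       (\<integral>\<^sup>+t. ?k t * indicator {r<..<\<delta>} t \<partial>lborel)"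
      by (rule nn_integral_cong_AE, rule AE_mp[OF AE_lborel_singleton[of \<delta>]], rule AE_mp[OF AE_lborel_singleton[of r]])
         (auto simp: indicator_def)
    finally show ?thesis
      using powr_mono2'[of "\<epsilon> - N" r \<delta>] r \<epsilon> N by (simp add: ennreal_plus[symmetric] del: ennreal_plus)
  qed
  have "(\<integral>\<^sup>+h\<in>ball 0 \<delta>. ennreal (norm h powr (\<epsilon> - N)) * f (sgn h) \<partial>lborel) =
    (\<integral>\<^sup>+h. ennreal (\<delta> powr (\<epsilon> - N)) * (f (sgn h) * indicator (ball 0 \<delta>) h) +
      (\<integral>\<^sup>+t. (f (sgn h) * indicator (ball 0 t) h) * (?k t * indicator {0<..<\<delta>} t) \<partial>lborel) \<partial>lborel)"
  proof (rule nn_integral_cong_AE, rule AE_mp[OF AE_lborel_singleton[of 0]], intro AE_I2 impI)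
    fix h :: 'a assume h: "h \<noteq> 0"
    show "ennreal (norm h powr (\<epsilon> - N)) * f (sgn h) * indicator (ball 0 \<delta>) h =
      ennreal (\<delta> powr (\<epsilon> - N)) * (f (sgn h) * indicator (ball 0 \<delta>) h) +
      (\<integral>\<^sup>+t. (f (sgn h) * indicator (ball 0 t) h) * (?k t * indicator {0<..<\<delta>} t) \<partial>lborel)"
    proof (cases "norm h < \<delta>")
      case True
      have "(\<integral>\<^sup>+t. (f (sgn h) * indicator (ball 0 t) h) * (?k t * indicator {0<..<\<delta>} t) \<partial>lborel)
        = (\<integral>\<^sup>+t. f (sgn h) * (?k t * indicator {norm h<..<\<delta>} t) \<partial>lborel)"
        using h by (intro nn_integral_cong) (auto simp: indicator_def intro: le_less_trans[OF norm_ge_zero])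
      also have "\<dots> = f (sgn h) * (\<integral>\<^sup>+t. ?k t * indicator {norm h<..<\<delta>} t \<partial>lborel)"
        by (rule nn_integral_cmult) measurable
      finally show ?thesis using True h by (simp add: split[of "norm h"] distrib_left mult.commute)
    next
      case False
      have "(\<integral>\<^sup>+t. (f (sgn h) * indicator (ball 0 t) h) * (?k t * indicator {0<..<\<delta>} t) \<partial>lborel)
        = (\<integral>\<^sup>+(t::real). 0 \<partial>lborel)"
        using False by (intro nn_integral_cong) (auto simp: indicator_def)
      then show ?thesis using False by simp
    qed
  qed
  \<comment> \<open>Membership of h in the ball of radius t is rewritten as t - |h| > 0, which makes
    the integrand visibly measurable in (h, t) for Tonelli. The same device recurs for superlevel
    sets.\<close>
  also have "\<dots> = ennreal (\<delta> powr (\<epsilon> - N)) * (\<integral>\<^sup>+h\<in>ball 0 \<delta>. f (sgn h) \<partial>lborel) +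
     (\<integral>\<^sup>+h. (\<integral>\<^sup>+t. (f (sgn h) * indicator {0<..} (t - norm h)) * (?k t * indicator {0<..<\<delta>} t) \<partial>lborel) \<partial>lborel)"
    by (subst nn_integral_add)
       (auto simp: nn_integral_cmult indicator_def intro!: nn_integral_cong)
  also have "(\<integral>\<^sup>+h. (\<integral>\<^sup>+t. (f (sgn h) * indicator {0<..} (t - norm h)) * (?k t * indicator {0<..<\<delta>} t) \<partial>lborel) \<partial>lborel)
      = (\<integral>\<^sup>+t. (\<integral>\<^sup>+h. (f (sgn h) * indicator {0<..} (t - norm h)) * (?k t * indicator {0<..<\<delta>} t) \<partial>lborel) \<partial>lborel)"
    by (rule lborel_pair.Fubini') measurable
  also have "\<dots> = (\<integral>\<^sup>+t. (\<integral>\<^sup>+h\<in>ball 0 t. f (sgn h) \<partial>lborel) * (?k t * indicator {0<..<\<delta>} t) \<partial>lborel)"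
    by (subst nn_integral_multc) (auto simp: indicator_def intro!: nn_integral_cong)
  also have "\<dots> = (\<integral>\<^sup>+t. (ennreal (N - \<epsilon>) * c) * (ennreal (t powr (\<epsilon> - 1)) * indicator {0<..<\<delta>} t) \<partial>lborel)"
  proof (intro nn_integral_cong)
    fix t :: real
    show "(\<integral>\<^sup>+h\<in>ball 0 t. f (sgn h) \<partial>lborel) * (?k t * indicator {0<..<\<delta>} t) =
      (ennreal (N - \<epsilon>) * c) * (ennreal (t powr (\<epsilon> - 1)) * indicator {0<..<\<delta>} t)"
    proof (cases "t \<in> {0<..<\<delta>}")
      case True
      then have "t ^ DIM('a) = t powr N" by (simp add: N_def powr_realpow)
      then have "t powr (\<epsilon> - 1) = t ^ DIM('a) * t powr (\<epsilon> - N - 1)" using True by (simp add: powr_add[symmetric])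
      then have "(N - \<epsilon>) * t powr (\<epsilon> - 1) = t ^ DIM('a) * ((N - \<epsilon>) * t powr (\<epsilon> - N - 1))" by simp
      then have "ennreal (N - \<epsilon>) * ennreal (t powr (\<epsilon> - 1)) = ennreal (t ^ DIM('a)) * ennreal ((N - \<epsilon>) * t powr (\<epsilon> - N - 1))"
        using N \<epsilon> True by (simp add: ennreal_mult[symmetric])
      then show ?thesis using True by (simp add: nn_integral_ball_sgn c_def[symmetric]) (metis mult.assoc mult.commute)
    qed simp
  qed
  also have "\<dots> = ennreal (N - \<epsilon>) * c * ennreal (\<delta> powr \<epsilon> / \<epsilon>)"
    by (subst nn_integral_cmult) (auto simp: nn_integral_powr_from_0 \<epsilon> \<delta>)
  also have "ennreal (\<delta> powr (\<epsilon> - N)) * (\<integral>\<^sup>+h\<in>ball 0 \<delta>. f (sgn h) \<partial>lborel) = c * ennreal (\<delta> powr \<epsilon>)"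
  proof -
    have "\<delta> ^ DIM('a) = \<delta> powr N" using \<delta> by (simp add: N_def powr_realpow)
    then have "\<delta> powr (\<epsilon> - N) * \<delta> ^ DIM('a) = \<delta> powr \<epsilon>" using \<delta> by (simp add: powr_add[symmetric])
    then have "ennreal (\<delta> powr (\<epsilon> - N)) * ennreal (\<delta> ^ DIM('a)) = ennreal (\<delta> powr \<epsilon>)" using \<delta>
      by (metis ennreal_mult' powr_ge_zero)
    then show ?thesis using \<delta> by (simp add: nn_integral_ball_sgn c_def[symmetric]) (metis mult.assoc mult.commute)
  qed
  finally have "ennreal \<epsilon> * (\<integral>\<^sup>+h\<in>ball 0 \<delta>. ennreal (norm h powr (\<epsilon> - N)) * f (sgn h) \<partial>lborel) =
    c * (ennreal \<epsilon> * ennreal (\<delta> powr \<epsilon>) + ennreal \<epsilon> * (ennreal (N - \<epsilon>) * ennreal (\<delta> powr \<epsilon> / \<epsilon>)))"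
    by (simp add: distrib_left mult_ac)
  \<comment> \<open>The boundary term contributes \<epsilon> \<delta>^\<epsilon> and the
    superposition of balls (N - \<epsilon>) \<delta>^\<epsilon>, so exactly the dimension
    remains.\<close>
  also have "ennreal \<epsilon> * ennreal (\<delta> powr \<epsilon>) + ennreal \<epsilon> * (ennreal (N - \<epsilon>) * ennreal (\<delta> powr \<epsilon> / \<epsilon>)) = ennreal (\<delta> powr \<epsilon> * N)"
    using \<epsilon> \<delta> N by (simp add: ennreal_mult[symmetric] ennreal_plus[symmetric] field_simps del: ennreal_plus)
  also have "\<dots> = ennreal (\<delta> powr \<epsilon>) * of_nat DIM('a)"
    by (simp add: ennreal_mult N_def ennreal_of_nat_eq_real_of_nat)
  finally show ?thesis by (simp add: N_def c_def mult_ac)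
qed

section \<open>The estimate for bounded functions\<close>

abbreviation energy :: "real \<Rightarrow> ('a::euclidean_space \<Rightarrow> 'b::euclidean_space) \<Rightarrow> ennreal" where
  "energy p f \<equiv> \<integral>\<^sup>+x. ennreal (norm (f x) powr p) \<partial>lborel"

text \<open>\<^const>\<open>Phi_lambda\<close> in the variables \<open>(h, x)\<close> with \<open>y = x + h\<close>.\<close>

abbreviation superlevel_mass :: "real \<Rightarrow> real \<Rightarrow> real \<Rightarrow> ('a::euclidean_space \<Rightarrow> real) \<Rightarrow> ennreal" where
  "superlevel_mass p \<gamma> l u \<equiv> ennreal (l powr p) *
     (\<integral>\<^sup>+z. ennreal (norm (fst z) powr (\<gamma> - real DIM('a))) *
        indicator {z. l < \<bar>u (snd z + fst z) - u (snd z)\<bar> / norm (fst z) powr (1 + \<gamma> / p)} z \<partial>(lborel :: ('a \<times> 'a) measure))"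

text \<open>Layer cake above the level \<Lambda>: s^q is at most \<Lambda>^q plus the integral of q
  l^(q-1) over \<Lambda> \<le> l < s. Tonelli and the hypothesis turn the second part into the
  integral of q M0 l^(q-p-1), which converges at infinity because q < p.\<close>

lemma (in sigma_finite_measure) level_average:
  fixes s :: "'a \<Rightarrow> real" and w :: "'a \<Rightarrow> ennreal"
  assumes [measurable]: "s \<in> borel_measurable M" "w \<in> borel_measurable M" "E \<in> sets M"
    and q: "0 < q" "q < p" and \<Lambda>: "0 < \<Lambda>" and s: "\<And>z. 0 \<le> s z" and M0: "0 \<le> M0"
    and le: "\<And>l. \<Lambda> \<le> l \<Longrightarrow> ennreal (l powr p) * (\<integral>\<^sup>+z. w z * indicator {z. l < s z} z \<partial>M) \<le> ennreal M0"
  shows "(\<integral>\<^sup>+z\<in>E. w z * ennreal (s z powr q) \<partial>M) \<le>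
     ennreal (\<Lambda> powr q) * (\<integral>\<^sup>+z\<in>E. w z \<partial>M) + ennreal (q * M0 * \<Lambda> powr (q - p) / (p - q))"
proof -
  interpret P: pair_sigma_finite M "lborel :: real measure" ..
  let ?J = "\<lambda>z. \<integral>\<^sup>+l. ennreal (q * l powr (q - 1)) * (indicator {\<Lambda>..} l * indicator {z. l < s z} z) \<partial>lborel"
  have pw: "ennreal (s z powr q) \<le> ennreal (\<Lambda> powr q) +
     ?J z" for z
  proof (cases "\<Lambda> \<le> s z")
    case True
    have a: "(\<integral>\<^sup>+l. ennreal (q * l powr (q - 1)) * indicator {\<Lambda>..s z} l \<partial>lborel) = ennreal (s z powr q - \<Lambda> powr q)"
      by (rule nn_integral_FTC_Icc) (use True \<Lambda> q in \<open>auto intro!: derivative_eq_intros\<close>)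
    have b: "(\<integral>\<^sup>+l. ennreal (q * l powr (q - 1)) * indicator {\<Lambda>..s z} l \<partial>lborel) =
      ?J z"
      by (rule nn_integral_cong_AE, rule AE_mp[OF AE_lborel_singleton[of "s z"]]) (auto simp: indicator_def)
    have eq: "?J z
      = ennreal (s z powr q - \<Lambda> powr q)" by (rule trans[OF b[symmetric] a])
    have "\<Lambda> powr q \<le> s z powr q" using True \<Lambda> q by (intro powr_mono2) auto
    then show ?thesis unfolding eq by (simp add: ennreal_plus[symmetric] del: ennreal_plus)
  next
    case False
    then have "s z powr q \<le> \<Lambda> powr q" using q s by (intro powr_mono2) auto
    from ennreal_leI[OF this] show ?thesis by (rule order_trans) simp
  qed
  have "(\<integral>\<^sup>+z\<in>E. w z * ennreal (s z powr q) \<partial>M) \<le>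
     (\<integral>\<^sup>+z. ennreal (\<Lambda> powr q) * (w z * indicator E z) +
       (\<integral>\<^sup>+l. w z * (ennreal (q * l powr (q - 1)) * (indicator {\<Lambda>..} l * indicator {z. l < s z} z)) \<partial>lborel) \<partial>M)"
  proof (intro nn_integral_mono)
    fix z
    have "w z * ennreal (s z powr q) * indicator E z \<le> w z * indicator E z * (ennreal (\<Lambda> powr q) +
     ?J z)"
      using mult_left_mono[OF pw[of z], of "w z * indicator E z"] by (simp add: mult_ac)
    \<comment> \<open>The restriction to E is dropped in the tail, where the hypothesis already
      controls the integral over the whole space.\<close>
    also have "\<dots> \<le> ennreal (\<Lambda> powr q) * (w z * indicator E z) + w z *
      ?J z"
      unfolding distrib_left
      by (intro add_mono mult_right_mono) (auto simp: mult_ac indicator_def)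
    also have "w z * ?J z
      = (\<integral>\<^sup>+l. w z * (ennreal (q * l powr (q - 1)) * (indicator {\<Lambda>..} l * indicator {z. l < s z} z)) \<partial>lborel)"
      by (rule nn_integral_cmult[symmetric]) (auto simp: indicator_def)
    finally show "w z * ennreal (s z powr q) * indicator E z \<le> ennreal (\<Lambda> powr q) * (w z * indicator E z) +
       (\<integral>\<^sup>+l. w z * (ennreal (q * l powr (q - 1)) * (indicator {\<Lambda>..} l * indicator {z. l < s z} z)) \<partial>lborel)" .
  qed
  also have "\<dots> = ennreal (\<Lambda> powr q) * (\<integral>\<^sup>+z\<in>E. w z \<partial>M) +
     (\<integral>\<^sup>+z. (\<integral>\<^sup>+l. w z * (ennreal (q * l powr (q - 1)) * (indicator {\<Lambda>..} l * indicator {0<..} (s z - l))) \<partial>lborel) \<partial>M)"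
    by (subst nn_integral_add) (auto simp: nn_integral_cmult indicator_def intro!: nn_integral_cong)
  also have "(\<integral>\<^sup>+z. (\<integral>\<^sup>+l. w z * (ennreal (q * l powr (q - 1)) * (indicator {\<Lambda>..} l * indicator {0<..} (s z - l))) \<partial>lborel) \<partial>M)
     = (\<integral>\<^sup>+l. (\<integral>\<^sup>+z. w z * (ennreal (q * l powr (q - 1)) * (indicator {\<Lambda>..} l * indicator {0<..} (s z - l))) \<partial>M) \<partial>lborel)"
    by (rule P.Fubini'[symmetric]) measurable
  also have "\<dots> \<le> (\<integral>\<^sup>+l. ennreal (q * M0 * l powr (q - p - 1)) * indicator {\<Lambda>..} l \<partial>lborel)"
  proof (intro nn_integral_mono)
    fix l :: real
    have ind: "indicator {0<..} (s z - l) = (indicator {z. l < s z} z :: ennreal)" for z by (auto simp: indicator_def)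
    have eq: "(\<integral>\<^sup>+z. w z * (ennreal (q * l powr (q - 1)) * (indicator {\<Lambda>..} l * indicator {0<..} (s z - l))) \<partial>M) =
      ennreal (q * l powr (q - 1)) * indicator {\<Lambda>..} l * (\<integral>\<^sup>+z. w z * indicator {z. l < s z} z \<partial>M)"
      unfolding ind[symmetric] by (subst nn_integral_cmult[symmetric]) (auto simp: mult_ac)
    show "(\<integral>\<^sup>+z. w z * (ennreal (q * l powr (q - 1)) * (indicator {\<Lambda>..} l * indicator {0<..} (s z - l))) \<partial>M)
      \<le> ennreal (q * M0 * l powr (q - p - 1)) * indicator {\<Lambda>..} l"
    proof (cases "\<Lambda> \<le> l")
      case True
      have l: "0 < l" using True \<Lambda> by simp
      have "l powr (q - 1) = l powr (q - p - 1) * l powr p" using l by (simp add: powr_add[symmetric])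
      then have "ennreal (q * l powr (q - 1)) = ennreal (q * l powr (q - p - 1)) * ennreal (l powr p)"
        using q by (simp add: ennreal_mult[symmetric])
      then have "ennreal (q * l powr (q - 1)) * (\<integral>\<^sup>+z. w z * indicator {z. l < s z} z \<partial>M) \<le> ennreal (q * l powr (q - p - 1)) * ennreal M0"
        using mult_left_mono[OF le[OF True], of "ennreal (q * l powr (q - p - 1))"] by (simp add: mult.assoc)
      also have "\<dots> = ennreal (q * M0 * l powr (q - p - 1))" using q M0 by (simp add: ennreal_mult[symmetric] mult_ac)
      finally show ?thesis using True unfolding eq by simp
    qed (simp add: eq)
  qed
  also have "\<dots> = ennreal (0 - (- (q * M0 * \<Lambda> powr (q - p) / (p - q))))"
  proof (rule nn_integral_FTC_atLeast)
    show "((\<lambda>l. - (q * M0 * l powr (q - p) / (p - q))) has_real_derivative q * M0 * l powr (q - p - 1)) (at l)" if "\<Lambda> \<le> l" for l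
    proof -
      have "((\<lambda>l. - (q * M0 * l powr (q - p) / (p - q))) has_real_derivative - (q * M0 * ((q - p) * l powr (q - p - 1)) / (p - q))) (at l)"
        using that \<Lambda> q by (auto intro!: derivative_eq_intros)
      moreover have "- (q * M0 * ((q - p) * l powr (q - p - 1)) / (p - q)) = q * M0 * l powr (q - p - 1)"
        using q by (simp add: field_simps)
      ultimately show ?thesis by simp
    qed
    have "((\<lambda>l. - (q * M0 * l powr (q - p) / (p - q))) \<longlongrightarrow> - (q * M0 * 0 / (p - q))) at_top"
      by (intro tendsto_intros tendsto_neg_powr) (use q in \<open>auto intro: filterlim_ident\<close>)
    then show "((\<lambda>l. - (q * M0 * l powr (q - p) / (p - q))) \<longlongrightarrow> 0) at_top" by simp
  qed (use q M0 in auto)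
  finally show ?thesis by simp
qed

text \<open>The Taylor bound of the kernel is integrated against u. For |h| \<le> 1 the remainder
  lives in a ball of radius \<eta> + 1 about x, whose volume does not depend on x, and |u| \<le> A
  there; hence C is uniform in x.\<close>

lemma mollify_diff_lower:
  fixes u :: "'a::euclidean_space \<Rightarrow> real"
  assumes u: "loc_int u" and A: "\<And>x. \<bar>u x\<bar> \<le> A" and \<eta>: "0 < \<eta>"
  obtains C where "C \<ge> 0"
    "\<And>x h. norm h \<le> 1 \<Longrightarrow> \<bar>mollifyG \<eta> u x \<bullet> h\<bar> - C * (norm h)\<^sup>2 \<le> \<bar>mollify \<eta> u (x + h) - mollify \<eta> u x\<bar>"
proof -
  obtain C where C: "C \<ge> 0"
    "\<And>z h :: 'a. \<bar>kern \<eta> (z - h) - kern \<eta> z - kernG \<eta> z \<bullet> h\<bar> \<le> C * (norm h)\<^sup>2"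
    using kern_taylor[OF \<eta>] by blast
  have A0: "0 \<le> A" using A[of 0] by simp
  define V where "V = measure lborel (cball (0::'a) (\<eta> + 1))"
  show thesis
  proof (rule that[of "A * C * V"])
    show "0 \<le> A * C * V" using A0 C by (simp add: V_def)
    fix x h :: 'a assume h: "norm h \<le> 1"
    have i: "integrable lborel (\<lambda>y. u y *\<^sub>R kern \<eta> (y - x))" for x
      by (rule conv_integrable[OF u kern_cont kern_supp[OF \<eta>]])
    have iG: "integrable lborel (\<lambda>y. u y *\<^sub>R kernG \<eta> (y - x))" for x
      by (rule conv_integrable[OF u kernG_cont kernG_supp[OF \<eta>]])
    have iG': "integrable lborel (\<lambda>y. (u y *\<^sub>R kernG \<eta> (y - x)) \<bullet> h)" by (rule integrable_inner_left) (rule iG)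
    have "mollify \<eta> u (x + h) - mollify \<eta> u x - mollifyG \<eta> u x \<bullet> h =
      (LINT y|lborel. u y *\<^sub>R kern \<eta> (y - (x + h)) - u y *\<^sub>R kern \<eta> (y - x) - (u y *\<^sub>R kernG \<eta> (y - x)) \<bullet> h)"
      unfolding mollify_def mollifyG_def using i[of "x + h"] i[of x] iG[of x] iG'
      by (simp add: integral_inner_left[symmetric])
    also have "norm \<dots> \<le> (LINT y|lborel. A * C * (norm h)\<^sup>2 * indicat_real (cball x (\<eta> + 1)) y)"
    proof (rule Bochner_Integration.integral_norm_bound_integral)
      show "integrable lborel (\<lambda>y. u y *\<^sub>R kern \<eta> (y - (x + h)) - u y *\<^sub>R kern \<eta> (y - x) - (u y *\<^sub>R kernG \<eta> (y - x)) \<bullet> h)"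
        using i[of "x + h"] i[of x] iG' by (intro Bochner_Integration.integrable_diff)
      show "integrable lborel (\<lambda>y. A * C * (norm h)\<^sup>2 * indicat_real (cball x (\<eta> + 1)) y)"
        by (rule integrable_indicator_cball)
      fix y
      show "norm (u y *\<^sub>R kern \<eta> (y - (x + h)) - u y *\<^sub>R kern \<eta> (y - x) - (u y *\<^sub>R kernG \<eta> (y - x)) \<bullet> h)
        \<le> A * C * (norm h)\<^sup>2 * indicat_real (cball x (\<eta> + 1)) y"
      proof (cases "y \<in> cball x (\<eta> + 1)")
        case True
        have "norm (u y *\<^sub>R kern \<eta> (y - (x + h)) - u y *\<^sub>R kern \<eta> (y - x) - (u y *\<^sub>R kernG \<eta> (y - x)) \<bullet> h)
          = \<bar>u y\<bar> * \<bar>kern \<eta> (y - x - h) - kern \<eta> (y - x) - kernG \<eta> (y - x) \<bullet> h\<bar>"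
        proof -
          have "u y *\<^sub>R kern \<eta> (y - (x + h)) - u y *\<^sub>R kern \<eta> (y - x) - (u y *\<^sub>R kernG \<eta> (y - x)) \<bullet> h
            = u y * (kern \<eta> (y - x - h) - kern \<eta> (y - x) - kernG \<eta> (y - x) \<bullet> h)"
            by (simp add: right_diff_distrib distrib_left diff_diff_eq)
          then show ?thesis by (simp only: real_norm_def abs_mult)
        qed
        also have "\<dots> \<le> A * (C * (norm h)\<^sup>2)" using A0 by (intro mult_mono A C) auto
        finally show ?thesis using True by simp
      next
        case False
        then have "norm (y - x) > \<eta> + 1" by (simp add: dist_norm norm_minus_commute)
        moreover have "norm (y - (x + h)) \<ge> norm (y - x) - norm h"
          using norm_triangle_ineq2[of "y - x" h] by (simp add: diff_diff_eq)
        ultimately show ?thesis using h \<eta> False by (simp add: kern_supp kernG_supp)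
      qed
    qed
    also have "\<dots> = A * C * V * (norm h)\<^sup>2"
      using \<eta> by (simp add: V_def content_cball_conv_ball content_ball)
    finally show "\<bar>mollifyG \<eta> u x \<bullet> h\<bar> - A * C * V * (norm h)\<^sup>2 \<le> \<bar>mollify \<eta> u (x + h) - mollify \<eta> u x\<bar>"
      by (simp add: abs_if split: if_splits)
  qed
qed

text \<open>Taking differences commutes with convolution, so Jensen's inequality applies to the
  difference function. This is the step for which a convex functional is needed; the ball grows by
  the radius of the kernel.\<close>

lemma mollify_diff_powr_le:
  fixes u :: "'a::euclidean_space \<Rightarrow> real"
  assumes u: "loc_int u" and \<eta>: "0 < \<eta>" and p: "1 \<le> p"
  shows "(\<integral>\<^sup>+x\<in>cball 0 R. ennreal (\<bar>mollify \<eta> u (x + h) - mollify \<eta> u x\<bar> powr p) \<partial>lborel) \<le>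
     (\<integral>\<^sup>+x\<in>cball 0 (R + \<eta>). ennreal (\<bar>u (x + h) - u x\<bar> powr p) \<partial>lborel)"
proof -
  have [measurable]: "u \<in> borel_measurable borel" using u by (rule loc_int_measurable)
  have i: "integrable lborel (\<lambda>y. u y *\<^sub>R kern \<eta> (y - x))" for x
    by (rule conv_integrable[OF u kern_cont kern_supp[OF \<eta>]])
  have i2: "integrable lborel (\<lambda>y. u (y + h) *\<^sub>R kern \<eta> (y - x))" for x
    using integrable_lborel_shift[OF i[of "x + h"], of h] by simp
  have eq: "mollify \<eta> u (x + h) - mollify \<eta> u x = (LINT y|lborel. kern \<eta> (y - x) * (u (y + h) - u y))" for x
  proof -
    have "mollify \<eta> u (x + h) = (LINT y|lborel. u (y + h) *\<^sub>R kern \<eta> (y - x))"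
      unfolding mollify_def
      by (subst integral_lborel_shift[of "\<lambda>y. u y *\<^sub>R kern \<eta> (y - (x + h))" h, symmetric]) auto
    then have "mollify \<eta> u (x + h) - mollify \<eta> u x = (LINT y|lborel. u (y + h) *\<^sub>R kern \<eta> (y - x) - u y *\<^sub>R kern \<eta> (y - x))"
      using i[of x] i2[of x] by (simp add: mollify_def)
    then show ?thesis by (simp add: algebra_simps)
  qed
  have ii: "integrable lborel (\<lambda>y. kern \<eta> (y - x) * \<bar>u (y + h) - u y\<bar>)" for x
  proof -
    have "integrable lborel (\<lambda>y. norm (u (y + h) *\<^sub>R kern \<eta> (y - x) - u y *\<^sub>R kern \<eta> (y - x)))"
      by (intro integrable_norm Bochner_Integration.integrable_diff i i2)
    then show ?thesis by (simp add: left_diff_distrib[symmetric] abs_mult kern_nonneg[OF \<eta>] mult.commute)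
  qed
  have le: "ennreal (\<bar>mollify \<eta> u (x + h) - mollify \<eta> u x\<bar> powr p) \<le>
     (\<integral>\<^sup>+y. ennreal (kern \<eta> (y - x)) * ennreal (\<bar>u (y + h) - u y\<bar> powr p) \<partial>lborel)" for x
  proof -
    have "\<bar>mollify \<eta> u (x + h) - mollify \<eta> u x\<bar> \<le> (LINT y|lborel. kern \<eta> (y - x) * \<bar>u (y + h) - u y\<bar>)"
      unfolding eq using integral_norm_bound[of lborel "\<lambda>y. kern \<eta> (y - x) * (u (y + h) - u y)"]
      by (simp add: abs_mult kern_nonneg[OF \<eta>])
    then have "\<bar>mollify \<eta> u (x + h) - mollify \<eta> u x\<bar> powr p \<le> (LINT y|lborel. kern \<eta> (y - x) * \<bar>u (y + h) - u y\<bar>) powr p"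
      using p by (intro powr_mono2) auto
    then have "ennreal (\<bar>mollify \<eta> u (x + h) - mollify \<eta> u x\<bar> powr p) \<le> ennreal ((LINT y|lborel. kern \<eta> (y - x) * \<bar>u (y + h) - u y\<bar>) powr p)"
      by (rule ennreal_leI)
    also have "\<dots> \<le> (\<integral>\<^sup>+y. ennreal (kern \<eta> (y - x) * \<bar>u (y + h) - u y\<bar> powr p) \<partial>lborel)"
      by (rule kern_jensen[OF p \<eta> _ ii]) auto
    finally show ?thesis by (simp add: ennreal_mult kern_nonneg[OF \<eta>])
  qed
  have "(\<integral>\<^sup>+x\<in>cball 0 R. ennreal (\<bar>mollify \<eta> u (x + h) - mollify \<eta> u x\<bar> powr p) \<partial>lborel) \<le>
    (\<integral>\<^sup>+x\<in>cball 0 R. (\<integral>\<^sup>+y. ennreal (kern \<eta> (y - x)) * ennreal (\<bar>u (y + h) - u y\<bar> powr p) \<partial>lborel) \<partial>lborel)"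
    by (intro nn_integral_mono mult_right_mono le) auto
  also have "\<dots> \<le> (\<integral>\<^sup>+x\<in>cball 0 (R + \<eta>). ennreal (\<bar>u (x + h) - u x\<bar> powr p) \<partial>lborel)"
  proof (rule kern_conv_nn_integral_le[OF \<eta>])
    fix x y :: 'a assume "x \<in> cball 0 R" "norm (y - x) < \<eta>"
    then show "y \<in> cball 0 (R + \<eta>)" using norm_triangle_ineq[of x "y - x"] by simp
  qed auto
  finally show ?thesis .
qed

lemma nn_integral_lborel_prod:
  fixes f :: "'a::euclidean_space \<times> 'b::euclidean_space \<Rightarrow> ennreal"
  assumes [measurable]: "f \<in> borel_measurable borel"
  shows "(\<integral>\<^sup>+z. f z \<partial>lborel) = (\<integral>\<^sup>+x. \<integral>\<^sup>+y. f (x, y) \<partial>lborel \<partial>lborel)"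
proof -
  have "f \<in> borel_measurable (lborel \<Otimes>\<^sub>M lborel)" using assms by (simp add: lborel_prod)
  from lborel.nn_integral_fst[OF this] show ?thesis by (simp add: lborel_prod)
qed

lemma nn_integral_lborel_prod_swap:
  fixes f :: "'a::euclidean_space \<times> 'b::euclidean_space \<Rightarrow> ennreal"
  assumes [measurable]: "f \<in> borel_measurable borel"
  shows "(\<integral>\<^sup>+z. f z \<partial>lborel) = (\<integral>\<^sup>+y. \<integral>\<^sup>+x. f (x, y) \<partial>lborel \<partial>lborel)"
proof -
  have [measurable]: "f \<in> borel_measurable (borel \<Otimes>\<^sub>M borel)" using assms by (simp add: borel_prod)
  show ?thesis unfolding nn_integral_lborel_prod[OF assms]
    by (rule lborel_pair.Fubini') measurable
qed

lemma nn_integral_norm_powr_ball_finite: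
  assumes "\<gamma> > 0"
  shows "(\<integral>\<^sup>+h\<in>ball 0 1. ennreal (norm (h::'a::euclidean_space) powr (\<gamma> - real DIM('a))) \<partial>lborel) < \<infinity>"
proof -
  \<comment> \<open>\<open>polar_kernel\<close> asks for an exponent below 1, and on the unit ball
    lowering \<gamma> only increases the integrand.\<close>
  define \<epsilon> where "\<epsilon> = min \<gamma> (1/2)"
  have \<epsilon>: "0 < \<epsilon>" "\<epsilon> < 1" using assms by (auto simp: \<epsilon>_def)
  have "(\<integral>\<^sup>+h\<in>ball 0 1. ennreal (norm (h::'a) powr (\<gamma> - real DIM('a))) \<partial>lborel) \<le>
     (\<integral>\<^sup>+h\<in>ball 0 1. ennreal (norm (h::'a) powr (\<epsilon> - real DIM('a))) * 1 \<partial>lborel)"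
  proof (intro nn_integral_mono)
    fix h :: 'a
    have "norm h powr (\<gamma> - real DIM('a)) \<le> norm h powr (\<epsilon> - real DIM('a))" if "norm h < 1"
      using that by (cases "h = 0") (auto intro!: powr_mono' simp: \<epsilon>_def)
    then show "ennreal (norm h powr (\<gamma> - real DIM('a))) * indicator (ball 0 1) h \<le> ennreal (norm h powr (\<epsilon> - real DIM('a))) * 1 * indicator (ball 0 1) h"
      by (auto simp: indicator_def)
  qed
  also have "\<dots> < \<infinity>"
  proof -
    have "ennreal \<epsilon> * (\<integral>\<^sup>+h\<in>ball 0 1. ennreal (norm (h::'a) powr (\<epsilon> - real DIM('a))) * 1 \<partial>lborel) < \<infinity>"
      using polar_kernel[of "\<lambda>_::'a. 1" \<epsilon> 1] \<epsilon> emeasure_lborel_ball_finite[of "0::'a" 1]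
      by (simp add: ennreal_mult_less_top of_nat_less_top)
    then show ?thesis using \<epsilon> by (auto simp: ennreal_mult_less_top)
  qed
  finally show ?thesis .
qed

text \<open>The passage from superlevel sets to differences. \<open>level_average\<close> is applied
  to the quotient s with weight |h|^(\<gamma> - N); the bound A on the oscillation trades p for q,
  and \<epsilon> absorbs the powers of |h|.\<close>

lemma difference_energy_le:
  fixes u :: "'a::euclidean_space \<Rightarrow> real"
  assumes [measurable]: "u \<in> borel_measurable borel"
    and A: "\<And>x y. \<bar>u x - u y\<bar> \<le> A" "0 < A" and p: "1 \<le> p" and \<gamma>: "0 < \<gamma>"
    and \<Lambda>: "0 < \<Lambda>" and M0: "0 \<le> M0"
    and le: "\<And>l. \<Lambda> \<le> l \<Longrightarrow> superlevel_mass p \<gamma> l u \<le> ennreal M0"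
    and q: "0 < q" "q < p"
  defines "\<epsilon> \<equiv> (p - q) * (p + \<gamma>) / p"
  shows "(\<integral>\<^sup>+h\<in>ball 0 1. ennreal (norm h powr (\<epsilon> - real DIM('a) - p)) * (\<integral>\<^sup>+x\<in>cball 0 R. ennreal (\<bar>u (x + h) - u x\<bar> powr p) \<partial>lborel) \<partial>lborel)
    \<le> ennreal (A powr (p - q)) * (ennreal (\<Lambda> powr q) * (\<integral>\<^sup>+z\<in>ball 0 1 \<times> cball 0 R. ennreal (norm (fst z) powr (\<gamma> - real DIM('a))) \<partial>(lborel :: ('a \<times> 'a) measure)) + ennreal (q * M0 * \<Lambda> powr (q - p) / (p - q)))"
proof -
  define N where "N = real DIM('a)"
  define s where "s z = \<bar>u (snd z + fst z) - u (snd z)\<bar> / norm (fst z) powr (1 + \<gamma> / p)" for z :: "'a \<times> 'a"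
  have E[measurable]: "ball 0 1 \<times> cball 0 R \<in> sets (borel :: ('a \<times> 'a) measure)"
    by (simp add: borel_prod[symmetric])
  have [measurable]: "s \<in> borel_measurable borel" unfolding s_def borel_prod[symmetric] by measurable
  have wm[measurable]: "(\<lambda>z::'a \<times> 'a. ennreal (norm (fst z) powr (\<gamma> - N))) \<in> borel_measurable borel"
    unfolding borel_prod[symmetric] by measurable
  define F where "F z = ennreal (norm (fst z) powr (\<gamma> - N)) * ennreal (s z powr q) * indicator (ball 0 1 \<times> cball 0 R) z" for z
  have "(\<lambda>z. ennreal (s z powr q)) \<in> borel_measurable borel" by measurable
  then have Fm: "F \<in> borel_measurable borel" unfolding F_def
    by (intro borel_measurable_times_ennreal wm borel_measurable_indicator E)
  have Fm': "(\<lambda>z. ennreal (A powr (p - q)) * F z) \<in> borel_measurable borel"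
    by (intro borel_measurable_times_ennreal Fm borel_measurable_const)
  have ex: "\<gamma> - N + - (q * (1 + \<gamma> / p)) = \<epsilon> - N - p" using p by (simp add: \<epsilon>_def field_simps)
  \<comment> \<open>Off the origin this is |d|^p \<le> A^(p-q) |d|^q combined with the exponent
    identity \<open>ex\<close>. At h = 0 both sides vanish, because \<open>0 powr a\<close> is 0 for
    every exponent.\<close>
  have pw: "norm h powr (\<epsilon> - N - p) * \<bar>u (x + h) - u x\<bar> powr p \<le> A powr (p - q) * (norm h powr (\<gamma> - N) * s (h, x) powr q)" for h x
  proof (cases "h = 0")
    case False
    define r where "r = \<bar>u (x + h) - u x\<bar>"
    have r: "0 \<le> r" "r \<le> A" using A(1)[of "x + h" x] by (auto simp: r_def)
    have "r powr p = r powr (p - q) * r powr q" using q by (simp add: powr_add[symmetric])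
    also have "\<dots> \<le> A powr (p - q) * r powr q" using r q by (intro mult_right_mono powr_mono2) auto
    finally have 1: "r powr p \<le> A powr (p - q) * r powr q" .
    have "s (h, x) powr q = r powr q * norm h powr (- (q * (1 + \<gamma> / p)))"
      unfolding s_def r_def using False
      by (simp add: powr_divide powr_powr powr_minus_divide mult.commute[of q])
    then have 2: "norm h powr (\<gamma> - N) * s (h, x) powr q = norm h powr (\<epsilon> - N - p) * r powr q"
      unfolding ex[symmetric] powr_add by simp
    show ?thesis unfolding 2 r_def[symmetric] using mult_left_mono[OF 1, of "norm h powr (\<epsilon> - N - p)"]
      by (simp add: mult_ac)
  qed (simp add: s_def)
  have "(\<integral>\<^sup>+h\<in>ball 0 1. ennreal (norm h powr (\<epsilon> - N - p)) * (\<integral>\<^sup>+x\<in>cball 0 R. ennreal (\<bar>u (x + h) - u x\<bar> powr p) \<partial>lborel) \<partial>lborel)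
    = (\<integral>\<^sup>+h. \<integral>\<^sup>+x. ennreal (norm h powr (\<epsilon> - N - p) * \<bar>u (x + h) - u x\<bar> powr p) * indicator (ball 0 1 \<times> cball 0 R) (h, x) \<partial>lborel \<partial>lborel)"
  proof (intro nn_integral_cong)
    fix h :: 'a
    have "ennreal (norm h powr (\<epsilon> - N - p)) * (\<integral>\<^sup>+x\<in>cball 0 R. ennreal (\<bar>u (x + h) - u x\<bar> powr p) \<partial>lborel) * indicator (ball 0 1) h =
       (ennreal (norm h powr (\<epsilon> - N - p)) * indicator (ball 0 1) h) * (\<integral>\<^sup>+x\<in>cball 0 R. ennreal (\<bar>u (x + h) - u x\<bar> powr p) \<partial>lborel)"
      by (simp add: mult_ac)
    also have "\<dots> = (\<integral>\<^sup>+x. (ennreal (norm h powr (\<epsilon> - N - p)) * indicator (ball 0 1) h) * (ennreal (\<bar>u (x + h) - u x\<bar> powr p) * indicator (cball 0 R) x) \<partial>lborel)"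
      by (rule nn_integral_cmult[symmetric]) measurable
    also have "\<dots> = (\<integral>\<^sup>+x. ennreal (norm h powr (\<epsilon> - N - p) * \<bar>u (x + h) - u x\<bar> powr p) * indicator (ball 0 1 \<times> cball 0 R) (h, x) \<partial>lborel)"
      by (intro nn_integral_cong) (simp add: ennreal_mult indicator_times mult_ac)
    finally show "ennreal (norm h powr (\<epsilon> - N - p)) * (\<integral>\<^sup>+x\<in>cball 0 R. ennreal (\<bar>u (x + h) - u x\<bar> powr p) \<partial>lborel) * indicator (ball 0 1) h
      = (\<integral>\<^sup>+x. ennreal (norm h powr (\<epsilon> - N - p) * \<bar>u (x + h) - u x\<bar> powr p) * indicator (ball 0 1 \<times> cball 0 R) (h, x) \<partial>lborel)" .
  qed
  also have "\<dots> \<le> (\<integral>\<^sup>+h. \<integral>\<^sup>+x. ennreal (A powr (p - q)) * (ennreal (norm h powr (\<gamma> - N)) * ennreal (s (h, x) powr q) * indicator (ball 0 1 \<times> cball 0 R) (h, x)) \<partial>lborel \<partial>lborel)"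
  proof (intro nn_integral_mono)
    fix h x
    show "ennreal (norm h powr (\<epsilon> - N - p) * \<bar>u (x + h) - u x\<bar> powr p) * indicator (ball 0 1 \<times> cball 0 R) (h, x)
      \<le> ennreal (A powr (p - q)) * (ennreal (norm h powr (\<gamma> - N)) * ennreal (s (h, x) powr q) * indicator (ball 0 1 \<times> cball 0 R) (h, x))"
      using mult_right_mono[OF ennreal_leI[OF pw[of h x]], of "indicator (ball 0 1 \<times> cball 0 R) (h, x)"]
      by (simp add: ennreal_mult mult.assoc)
  qed
  also have "\<dots> = (\<integral>\<^sup>+z. ennreal (A powr (p - q)) * (ennreal (norm (fst z) powr (\<gamma> - N)) * ennreal (s z powr q) * indicator (ball 0 1 \<times> cball 0 R) z) \<partial>lborel)"
    unfolding F_def[symmetric] nn_integral_lborel_prod[OF Fm'] by (simp only: F_def fst_conv)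
  also have "\<dots> = ennreal (A powr (p - q)) * (\<integral>\<^sup>+z\<in>ball 0 1 \<times> cball 0 R. ennreal (norm (fst z) powr (\<gamma> - N)) * ennreal (s z powr q) \<partial>lborel)"
    unfolding F_def[symmetric] by (rule nn_integral_cmult) (use Fm in simp)
  also have "(\<integral>\<^sup>+z\<in>ball 0 1 \<times> cball 0 R. ennreal (norm (fst z) powr (\<gamma> - N)) * ennreal (s z powr q) \<partial>lborel)
    \<le> ennreal (\<Lambda> powr q) * (\<integral>\<^sup>+z\<in>ball 0 1 \<times> cball 0 R. ennreal (norm (fst z) powr (\<gamma> - N)) \<partial>(lborel :: ('a \<times> 'a) measure)) + ennreal (q * M0 * \<Lambda> powr (q - p) / (p - q))"
  proof (rule lborel.level_average)
    show "(\<lambda>z::'a \<times> 'a. ennreal (norm (fst z) powr (\<gamma> - N))) \<in> borel_measurable lborel"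
      using wm by (simp only: measurable_lborel2)
    show "s \<in> borel_measurable lborel"
      "ball 0 1 \<times> cball 0 R \<in> sets (lborel :: ('a \<times> 'a) measure)" by simp_all
    show "0 \<le> s z" for z by (simp add: s_def)
    show "ennreal (l powr p) * (\<integral>\<^sup>+z. ennreal (norm (fst z) powr (\<gamma> - N)) * indicator {z. l < s z} z \<partial>lborel) \<le> ennreal M0" if "\<Lambda> \<le> l" for l
      using le[OF that] unfolding s_def N_def .
  qed (use q \<Lambda> M0 in simp_all)
  finally show ?thesis unfolding N_def by (simp add: mult_left_mono)
qed

text \<open>Close to the origin the difference quotient of the mollified function is at least the
  directional derivative up to C \<delta>; the maximum with 0 keeps this meaningful where the
  derivative is small. Polar coordinates then factor out the direction, and \<delta> and R stay
  fixed while q \<rightarrow> p.\<close>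

lemma directional_energy_le:
  fixes u :: "'a::euclidean_space \<Rightarrow> real"
  assumes u: "loc_int u"
    and A0: "\<And>x y. \<bar>u x - u y\<bar> \<le> A" "0 < A" and p: "1 \<le> p" and \<gamma>: "0 < \<gamma>" and \<eta>: "0 < \<eta>"
    and \<Lambda>: "0 < \<Lambda>" and M0: "0 \<le> M0"
    and le: "\<And>l. \<Lambda> \<le> l \<Longrightarrow> superlevel_mass p \<gamma> l u \<le> ennreal M0"
    and C: "C \<ge> 0" "\<And>x h. norm h \<le> 1 \<Longrightarrow> \<bar>mollifyG \<eta> u x \<bullet> h\<bar> - C * (norm h)\<^sup>2 \<le> \<bar>mollify \<eta> u (x + h) - mollify \<eta> u x\<bar>"
    and \<delta>: "0 < \<delta>" "\<delta> \<le> 1" and R: "0 \<le> R"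
  shows "of_nat DIM('a) * (\<integral>\<^sup>+h\<in>ball 0 1. (\<integral>\<^sup>+x\<in>cball 0 R. ennreal ((max 0 (\<bar>mollifyG \<eta> u x \<bullet> sgn h\<bar> - C * \<delta>)) powr p) \<partial>lborel) \<partial>lborel)
     \<le> ennreal ((p + \<gamma>) * M0)"
proof -
  define N where "N = real DIM('a)"
  have [measurable]: "u \<in> borel_measurable borel" using u by (rule loc_int_measurable)
  have [measurable]: "mollifyG \<eta> u \<in> borel_measurable borel"
    by (rule borel_measurable_continuous_onI[OF mollifyG_cont[OF u \<eta>]])
  define f where "f \<sigma> = (\<integral>\<^sup>+x\<in>cball 0 R. ennreal ((max 0 (\<bar>mollifyG \<eta> u x \<bullet> \<sigma>\<bar> - C * \<delta>)) powr p) \<partial>lborel)" for \<sigma> :: 'a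
  have cb[measurable]: "cball (0::'a) R \<in> sets borel" by simp
  have f[measurable]: "f \<in> borel_measurable borel" unfolding f_def by measurable
  define J where "J = of_nat DIM('a) * (\<integral>\<^sup>+h\<in>ball 0 1. f (sgn h) \<partial>lborel)"
  \<comment> \<open>The weight of the low quotients. Only its finiteness matters, since it is
    multiplied by \<epsilon> \<rightarrow> 0.\<close>
  define V where "V = (\<integral>\<^sup>+z\<in>ball 0 1 \<times> cball 0 (R + \<eta>). ennreal (norm (fst z) powr (\<gamma> - N)) \<partial>(lborel :: ('a \<times> 'a) measure))"
  have V: "V < \<infinity>"
  proof -
    have E[measurable]: "ball 0 1 \<times> cball 0 (R + \<eta>) \<in> sets (borel :: ('a \<times> 'a) measure)"
      by (simp add: borel_prod[symmetric])
    have [measurable]: "(\<lambda>z::'a\<times>'a. ennreal (norm (fst z) powr (\<gamma> - N))) \<in> borel_measurable borel"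
      unfolding borel_prod[symmetric] by measurable
    have "V = (\<integral>\<^sup>+h. \<integral>\<^sup>+x. (ennreal (norm h powr (\<gamma> - N)) * indicator (ball 0 1) h) * indicator (cball (0::'a) (R + \<eta>)) x \<partial>lborel \<partial>(lborel :: 'a measure))"
      unfolding V_def by (subst nn_integral_lborel_prod, measurable) (simp add: indicator_times mult.assoc)
    also have "\<dots> = (\<integral>\<^sup>+h\<in>ball 0 1. ennreal (norm (h::'a) powr (\<gamma> - N)) \<partial>lborel) * emeasure lborel (cball (0::'a) (R + \<eta>))"
      by (simp add: nn_integral_cmult nn_integral_multc)
    also have "\<dots> < \<infinity>"
      using nn_integral_norm_powr_ball_finite[OF \<gamma>, where 'a='a] emeasure_bounded_finite[of "cball (0::'a) (R + \<eta>)"]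
      by (simp add: N_def ennreal_mult_less_top)
    finally show ?thesis .
  qed
  then obtain v where v: "V = ennreal v" "0 \<le> v" by (cases V) auto
  \<comment> \<open>Taylor's lower bound is divided by |h|; the error C|h| is at most C \<delta>,
    which no longer depends on |h|, so that the left side is a function of the direction
    only.\<close>
  have lower: "f (sgn h) \<le> ennreal (norm h powr (- p)) * (\<integral>\<^sup>+x\<in>cball 0 (R + \<eta>). ennreal (\<bar>u (x + h) - u x\<bar> powr p) \<partial>lborel)"
    if h: "h \<noteq> 0" "norm h < \<delta>" for h
  proof -
    have "f (sgn h) \<le> (\<integral>\<^sup>+x\<in>cball 0 R. ennreal (norm h powr (- p)) * ennreal (\<bar>mollify \<eta> u (x + h) - mollify \<eta> u x\<bar> powr p) \<partial>lborel)"
      unfolding f_def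
    proof (intro nn_integral_mono mult_right_mono)
      fix x
      let ?w = "\<bar>mollify \<eta> u (x + h) - mollify \<eta> u x\<bar>"
      have sg: "norm h * \<bar>mollifyG \<eta> u x \<bullet> sgn h\<bar> = \<bar>mollifyG \<eta> u x \<bullet> h\<bar>"
        using h by (simp add: sgn_div_norm abs_mult)
      have "norm h * (\<bar>mollifyG \<eta> u x \<bullet> sgn h\<bar> - C * \<delta>) \<le> \<bar>mollifyG \<eta> u x \<bullet> h\<bar> - C * (norm h)\<^sup>2"
        using mult_left_mono[of "norm h" \<delta> "C * norm h"] h C(1) unfolding right_diff_distrib sg
        by (simp add: power2_eq_square mult_ac)
      also have "\<dots> \<le> ?w" using C(2)[of h x] h \<delta> by simp
      finally have "\<bar>mollifyG \<eta> u x \<bullet> sgn h\<bar> - C * \<delta> \<le> ?w / norm h"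
        using h by (simp add: field_simps)
      then have "(max 0 (\<bar>mollifyG \<eta> u x \<bullet> sgn h\<bar> - C * \<delta>)) powr p \<le> (?w / norm h) powr p"
        using p by (intro powr_mono2) auto
      also have "\<dots> = norm h powr (- p) * ?w powr p"
        using h by (simp add: powr_divide powr_minus_divide)
      finally show "ennreal ((max 0 (\<bar>mollifyG \<eta> u x \<bullet> sgn h\<bar> - C * \<delta>)) powr p) \<le> ennreal (norm h powr (- p)) * ennreal (?w powr p)"
        by (simp add: ennreal_mult'[symmetric] ennreal_leI)
    qed auto
    also have "\<dots> = ennreal (norm h powr (- p)) * (\<integral>\<^sup>+x\<in>cball 0 R. ennreal (\<bar>mollify \<eta> u (x + h) - mollify \<eta> u x\<bar> powr p) \<partial>lborel)"
      using borel_measurable_continuous_onI[OF mollify_cont[OF u \<eta>]]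
      by (subst nn_integral_cmult[symmetric]) (auto simp: mult.assoc)
    also have "\<dots> \<le> ennreal (norm h powr (- p)) * (\<integral>\<^sup>+x\<in>cball 0 (R + \<eta>). ennreal (\<bar>u (x + h) - u x\<bar> powr p) \<partial>lborel)"
      by (intro mult_left_mono mollify_diff_powr_le u \<eta> p) auto
    finally show ?thesis .
  qed
  have main: "ennreal (\<delta> powr \<epsilon>) * J \<le> ennreal (\<epsilon> * (A powr (p - q) * (\<Lambda> powr q * v + q * M0 * \<Lambda> powr (q - p) / (p - q))))"
    if q: "0 < q" "q < p" and \<epsilon>: "\<epsilon> = (p - q) * (p + \<gamma>) / p" "\<epsilon> < 1" for q \<epsilon>
  proof -
    have \<epsilon>0: "0 < \<epsilon>" using q p \<gamma> by (simp add: \<epsilon>)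
    have "ennreal (\<delta> powr \<epsilon>) * J = ennreal \<epsilon> * (\<integral>\<^sup>+h\<in>ball 0 \<delta>. ennreal (norm h powr (\<epsilon> - N)) * f (sgn h) \<partial>lborel)"
      unfolding J_def N_def by (rule polar_kernel[symmetric]) (use \<epsilon>0 \<epsilon> \<delta> in auto)
    also have "\<dots> \<le> ennreal \<epsilon> * (\<integral>\<^sup>+h\<in>ball 0 1. ennreal (norm h powr (\<epsilon> - N - p)) * (\<integral>\<^sup>+x\<in>cball 0 (R + \<eta>). ennreal (\<bar>u (x + h) - u x\<bar> powr p) \<partial>lborel) \<partial>lborel)"
    proof (rule mult_left_mono, rule nn_integral_mono_AE, rule AE_mp[OF AE_lborel_singleton[of 0]], intro AE_I2 impI)
      fix h :: 'a assume h: "h \<noteq> 0"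
      let ?I = "\<integral>\<^sup>+x\<in>cball 0 (R + \<eta>). ennreal (\<bar>u (x + h) - u x\<bar> powr p) \<partial>lborel"
      show "ennreal (norm h powr (\<epsilon> - N)) * f (sgn h) * indicator (ball 0 \<delta>) h \<le> ennreal (norm h powr (\<epsilon> - N - p)) * ?I * indicator (ball 0 1) h"
      proof (cases "norm h < \<delta>")
        case True
        have "norm h powr (\<epsilon> - N) * norm h powr (- p) = norm h powr (\<epsilon> - N - p)"
          by (simp add: powr_add[symmetric])
        then have "ennreal (norm h powr (\<epsilon> - N)) * ennreal (norm h powr (- p)) = ennreal (norm h powr (\<epsilon> - N - p))"
          by (simp add: ennreal_mult'[symmetric])
        then have "ennreal (norm h powr (\<epsilon> - N)) * f (sgn h) \<le> ennreal (norm h powr (\<epsilon> - N - p)) * ?I"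
          using mult_left_mono[OF lower[OF h True], of "ennreal (norm h powr (\<epsilon> - N))"]
          by (simp add: mult.assoc[symmetric])
        then show ?thesis using True \<delta> by simp
      qed simp
    qed simp
    also have "\<dots> \<le> ennreal \<epsilon> * (ennreal (A powr (p - q)) * (ennreal (\<Lambda> powr q) * V + ennreal (q * M0 * \<Lambda> powr (q - p) / (p - q))))"
      unfolding V_def N_def \<epsilon>(1) using q p \<gamma> \<Lambda> M0
      by (intro mult_left_mono difference_energy_le A0 le) auto
    also have "\<dots> = ennreal (\<epsilon> * (A powr (p - q) * (\<Lambda> powr q * v + q * M0 * \<Lambda> powr (q - p) / (p - q))))"
      using v \<epsilon>0 q M0 by (simp add: ennreal_mult'[symmetric] ennreal_plus[symmetric] del: ennreal_plus)
    finally show ?thesis .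
  qed
  \<comment> \<open>Two successors keep \<epsilon> strictly below 1, as \<open>polar_kernel\<close>
    requires, and \<open>q n\<close> is obtained by solving the relation between \<epsilon> and
    q.\<close>
  define \<epsilon> where "\<epsilon> n = inverse (real (Suc (Suc n)))" for n
  define q where "q n = p - \<epsilon> n * p / (p + \<gamma>)" for n
  have \<epsilon>: "0 < \<epsilon> n" "\<epsilon> n < 1" for n by (auto simp: \<epsilon>_def field_simps)
  have q: "0 < q n" "q n < p" "\<epsilon> n = (p - q n) * (p + \<gamma>) / p" "\<epsilon> n / (p - q n) = (p + \<gamma>) / p" for n
  proof -
    have "\<epsilon> n * p < 1 * (p + \<gamma>)" using \<epsilon>[of n] p \<gamma> by (intro mult_strict_mono) auto
    then have "\<epsilon> n * p / (p + \<gamma>) < 1" using p \<gamma> by (simp add: divide_less_eq)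
    then show "0 < q n" using p by (simp add: q_def)
    show "q n < p" using p \<gamma> \<epsilon>[of n] by (simp add: q_def)
    show "\<epsilon> n = (p - q n) * (p + \<gamma>) / p" using p \<gamma> by (simp add: q_def)
    show "\<epsilon> n / (p - q n) = (p + \<gamma>) / p" using p \<gamma> \<epsilon>[of n] by (simp add: q_def)
  qed
  have e0: "\<epsilon> \<longlonglongrightarrow> 0"
    unfolding \<epsilon>_def by (rule LIMSEQ_Suc[OF LIMSEQ_inverse_real_of_nat])
  have qp: "q \<longlonglongrightarrow> p - 0 * p / (p + \<gamma>)"
    unfolding q_def using p \<gamma> by (intro tendsto_intros e0) auto
  define r where "r n = A powr (p - q n) * (\<epsilon> n * (\<Lambda> powr q n * v) + q n * M0 * \<Lambda> powr (q n - p) * ((p + \<gamma>) / p)) * (\<delta> powr (- \<epsilon> n))" for n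
  have Jr: "J \<le> ennreal (r n)" for n
  proof -
    have "J = ennreal (\<delta> powr (- \<epsilon> n)) * (ennreal (\<delta> powr \<epsilon> n) * J)"
      using \<delta> by (simp add: mult.assoc[symmetric] ennreal_mult'[symmetric] powr_add[symmetric])
    also have "\<dots> \<le> ennreal (\<delta> powr (- \<epsilon> n)) * ennreal (\<epsilon> n * (A powr (p - q n) * (\<Lambda> powr q n * v + q n * M0 * \<Lambda> powr (q n - p) / (p - q n))))"
      by (intro mult_left_mono main q \<epsilon>) auto
    also have "\<dots> = ennreal (r n)"
    proof -
      have eq: "\<epsilon> n * (A powr (p - q n) * (\<Lambda> powr q n * v + q n * M0 * \<Lambda> powr (q n - p) / (p - q n)))
        = A powr (p - q n) * (\<epsilon> n * (\<Lambda> powr q n * v) + q n * M0 * \<Lambda> powr (q n - p) * (\<epsilon> n / (p - q n)))"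
        by (simp add: distrib_left mult_ac)
      show ?thesis unfolding ennreal_mult'[symmetric, OF powr_ge_zero] eq q(4) r_def by (simp only: mult_ac)
    qed
    finally show ?thesis .
  qed
  \<comment> \<open>The powers of A, \<Lambda> and \<delta> with vanishing exponents tend to 1, the
    term with v dies with \<epsilon>, and q (p + \<gamma>)/p tends to p + \<gamma>.\<close>
  have "r \<longlonglongrightarrow> A powr (p - (p - 0 * p / (p + \<gamma>))) * (0 * (\<Lambda> powr (p - 0 * p / (p + \<gamma>)) * v) + (p - 0 * p / (p + \<gamma>)) * M0 * \<Lambda> powr ((p - 0 * p / (p + \<gamma>)) - p) * ((p + \<gamma>) / p)) * (\<delta> powr (- 0))"
    unfolding r_def using A0(2) \<Lambda> \<delta> by (intro tendsto_intros qp e0) auto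
  then have "r \<longlonglongrightarrow> (p + \<gamma>) * M0" using A0(2) \<Lambda> \<delta> p by (simp add: mult_ac)
  then have "(\<lambda>n. ennreal (r n)) \<longlonglongrightarrow> ennreal ((p + \<gamma>) * M0)" by (rule tendsto_ennrealI)
  then have "J \<le> ennreal ((p + \<gamma>) * M0)" by (rule LIMSEQ_le_const) (use Jr in auto)
  then show ?thesis unfolding J_def f_def .
qed

text \<open>The error \<delta> shrinks and the ball grows along the same index. Fatou's lemma is
  used twice, first in x for each direction and then over the directions, because nothing guarantees
  that the integrands increase with n.\<close>

lemma mollifyG_energy_le_bounded:
  fixes u :: "'a::euclidean_space \<Rightarrow> real"
  assumes u: "loc_int u" and A: "\<And>x. \<bar>u x\<bar> \<le> A" "0 < A"
    and p: "1 \<le> p" and \<gamma>: "0 < \<gamma>" and \<eta>: "0 < \<eta>" and \<Lambda>: "0 < \<Lambda>" and M0: "0 \<le> M0"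
    and le: "\<And>l. \<Lambda> \<le> l \<Longrightarrow> superlevel_mass p \<gamma> l u \<le> ennreal M0"
    and e: "norm (e::'a) = 1"
  shows "K_const e p * energy p (mollifyG \<eta> u) \<le> ennreal ((p + \<gamma>) * M0)"
proof -
  obtain C where C: "C \<ge> 0"
    "\<And>x h. norm h \<le> 1 \<Longrightarrow> \<bar>mollifyG \<eta> u x \<bullet> h\<bar> - C * (norm h)\<^sup>2 \<le> \<bar>mollify \<eta> u (x + h) - mollify \<eta> u x\<bar>"
    using mollify_diff_lower[OF u A(1) \<eta>] by blast
  have A2: "\<bar>u x - u y\<bar> \<le> 2 * A" for x y using A(1)[of x] A(1)[of y] by linarith
  have [measurable]: "mollifyG \<eta> u \<in> borel_measurable borel"
    by (rule borel_measurable_continuous_onI[OF mollifyG_cont[OF u \<eta>]])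
  define d where "d n = inverse (real (Suc n))" for n
  define F where "F n h x = ennreal ((max 0 (\<bar>mollifyG \<eta> u x \<bullet> sgn h\<bar> - C * d n)) powr p) * indicator (cball 0 (real n)) x" for n and h x :: 'a
  define f where "f h x = ennreal (\<bar>mollifyG \<eta> u x \<bullet> sgn h\<bar> powr p)" for h x :: 'a
  have [measurable]: "case_prod (F n) \<in> borel_measurable (borel \<Otimes>\<^sub>M borel)" for n unfolding F_def by measurable
  have [measurable]: "case_prod f \<in> borel_measurable (borel \<Otimes>\<^sub>M borel)" unfolding f_def by measurable
  have lim: "(\<lambda>n. F n h x) \<longlonglongrightarrow> f h x" for h x
  proof -
    obtain k where k: "norm x \<le> real k" using real_arch_simple by blast
    have "(\<lambda>n. (max 0 (\<bar>mollifyG \<eta> u x \<bullet> sgn h\<bar> - C * d n)) powr p) \<longlonglongrightarrow> (max 0 (\<bar>mollifyG \<eta> u x \<bullet> sgn h\<bar> - C * 0)) powr p"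
      unfolding d_def using p by (intro tendsto_intros LIMSEQ_inverse_real_of_nat tendsto_powr') auto
    then have "(\<lambda>n. ennreal ((max 0 (\<bar>mollifyG \<eta> u x \<bullet> sgn h\<bar> - C * d n)) powr p)) \<longlonglongrightarrow> f h x"
      unfolding f_def by (intro tendsto_ennrealI) simp
    moreover have "\<forall>\<^sub>F n in sequentially. F n h x = ennreal ((max 0 (\<bar>mollifyG \<eta> u x \<bullet> sgn h\<bar> - C * d n)) powr p)"
      using eventually_ge_at_top[of k] by eventually_elim (use k in \<open>auto simp: F_def\<close>)
    ultimately show ?thesis by (simp add: tendsto_cong)
  qed
  have bound: "of_nat DIM('a) * (\<integral>\<^sup>+h\<in>ball 0 1. (\<integral>\<^sup>+x. F n h x \<partial>lborel) \<partial>lborel) \<le> ennreal ((p + \<gamma>) * M0)" for n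
    unfolding F_def
    by (rule directional_energy_le[OF u A2 _ p \<gamma> \<eta> \<Lambda> M0 le C]) (use A in \<open>auto simp: d_def field_simps\<close>)
  have fatou1: "(\<integral>\<^sup>+x. f h x \<partial>lborel) \<le> liminf (\<lambda>n. \<integral>\<^sup>+x. F n h x \<partial>lborel)" for h
  proof -
    have "(\<integral>\<^sup>+x. f h x \<partial>lborel) = (\<integral>\<^sup>+x. liminf (\<lambda>n. F n h x) \<partial>lborel)"
      by (intro nn_integral_cong lim_imp_Liminf[symmetric] lim) auto
    also have "\<dots> \<le> liminf (\<lambda>n. \<integral>\<^sup>+x. F n h x \<partial>lborel)" by (rule nn_integral_liminf) measurable
    finally show ?thesis .
  qed
  have "(\<integral>\<^sup>+h\<in>ball 0 1. (\<integral>\<^sup>+x. f h x \<partial>lborel) \<partial>lborel) \<le> (\<integral>\<^sup>+h. liminf (\<lambda>n. (\<integral>\<^sup>+x. F n h x \<partial>lborel) * indicator (ball 0 1) h) \<partial>lborel)"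
    using fatou1 by (intro nn_integral_mono) (auto simp: indicator_def)
  also have "\<dots> \<le> liminf (\<lambda>n. \<integral>\<^sup>+h\<in>ball 0 1. (\<integral>\<^sup>+x. F n h x \<partial>lborel) \<partial>lborel)" by (rule nn_integral_liminf) measurable
  finally have le1: "(\<integral>\<^sup>+h\<in>ball 0 1. (\<integral>\<^sup>+x. f h x \<partial>lborel) \<partial>lborel) \<le> liminf (\<lambda>n. \<integral>\<^sup>+h\<in>ball 0 1. (\<integral>\<^sup>+x. F n h x \<partial>lborel) \<partial>lborel)" .
  have "(\<integral>\<^sup>+h\<in>ball 0 1. (\<integral>\<^sup>+x. F n h x \<partial>lborel) \<partial>lborel) \<le> ennreal ((p + \<gamma>) * M0 / real DIM('a))" for n
  proof -
    have "ennreal (1 / real DIM('a)) * (of_nat DIM('a) * (\<integral>\<^sup>+h\<in>ball 0 1. (\<integral>\<^sup>+x. F n h x \<partial>lborel) \<partial>lborel)) \<le> ennreal (1 / real DIM('a)) * ennreal ((p + \<gamma>) * M0)"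
      by (intro mult_left_mono bound) auto
    then show ?thesis
      by (simp add: mult.assoc[symmetric] ennreal_of_nat_eq_real_of_nat ennreal_mult'[symmetric])
  qed
  then have "liminf (\<lambda>n. \<integral>\<^sup>+h\<in>ball 0 1. (\<integral>\<^sup>+x. F n h x \<partial>lborel) \<partial>lborel) \<le> ennreal ((p + \<gamma>) * M0 / real DIM('a))"
    by (intro Liminf_le always_eventually) auto
  with le1 have le2: "(\<integral>\<^sup>+h\<in>ball 0 1. (\<integral>\<^sup>+x. f h x \<partial>lborel) \<partial>lborel) \<le> ennreal ((p + \<gamma>) * M0 / real DIM('a))"
    by (rule order_trans)
  \<comment> \<open>With the order exchanged, the inner integral over h is \<open>K_ball\<close> at
    the gradient vector, so \<open>K_ball_scale\<close> produces its norm.\<close>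
  have "(\<integral>\<^sup>+h\<in>ball 0 1. (\<integral>\<^sup>+x. f h x \<partial>lborel) \<partial>lborel) = (\<integral>\<^sup>+h. (\<integral>\<^sup>+x. f h x * indicator (ball 0 1) h \<partial>lborel) \<partial>lborel)"
    by (subst nn_integral_multc) auto
  also have "\<dots> = (\<integral>\<^sup>+x. (\<integral>\<^sup>+h. f h x * indicator (ball 0 1) h \<partial>lborel) \<partial>lborel)"
    by (rule lborel_pair.Fubini') measurable
  also have "\<dots> = (\<integral>\<^sup>+x. ennreal (norm (mollifyG \<eta> u x) powr p) * K_ball e p \<partial>lborel)"
    unfolding f_def K_ball_def[symmetric] by (intro nn_integral_cong K_ball_scale[OF e p])
  also have "\<dots> = K_ball e p * energy p (mollifyG \<eta> u)"
    by (subst nn_integral_multc) (auto simp: mult.commute)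
  finally have eq: "K_const e p * energy p (mollifyG \<eta> u) = of_nat DIM('a) * (\<integral>\<^sup>+h\<in>ball 0 1. (\<integral>\<^sup>+x. f h x \<partial>lborel) \<partial>lborel)"
    by (simp add: K_const_eq mult.assoc)
  also have "\<dots> \<le> of_nat DIM('a) * ennreal ((p + \<gamma>) * M0 / real DIM('a))" by (intro mult_left_mono le2) auto
  also have "\<dots> = ennreal ((p + \<gamma>) * M0)" by (simp add: ennreal_of_nat_eq_real_of_nat ennreal_mult'[symmetric])
  finally show ?thesis .
qed

text \<open>Truncation is 1-Lipschitz, so it only shrinks the superlevel sets and inherits the
  hypothesis with the same constant. As the bound is independent of the truncation level, Fatou's
  lemma removes it.\<close>

lemma mollifyG_energy_le:
  fixes u :: "'a::euclidean_space \<Rightarrow> real"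
  assumes u: "loc_int u"
    and p: "1 \<le> p" and \<gamma>: "0 < \<gamma>" and \<eta>: "0 < \<eta>" and \<Lambda>: "0 < \<Lambda>" and M0: "0 \<le> M0"
    and le: "\<And>l. \<Lambda> \<le> l \<Longrightarrow> superlevel_mass p \<gamma> l u \<le> ennreal M0"
    and e: "norm (e::'a) = 1"
  shows "K_const e p * energy p (mollifyG \<eta> u) \<le> ennreal ((p + \<gamma>) * M0)"
proof -
  have [measurable]: "u \<in> borel_measurable borel" using u by (rule loc_int_measurable)
  \<comment> \<open>The level starts at 1 because the estimate for bounded functions asks for a
    positive bound.\<close>
  define v where "v n x = max (- real (Suc n)) (min (real (Suc n)) (u x))" for n x
  have vu: "\<bar>v n x\<bar> \<le> \<bar>u x\<bar>" and vd: "\<bar>v n x - v n y\<bar> \<le> \<bar>u x - u y\<bar>" and vb: "\<bar>v n x\<bar> \<le> real (Suc n)" for n x y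
    by (auto simp: v_def max_def min_def)
  have vm[measurable]: "v n \<in> borel_measurable borel" for n unfolding v_def by measurable
  have v: "loc_int (v n)" for n
    unfolding loc_int_def
  proof safe
    fix R
    show "integrable lborel (\<lambda>x. indicat_real (cball 0 R) x *\<^sub>R v n x)"
      by (rule loc_int_integrable[OF u, of _ 1 R]) (auto intro: mult_left_mono vu simp: abs_mult)
  qed (rule vm)
  have bd: "K_const e p * energy p (mollifyG \<eta> (v n)) \<le> ennreal ((p + \<gamma>) * M0)" for n
  proof (rule mollifyG_energy_le_bounded[OF v vb _ p \<gamma> \<eta> \<Lambda> M0 _ e])
    fix l assume l: "\<Lambda> \<le> l"
    have "superlevel_mass p \<gamma> l (v n)
      \<le> superlevel_mass p \<gamma> l u"
    proof (intro mult_left_mono nn_integral_mono)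
      fix z :: "'a \<times> 'a"
      have "\<bar>v n (snd z + fst z) - v n (snd z)\<bar> / norm (fst z) powr (1 + \<gamma> / p) \<le> \<bar>u (snd z + fst z) - u (snd z)\<bar> / norm (fst z) powr (1 + \<gamma> / p)"
        by (intro divide_right_mono vd) auto
      then show "(indicator {z. l < \<bar>v n (snd z + fst z) - v n (snd z)\<bar> / norm (fst z) powr (1 + \<gamma> / p)} z :: ennreal)
        \<le> indicator {z. l < \<bar>u (snd z + fst z) - u (snd z)\<bar> / norm (fst z) powr (1 + \<gamma> / p)} z"
        by (auto simp: indicator_def)
    qed auto
    also have "\<dots> \<le> ennreal M0" by (rule le[OF l])
    finally show "superlevel_mass p \<gamma> l (v n) \<le> ennreal M0" .
  qed simp
  have lim: "(\<lambda>n. mollifyG \<eta> (v n) x) \<longlonglongrightarrow> mollifyG \<eta> u x" for x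
  proof -
    obtain B where B: "B \<ge> 0" "\<And>(x::'a) y R. norm x \<le> R \<Longrightarrow> norm (kernG \<eta> (y - x)) \<le> B * indicat_real (cball 0 (R + \<eta>)) y"
      using shifted_supp_bound[OF kernG_cont kernG_supp[OF \<eta>]] by blast
    show ?thesis unfolding mollifyG_def
    proof (rule integral_dominated_convergence[OF _ _ loc_int_dom[OF u, of B "norm x + \<eta>"]])
      show "AE y in lborel. (\<lambda>n. v n y *\<^sub>R kernG \<eta> (y - x)) \<longlonglongrightarrow> u y *\<^sub>R kernG \<eta> (y - x)"
      proof (intro AE_I2 tendsto_intros)
        fix y
        obtain k where k: "\<bar>u y\<bar> \<le> real k" using real_arch_simple by blast
        have "\<forall>\<^sub>F n in sequentially. v n y = u y"
          using eventually_ge_at_top[of k] by eventually_elim (use k in \<open>auto simp: v_def max_def min_def\<close>)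
        then show "(\<lambda>n. v n y) \<longlonglongrightarrow> u y" by (rule tendsto_eventually)
      qed
      show "AE y in lborel. norm (v n y *\<^sub>R kernG \<eta> (y - x)) \<le> B * (indicat_real (cball 0 (norm x + \<eta>)) y * norm (u y))" for n
      proof (intro AE_I2)
        fix y
        have "norm (v n y *\<^sub>R kernG \<eta> (y - x)) \<le> norm (u y *\<^sub>R kernG \<eta> (y - x))" using vu by (simp add: mult_right_mono)
        also have "\<dots> \<le> B * (indicat_real (cball 0 (norm x + \<eta>)) y * norm (u y))" by (intro conv_bound B) auto
        finally show "norm (v n y *\<^sub>R kernG \<eta> (y - x)) \<le> B * (indicat_real (cball 0 (norm x + \<eta>)) y * norm (u y))" .
      qed
    qed auto
  qed
  have Km: "K_const e p * energy p (mollifyG \<eta> w) = (\<integral>\<^sup>+x. K_const e p * ennreal (norm (mollifyG \<eta> w x) powr p) \<partial>lborel)"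
    if "loc_int w" for w
    using borel_measurable_continuous_onI[OF mollifyG_cont[OF that \<eta>]] by (subst nn_integral_cmult) auto
  \<comment> \<open>Multiplication by a constant is continuous on \<open>ennreal\<close> at 0 only
    when the constant is finite.\<close>
  have Kfin: "K_const e p \<noteq> \<infinity>"
    using K_ball_finite[OF e p] by (auto simp: K_const_eq ennreal_mult_eq_top_iff)
  have "K_const e p * energy p (mollifyG \<eta> u) = (\<integral>\<^sup>+x. liminf (\<lambda>n. K_const e p * ennreal (norm (mollifyG \<eta> (v n) x) powr p)) \<partial>lborel)"
    unfolding Km[OF u]
  proof (intro nn_integral_cong lim_imp_Liminf[symmetric])
    fix x
    have "(\<lambda>n. norm (mollifyG \<eta> (v n) x) powr p) \<longlonglongrightarrow> norm (mollifyG \<eta> u x) powr p"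
      using p by (intro tendsto_powr' tendsto_norm lim tendsto_const) auto
    then show "(\<lambda>n. K_const e p * ennreal (norm (mollifyG \<eta> (v n) x) powr p)) \<longlonglongrightarrow> K_const e p * ennreal (norm (mollifyG \<eta> u x) powr p)"
      using Kfin by (intro ennreal_tendsto_cmult tendsto_ennrealI) (auto simp: less_top)
  qed auto
  also have "\<dots> \<le> liminf (\<lambda>n. \<integral>\<^sup>+x. K_const e p * ennreal (norm (mollifyG \<eta> (v n) x) powr p) \<partial>lborel)"
    using borel_measurable_continuous_onI[OF mollifyG_cont[OF v \<eta>]] by (intro nn_integral_liminf) auto
  also have "\<dots> \<le> ennreal ((p + \<gamma>) * M0)"
    using bd unfolding Km[OF v] by (intro Liminf_le always_eventually) auto
  finally show ?thesis .
qed

section \<open>Change of representative and of variables in the functional\<close>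

lemma AE_lborel_fst_snd:
  assumes "AE x in (lborel :: 'a::euclidean_space measure). P x"
  shows "AE z in (lborel :: ('a \<times> 'a) measure). P (fst z) \<and> P (snd z)"
proof -
  obtain N where N: "{x. \<not> P x} \<subseteq> N" "emeasure lborel N = 0" "N \<in> sets lborel"
    using assms by (auto elim!: AE_E)
  have [measurable]: "N \<in> sets borel" using N by simp
  have "emeasure (lborel \<Otimes>\<^sub>M lborel) (N \<times> (UNIV::'a set)) = 0" "emeasure (lborel \<Otimes>\<^sub>M lborel) ((UNIV::'a set) \<times> N) = 0"
    using N by (simp_all add: lborel.emeasure_pair_measure_Times)
  then have "N \<times> UNIV \<in> null_sets (lborel :: ('a \<times> 'a) measure)" "UNIV \<times> N \<in> null_sets (lborel :: ('a \<times> 'a) measure)"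
    by (auto simp: null_sets_def lborel_prod borel_prod[symmetric])
  then have "N \<times> UNIV \<union> UNIV \<times> N \<in> null_sets (lborel :: ('a \<times> 'a) measure)" by (rule null_sets.Un)
  then show ?thesis by (rule AE_I') (use N in auto)
qed

lemma Phi_lambda_cong_AE:
  fixes u v :: "'a::euclidean_space \<Rightarrow> real"
  assumes "AE x in lborel. u x = v x"
  shows "Phi_lambda p \<gamma> l u = Phi_lambda p \<gamma> l v"
proof -
  have "AE z in (lebesgue :: ('a \<times> 'a) measure). u (fst z) = v (fst z) \<and> u (snd z) = v (snd z)"
    using AE_lborel_fst_snd[OF assms] by (rule AE_completion)
  then show ?thesis unfolding Phi_lambda_def
    by (intro arg_cong2[where f = "(*)"] refl nn_integral_cong_AE) (auto simp: indicator_def)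
qed

lemma Phi_lambda_eq:
  fixes u :: "'a::euclidean_space \<Rightarrow> real"
  assumes [measurable]: "u \<in> borel_measurable borel"
  shows "Phi_lambda p \<gamma> l u = superlevel_mass p \<gamma> l u"
proof -
  \<comment> \<open>Isolating the dependence on the distance r and the difference d makes the
    measurability of both integrands on the product space automatic; the strict inequality becomes
    membership in an open ray.\<close>
  define g where "g r d = ennreal (r powr (\<gamma> - real DIM('a))) * indicator {l<..} (d / r powr (1 + \<gamma> / p))" for r d :: real
  define f where "f = (\<lambda>(x, y). g (norm (x - y)) \<bar>u x - u y\<bar>)"
  define f' where "f' = (\<lambda>(h, x). g (norm h) \<bar>u (x + h) - u x\<bar>)"
  have [measurable]: "f \<in> borel_measurable (borel \<Otimes>\<^sub>M borel)" "f' \<in> borel_measurable (borel \<Otimes>\<^sub>M borel)"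
    unfolding f_def f'_def g_def by measurable
  have m: "f \<in> borel_measurable borel" "f' \<in> borel_measurable borel"
    using \<open>f \<in> _\<close> \<open>f' \<in> _\<close> by (simp_all add: borel_prod)
  have "Phi_lambda p \<gamma> l u = ennreal (l powr p) * (\<integral>\<^sup>+z. f z \<partial>lborel)"
    unfolding Phi_lambda_def nn_integral_completion
    by (intro arg_cong2[where f = "(*)"] refl nn_integral_cong) (auto simp: f_def g_def indicator_def)
  also have "(\<integral>\<^sup>+z. f z \<partial>lborel) = (\<integral>\<^sup>+x. \<integral>\<^sup>+y. f (x, y) \<partial>lborel \<partial>lborel)"
    by (rule nn_integral_lborel_prod[OF m(1)])
  also have "\<dots> = (\<integral>\<^sup>+x. \<integral>\<^sup>+h. f (x, h + x) \<partial>lborel \<partial>lborel)"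
    by (intro nn_integral_cong nn_integral_lborel_shift[symmetric]) measurable
  also have "\<dots> = (\<integral>\<^sup>+x. \<integral>\<^sup>+h. f' (h, x) \<partial>lborel \<partial>lborel)"
    by (simp add: f_def f'_def abs_minus_commute add.commute)
  also have "\<dots> = (\<integral>\<^sup>+z. f' z \<partial>lborel)"
    by (rule nn_integral_lborel_prod_swap[OF m(2), symmetric])
  also have "\<dots> = (\<integral>\<^sup>+z. ennreal (norm (fst z) powr (\<gamma> - real DIM('a))) *
        indicator {z. l < \<bar>u (snd z + fst z) - u (snd z)\<bar> / norm (fst z) powr (1 + \<gamma> / p)} z \<partial>(lborel :: ('a \<times> 'a) measure))"
    by (intro nn_integral_cong) (auto simp: f'_def g_def indicator_def)
  finally show ?thesis .
qed

section \<open>Total variation\<close>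

text \<open>Only the derivative along b is recorded, which is all that integration by parts in that
  direction uses. The notion therefore covers smooth test functions as well as translates of the
  kernel, which are not smooth.\<close>

definition C1c_deriv :: "'a::euclidean_space \<Rightarrow> ('a \<Rightarrow> real) \<Rightarrow> ('a \<Rightarrow> real) \<Rightarrow> bool" where
  "C1c_deriv b f f' \<longleftrightarrow> continuous_on UNIV f \<and> continuous_on UNIV f' \<and> (\<exists>R. \<forall>x. R \<le> norm x \<longrightarrow> f x = 0) \<and>
     (\<forall>x. ((\<lambda>t. f (x + t *\<^sub>R b)) has_real_derivative f' x) (at 0))"

lemma C1c_deriv_supp:
  assumes "C1c_deriv b f f'"
  obtains R where "\<And>x. norm x \<ge> R \<Longrightarrow> f x = 0" "\<And>x. norm x \<ge> R \<Longrightarrow> f' x = 0"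
proof -
  obtain R where R: "\<And>x. norm x \<ge> R \<Longrightarrow> f x = 0"
    and der: "\<And>x. ((\<lambda>t. f (x + t *\<^sub>R b)) has_real_derivative f' x) (at 0)"
    using assms by (auto simp: C1c_deriv_def)
  \<comment> \<open>Beyond R + 1 the function f vanishes on a whole neighbourhood of x, so its
    derivative vanishes too; at radius R itself this neighbourhood could be missing.\<close>
  show thesis
  proof (rule that[of "R + 1"])
    fix x :: 'a assume x: "norm x \<ge> R + 1"
    have "((\<lambda>t. norm (x + t *\<^sub>R b)) \<longlongrightarrow> norm (x + 0 *\<^sub>R b)) (nhds (0::real))"
      by (intro tendsto_intros filterlim_ident)
    then have "\<forall>\<^sub>F t in nhds 0. norm (x + t *\<^sub>R b) > R"
      using x by (intro order_tendstoD(1)) auto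
    then have "\<forall>\<^sub>F t in nhds 0. f (x + t *\<^sub>R b) = 0" by eventually_elim (simp add: R)
    then have "((\<lambda>t. f (x + t *\<^sub>R b)) has_real_derivative f' x) (at 0) \<longleftrightarrow> ((\<lambda>t. 0) has_real_derivative f' x) (at 0)"
      by (rule DERIV_cong_ev[OF refl _ refl])
    then have "((\<lambda>t::real. 0::real) has_real_derivative f' x) (at 0)" using der by blast
    then show "f' x = 0" by (rule DERIV_unique) (rule DERIV_const)
  qed (use R in auto)
qed

lemma C1c_deriv_integrable:
  fixes u :: "'a::euclidean_space \<Rightarrow> 'b::euclidean_space"
  assumes u: "loc_int u" and f: "C1c_deriv b f f'"
  shows "integrable lborel (\<lambda>x. f x *\<^sub>R u x)" "integrable lborel (\<lambda>x. f' x *\<^sub>R u x)"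
proof -
  have [measurable]: "u \<in> borel_measurable borel" "f \<in> borel_measurable borel" "f' \<in> borel_measurable borel"
    using u f by (auto intro: borel_measurable_continuous_onI loc_int_measurable simp: C1c_deriv_def)
  obtain R where R: "\<And>x. norm x \<ge> R \<Longrightarrow> f x = 0" "\<And>x. norm x \<ge> R \<Longrightarrow> f' x = 0"
    using C1c_deriv_supp[OF f] by blast
  have c: "continuous_on UNIV f" "continuous_on UNIV f'" using f by (auto simp: C1c_deriv_def)
  obtain B where B: "\<And>x. norm (f x) \<le> B * indicat_real (cball 0 R) x"
    using continuous_supp_bounded[OF c(1) R(1)] by blast
  obtain B' where B': "\<And>x. norm (f' x) \<le> B' * indicat_real (cball 0 R) x"
    using continuous_supp_bounded[OF c(2) R(2)] by blast
  show "integrable lborel (\<lambda>x. f x *\<^sub>R u x)"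
    by (rule loc_int_integrable[OF u, of _ B R])
       (use mult_right_mono[OF B norm_ge_zero] in \<open>auto simp: mult.assoc\<close>)
  show "integrable lborel (\<lambda>x. f' x *\<^sub>R u x)"
    by (rule loc_int_integrable[OF u, of _ B' R])
       (use mult_right_mono[OF B' norm_ge_zero] in \<open>auto simp: mult.assoc\<close>)
qed

lemma mollifyG_limit:
  fixes u :: "'a::euclidean_space \<Rightarrow> real"
  assumes u: "loc_int u" and f: "C1c_deriv b f f'"
  shows "(\<lambda>n. LINT x|lborel. (mollifyG (inverse (real (Suc n))) u x \<bullet> b) * f x) \<longlonglongrightarrow>
     - (LINT x|lborel. u x * f' x)"
proof -
  obtain R where R: "\<And>x. norm x \<ge> R \<Longrightarrow> f x = 0" "\<And>x. norm x \<ge> R \<Longrightarrow> f' x = 0"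
    using C1c_deriv_supp[OF f] by blast
  show ?thesis
    by (rule mollifyG_weak_limit[OF u _ _ R]) (use f in \<open>auto simp: C1c_deriv_def\<close>)
qed

text \<open>The vector c selects a component of a vector field for the divergence; for real test
  functions c = 1 recovers the function itself.\<close>

lemma test_function_C1c:
  fixes \<phi> :: "'a::euclidean_space \<Rightarrow> 'b::euclidean_space"
  assumes "test_function \<phi>"
  shows "C1c_deriv b (\<lambda>x. \<phi> x \<bullet> c) (\<lambda>x. frechet_derivative \<phi> (at x) b \<bullet> c)"
proof -
  have "Ck (Suc 0) \<phi>" using assms unfolding test_function_def by blast
  then have diff: "\<And>x. \<phi> differentiable (at x)" and cont: "\<And>v. continuous_on UNIV (\<lambda>x. frechet_derivative \<phi> (at x) v)" by auto
  have der: "(\<phi> has_derivative frechet_derivative \<phi> (at x)) (at x)" for x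
    using diff frechet_derivative_works by blast
  have "bounded {x. \<phi> x \<noteq> 0}"
    using assms unfolding test_function_def by (meson bounded_closure_image bounded_subset closure_subset compact_imp_bounded)
  then obtain R where R0: "\<And>x. \<phi> x \<noteq> 0 \<Longrightarrow> norm x \<le> R" by (auto simp: bounded_iff)
  have R: "R + 1 \<le> norm x \<longrightarrow> \<phi> x \<bullet> c = 0" for x using R0[of x] by (cases "\<phi> x = 0") auto
  have c0: "continuous_on UNIV \<phi>" using diff by (simp add: continuous_on_eq_continuous_at differentiable_imp_continuous_within)
  show ?thesis unfolding C1c_deriv_def
  proof (intro conjI exI[of _ "R + 1"] R allI)
    show "continuous_on UNIV (\<lambda>x. \<phi> x \<bullet> c)" by (intro continuous_intros c0)
    show "continuous_on UNIV (\<lambda>x. frechet_derivative \<phi> (at x) b \<bullet> c)" by (intro continuous_intros cont)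
    fix x
    have lin: "linear (frechet_derivative \<phi> (at x))" using der[of x] by (rule has_derivative_linear)
    have "((\<lambda>t. x + t *\<^sub>R b) has_derivative (\<lambda>t. t *\<^sub>R b)) (at 0)" by (auto intro!: derivative_eq_intros)
    moreover have "(\<phi> has_derivative frechet_derivative \<phi> (at x)) (at (x + 0 *\<^sub>R b))" using der[of x] by simp
    ultimately have "((\<lambda>t. \<phi> (x + t *\<^sub>R b)) has_derivative (\<lambda>t. frechet_derivative \<phi> (at x) (t *\<^sub>R b))) (at 0)"
      using has_derivative_compose[of "\<lambda>t. x + t *\<^sub>R b" "\<lambda>t. t *\<^sub>R b" 0 UNIV \<phi>] by simp
    then have "((\<lambda>t. \<phi> (x + t *\<^sub>R b) \<bullet> c) has_derivative (\<lambda>t. frechet_derivative \<phi> (at x) (t *\<^sub>R b) \<bullet> c)) (at 0)"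
      by (rule has_derivative_inner_left)
    then show "((\<lambda>t. \<phi> (x + t *\<^sub>R b) \<bullet> c) has_real_derivative (frechet_derivative \<phi> (at x) b \<bullet> c)) (at 0)"
      by (simp add: has_field_derivative_def linear_scale[OF lin] mult_commute_abs)
  qed
qed

text \<open>Lower semicontinuity of the total variation: for a fixed field the pairings with the
  mollified gradients converge to minus the pairing of u with the divergence, and each of them is at
  most c since the field has norm at most 1 almost everywhere.\<close>

lemma total_variation_le:
  fixes u :: "'a::euclidean_space \<Rightarrow> real"
  assumes u: "loc_int u" and c: "0 \<le> c"
    and le: "\<And>n. (\<integral>\<^sup>+x. ennreal (norm (mollifyG (inverse (real (Suc n))) u x)) \<partial>lborel) \<le> ennreal c"
  shows "total_variation u \<le> ennreal c"
  unfolding total_variation_def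
proof (intro SUP_least, clarify)
  fix \<phi> :: "'a \<Rightarrow> 'a" assume \<phi>: "test_function \<phi>" and "AE x in lebesgue. norm (\<phi> x) \<le> 1"
  then have \<phi>1: "AE x in lborel. norm (\<phi> x) \<le> 1" by (simp add: AE_completion_iff)
  have [measurable]: "u \<in> borel_measurable borel" using u by (rule loc_int_measurable)
  define D where "D n = mollifyG (inverse (real (Suc n))) u" for n
  have Dc: "continuous_on UNIV (D n)" for n unfolding D_def by (rule mollifyG_cont[OF u]) simp
  have [measurable]: "D n \<in> borel_measurable borel" for n using Dc by (rule borel_measurable_continuous_onI)
  note tf = test_function_C1c[OF \<phi>]
  have [measurable]: "(\<lambda>x. frechet_derivative \<phi> (at x) b \<bullet> b) \<in> borel_measurable borel" for b
    using tf[of b b] by (auto simp: C1c_deriv_def intro: borel_measurable_continuous_onI)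
  have [measurable]: "(\<lambda>x. \<phi> x \<bullet> b) \<in> borel_measurable borel" for b
    using tf[of b b] by (auto simp: C1c_deriv_def intro: borel_measurable_continuous_onI)
  have m\<phi>[measurable]: "\<phi> \<in> borel_measurable borel"
    by (rule borel_measurable_euclidean_space[THEN iffD2]) auto
  have [measurable]: "divergence \<phi> \<in> borel_measurable borel" unfolding divergence_def[abs_def] by measurable
  have "(LINT x|lebesgue. u x * divergence \<phi> x) = (LINT x|lborel. u x * divergence \<phi> x)"
    by (rule integral_completion) measurable
  also have "\<dots> = (LINT x|lborel. (\<Sum>b\<in>Basis. u x * (frechet_derivative \<phi> (at x) b \<bullet> b)))"
    by (simp add: divergence_def sum_distrib_left)
  also have "\<dots> = (\<Sum>b\<in>Basis. LINT x|lborel. u x * (frechet_derivative \<phi> (at x) b \<bullet> b))"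
    using C1c_deriv_integrable(2)[OF u tf] by (intro Bochner_Integration.integral_sum) (simp add: mult.commute)
  finally have eq: "(LINT x|lebesgue. u x * divergence \<phi> x) = (\<Sum>b\<in>Basis. LINT x|lborel. u x * (frechet_derivative \<phi> (at x) b \<bullet> b))" .
  have lim: "(\<lambda>n. \<Sum>b\<in>Basis. LINT x|lborel. (D n x \<bullet> b) * (\<phi> x \<bullet> b)) \<longlonglongrightarrow> (\<Sum>b\<in>Basis. - (LINT x|lborel. u x * (frechet_derivative \<phi> (at x) b \<bullet> b)))"
    unfolding D_def by (intro tendsto_sum mollifyG_limit u tf)
  have bd: "\<bar>\<Sum>b\<in>Basis. LINT x|lborel. (D n x \<bullet> b) * (\<phi> x \<bullet> b)\<bar> \<le> c" for n
  proof -
    have "continuous_on UNIV (\<lambda>x. D n x \<bullet> b)" for b by (intro continuous_intros Dc)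
    from C1c_deriv_integrable(1)[OF continuous_loc_int[OF this] tf]
    have i: "integrable lborel (\<lambda>x. (D n x \<bullet> b) * (\<phi> x \<bullet> b))" for b by (simp add: mult.commute)
    have "(\<Sum>b\<in>Basis. LINT x|lborel. (D n x \<bullet> b) * (\<phi> x \<bullet> b)) = (LINT x|lborel. D n x \<bullet> \<phi> x)"
      unfolding euclidean_inner[of "D n x" "\<phi> x" for x]
      by (rule Bochner_Integration.integral_sum[symmetric]) (rule i)
    also have "norm \<dots> \<le> (LINT x|lborel. norm (D n x \<bullet> \<phi> x))" by (rule integral_norm_bound)
    also have "ennreal \<dots> \<le> (\<integral>\<^sup>+x. ennreal (norm (D n x)) \<partial>lborel)"
    proof -
      have "integrable lborel (\<lambda>x. D n x \<bullet> \<phi> x)"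
        unfolding euclidean_inner[of "D n x" "\<phi> x" for x] by (rule Bochner_Integration.integrable_sum) (rule i)
      then have "ennreal (LINT x|lborel. norm (D n x \<bullet> \<phi> x)) = (\<integral>\<^sup>+x. ennreal (norm (D n x \<bullet> \<phi> x)) \<partial>lborel)"
        by (intro nn_integral_eq_integral[symmetric] integrable_norm) auto
      also have "\<dots> \<le> (\<integral>\<^sup>+x. ennreal (norm (D n x)) \<partial>lborel)"
        using \<phi>1
      proof (intro nn_integral_mono_AE, eventually_elim)
        case (elim x)
        have "norm (D n x \<bullet> \<phi> x) \<le> norm (D n x) * norm (\<phi> x)" using Cauchy_Schwarz_ineq2 by simp
        also have "\<dots> \<le> norm (D n x) * 1" using elim by (intro mult_left_mono) auto
        finally show ?case by (simp add: ennreal_leI)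
      qed
      finally show ?thesis .
    qed
    also have "\<dots> \<le> ennreal c" unfolding D_def by (rule le)
    finally show ?thesis using c by (simp add: ennreal_leI)
  qed
  have "\<bar>\<Sum>b\<in>Basis. - (LINT x|lborel. u x * (frechet_derivative \<phi> (at x) b \<bullet> b))\<bar> \<le> c"
    by (rule LIMSEQ_le_const2[OF tendsto_rabs[OF lim]]) (use bd in auto)
  then have "\<bar>LINT x|lebesgue. u x * divergence \<phi> x\<bar> \<le> c" unfolding eq by (simp add: sum_negf)
  then show "ennreal \<bar>LINT x|lebesgue. u x * divergence \<phi> x\<bar> \<le> ennreal c" by (rule ennreal_leI)
qed

section \<open>Uniform convexity and completeness of \<open>L\<^sup>p\<close>\<close>

text \<open>The mean value theorem on both halves and strict monotonicity of the derivative. The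
  left half uses the version that asks only for continuity at the endpoints, as s may be 0.\<close>

lemma powr_midpoint_strict_aux:
  fixes p s t :: real
  assumes p: "1 < p" and st: "0 \<le> s" "s < t"
  shows "2 * ((s + t) / 2) powr p < s powr p + t powr p"
proof -
  define m where "m = (s + t) / 2"
  have m: "s < m" "m < t" "m - s = t - m" using st by (auto simp: m_def field_simps)
  have der: "((\<lambda>x. x powr p) has_real_derivative p * z powr (p - 1)) (at z)" if "0 < z" for z
    using that by (auto intro!: derivative_eq_intros)
  have "\<exists>l z. s < z \<and> z < m \<and> ((\<lambda>x. x powr p) has_real_derivative l) (at z) \<and> m powr p - s powr p = (m - s) * l"
  proof (rule MVT[OF m(1)])
    show "continuous_on {s..m} (\<lambda>x. x powr p)" using p st by (intro continuous_on_powr' continuous_intros) auto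
    show "(\<lambda>x. x powr p) differentiable (at x)" if "s < x" "x < m" for x
      using der[of x] that st by (auto simp: real_differentiable_def)
  qed
  then obtain l z where z: "s < z" "z < m" "((\<lambda>x. x powr p) has_real_derivative l) (at z)" "m powr p - s powr p = (m - s) * l" by blast
  have l: "l = p * z powr (p - 1)" using DERIV_unique[OF z(3) der[of z]] z st by auto
  have "\<exists>w. m < w \<and> w < t \<and> t powr p - m powr p = (t - m) * (p * w powr (p - 1))"
    by (rule MVT2[OF m(2)]) (use der m st in auto)
  then obtain w where w: "m < w" "w < t" "t powr p - m powr p = (t - m) * (p * w powr (p - 1))" by blast
  have "z powr (p - 1) < w powr (p - 1)" using p z w st by (intro powr_less_mono2) auto
  then have "(m - s) * (p * z powr (p - 1)) < (t - m) * (p * w powr (p - 1))"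
    using m p unfolding m(3) by (intro mult_strict_left_mono) auto
  then have "m powr p - s powr p < t powr p - m powr p" using z(4) w(3) l by simp
  then show ?thesis unfolding m_def[symmetric] by simp
qed

lemma powr_midpoint_strict:
  fixes p s t :: real
  assumes p: "1 < p" and st: "0 \<le> s" "0 \<le> t" "s \<noteq> t"
  shows "2 * ((s + t) / 2) powr p < s powr p + t powr p"
  using powr_midpoint_strict_aux[OF p, of s t] powr_midpoint_strict_aux[OF p, of t s] st
  by (cases "s < t") (auto simp: add.commute)

text \<open>Equality is excluded in two stages: strict convexity of the power forces equal norms,
  and the parallelogram law then forces equal vectors.\<close>

lemma norm_midpoint_le:
  fixes a b :: "'a::euclidean_space"
  assumes p: "1 < p"
  shows "2 * norm ((1/2) *\<^sub>R (a + b)) powr p \<le> norm a powr p + norm b powr p"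
    and "2 * norm ((1/2) *\<^sub>R (a + b)) powr p = norm a powr p + norm b powr p \<Longrightarrow> a = b"
proof -
  have "norm ((1/2) *\<^sub>R (a + b)) \<le> (norm a + norm b) / 2" using norm_triangle_ineq[of a b] by simp
  then have 1: "norm ((1/2) *\<^sub>R (a + b)) powr p \<le> ((norm a + norm b) / 2) powr p" using p by (intro powr_mono2) auto
  have 2: "2 * ((norm a + norm b) / 2) powr p \<le> norm a powr p + norm b powr p"
    using powr_midpoint_strict[OF p, of "norm a" "norm b"] by (cases "norm a = norm b") auto
  show "2 * norm ((1/2) *\<^sub>R (a + b)) powr p \<le> norm a powr p + norm b powr p" using 1 2 by simp
  assume eq: "2 * norm ((1/2) *\<^sub>R (a + b)) powr p = norm a powr p + norm b powr p"
  have ab: "norm a = norm b"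
    using powr_midpoint_strict[OF p, of "norm a" "norm b"] eq 1 by force
  have "norm ((1/2) *\<^sub>R (a + b)) powr p = norm a powr p" using eq ab by simp
  then have "(norm ((1/2) *\<^sub>R (a + b)) powr p) powr (1 / p) = (norm a powr p) powr (1 / p)" by (simp only:)
  then have "norm ((1/2) *\<^sub>R (a + b)) = norm a" using p by (simp add: powr_powr del: norm_scaleR)
  then have "norm (a + b) = 2 * norm a" by simp
  then have "(norm (a + b))\<^sup>2 = 4 * (norm a)\<^sup>2" by simp
  moreover have "(norm (a - b))\<^sup>2 + (norm (a + b))\<^sup>2 = 2 * (norm a)\<^sup>2 + 2 * (norm b)\<^sup>2"
    by (simp add: power2_norm_eq_inner inner_simps inner_commute)
  ultimately show "a = b" using ab by simp
qed

text \<open>A substitute for Clarkson's inequalities, valid for all \<open>p > 1\<close> and obtained by compactness.\<close>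

lemma uniform_convexity_powr:
  fixes p \<delta> :: real
  assumes p: "1 < p" and \<delta>: "0 < \<delta>"
  obtains C where "0 \<le> C" "\<And>a b :: 'a::euclidean_space. norm (a - b) powr p \<le> \<delta> * (norm a powr p + norm b powr p)
     + C * (norm a powr p + norm b powr p - 2 * norm ((1/2) *\<^sub>R (a + b)) powr p)"
proof -
  define n where "n z = norm (fst z) powr p + norm (snd z) powr p" for z :: "'a \<times> 'a"
  define G where "G z = n z - 2 * norm ((1/2) *\<^sub>R (fst z + snd z)) powr p" for z :: "'a \<times> 'a"
  define d where "d z = norm (fst z - snd z) powr p" for z :: "'a \<times> 'a"
  have cp: "continuous_on UNIV (\<lambda>z. norm (h z) powr p)" if "continuous_on UNIV h" for h :: "'a \<times> 'a \<Rightarrow> 'a"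
    using p that by (intro continuous_on_powr' continuous_on_norm continuous_on_const) auto
  have c1: "continuous_on UNIV (fst :: 'a \<times> 'a \<Rightarrow> 'a)" and c2: "continuous_on UNIV (snd :: 'a \<times> 'a \<Rightarrow> 'a)"
    by (auto intro!: continuous_intros)
  have c3: "continuous_on UNIV (\<lambda>z::'a \<times> 'a. (1/2) *\<^sub>R (fst z + snd z))" "continuous_on UNIV (\<lambda>z::'a \<times> 'a. fst z - snd z)"
    by (auto intro!: continuous_intros)
  have cn: "continuous_on UNIV n" unfolding n_def by (rule continuous_on_add[OF cp[OF c1] cp[OF c2]])
  have cG: "continuous_on UNIV G" unfolding G_def
    by (rule continuous_on_diff[OF cn continuous_on_mult[OF continuous_on_const cp[OF c3(1)]]])
  have cd: "continuous_on UNIV d" unfolding d_def by (rule cp[OF c3(2)])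
  \<comment> \<open>By homogeneity it suffices to treat pairs with \<open>n z = 1\<close>. Those
    whose distance is not already absorbed by \<delta> form a compact set, on which the convexity
    defect G is continuous and vanishes nowhere.\<close>
  define K where "K = {z. n z = 1 \<and> \<delta> \<le> d z}"
  have le1: "norm (fst z) \<le> 1 \<and> norm (snd z) \<le> 1" if "n z = 1" for z
  proof -
    have "norm (fst z) powr p \<le> 1" "norm (snd z) powr p \<le> 1"
      using that powr_ge_zero[of "norm (fst z)" p] powr_ge_zero[of "norm (snd z)" p] unfolding n_def by linarith+
    moreover have "y \<le> 1" if "y powr p \<le> 1" for y :: real
    proof (rule ccontr)
      assume "\<not> y \<le> 1"
      then have "1 powr p < y powr p" using p by (intro powr_less_mono2) auto
      then show False using that by simp
    qed
    ultimately show ?thesis by blast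
  qed
  have "closed K" unfolding K_def
    using closed_Collect_conj[OF closed_Collect_eq[OF cn continuous_on_const] closed_Collect_le[OF continuous_on_const cd]] .
  moreover have "bounded K"
  proof -
    have "norm z \<le> 2" if "z \<in> K" for z
      using le1[of z] that norm_Pair_le[of "fst z" "snd z"] by (auto simp: K_def)
    then show ?thesis unfolding bounded_iff by blast
  qed
  ultimately have K: "compact K" by (simp add: compact_eq_bounded_closed)
  have Gnn: "0 \<le> G z" for z unfolding G_def n_def using norm_midpoint_le(1)[OF p, of "fst z" "snd z"] by simp
  obtain g where g: "0 < g" "\<And>z. z \<in> K \<Longrightarrow> g \<le> G z"
  proof (cases "K = {}")
    case True then show thesis using that[of 1] by auto
  next
    case False
    obtain z0 where z0: "z0 \<in> K" "\<And>z. z \<in> K \<Longrightarrow> G z0 \<le> G z"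
      using continuous_attains_inf[OF K False continuous_on_subset[OF cG]] by auto
    have "G z0 \<noteq> 0"
    proof
      assume "G z0 = 0"
      then have "fst z0 = snd z0" using norm_midpoint_le(2)[OF p, of "fst z0" "snd z0"] by (simp add: G_def n_def)
      then show False using z0(1) \<delta> p by (simp add: K_def d_def)
    qed
    then show thesis using that[of "G z0"] z0 Gnn[of z0] by simp
  qed
  \<comment> \<open>On K the distance term is at most 2^p, because both vectors have norm at most 1,
    while G is at least g.\<close>
  define C where "C = 2 powr p / g"
  have unit: "d z \<le> \<delta> + C * G z" if z: "n z = 1" for z
  proof (cases "\<delta> \<le> d z")
    case True
    have "norm (fst z - snd z) \<le> 2" using le1[OF z] norm_triangle_ineq4[of "fst z" "snd z"] by linarith
    then have "d z \<le> 2 powr p" unfolding d_def using p by (intro powr_mono2) auto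
    also have "\<dots> \<le> C * G z" using g(2)[of z] True z g(1) unfolding C_def K_def
      by (simp add: field_simps mult_left_mono)
    finally show ?thesis using \<delta> by simp
  next
    case False
    moreover have "0 \<le> C * G z" using Gnn[of z] g(1) by (simp add: C_def)
    ultimately show ?thesis by linarith
  qed
  show thesis
  proof (rule that[of C])
    show "0 \<le> C" using g(1) by (simp add: C_def)
    fix a b :: 'a
    define N where "N = norm a powr p + norm b powr p"
    show "norm (a - b) powr p \<le> \<delta> * (norm a powr p + norm b powr p)
     + C * (norm a powr p + norm b powr p - 2 * norm ((1/2) *\<^sub>R (a + b)) powr p)"
    proof (cases "N = 0")
      case True
      then have "norm a powr p = 0" "norm b powr p = 0" unfolding N_def
        by (smt (verit) powr_ge_zero)+
      then show ?thesis using p by simp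
    next
      case False
      then have N: "0 < N" unfolding N_def by (smt (verit) powr_ge_zero)
      \<comment> \<open>The scaling that normalises the pair: every term is homogeneous of degree p,
        and s^p = 1/N.\<close>
      define s where "s = N powr (- 1 / p)"
      have "s powr p = N powr (- 1 / p * p)" unfolding s_def by (rule powr_powr)
      then have s: "0 < s" "s powr p = 1 / N" using N p by (auto simp: s_def powr_minus_divide)
      have sc: "norm (s *\<^sub>R x) powr p = norm x powr p / N" for x :: 'a
        using s by (simp add: powr_mult)
      have n1: "n (s *\<^sub>R a, s *\<^sub>R b) = 1"
        using N by (simp add: n_def sc add_divide_distrib[symmetric] N_def[symmetric] del: norm_scaleR)
      have d1: "d (s *\<^sub>R a, s *\<^sub>R b) = norm (a - b) powr p / N"
        using sc[of "a - b"] by (simp add: d_def scaleR_diff_right[symmetric] del: norm_scaleR)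
      have G1: "G (s *\<^sub>R a, s *\<^sub>R b) = (N - 2 * norm ((1/2) *\<^sub>R (a + b)) powr p) / N"
      proof -
        have "(1/2) *\<^sub>R (s *\<^sub>R a + s *\<^sub>R b) = s *\<^sub>R ((1/2) *\<^sub>R (a + b))" by (simp add: algebra_simps)
        then have "G (s *\<^sub>R a, s *\<^sub>R b) = 1 - 2 * (norm ((1/2) *\<^sub>R (a + b)) powr p / N)"
          unfolding G_def n1 fst_conv snd_conv by (simp only: sc)
        then show ?thesis using N by (simp add: field_simps)
      qed
      have "norm (a - b) powr p / N \<le> \<delta> + C * ((N - 2 * norm ((1/2) *\<^sub>R (a + b)) powr p) / N)"
        using unit[OF n1] unfolding d1 G1 .
      then show ?thesis using N unfolding N_def[symmetric] by (simp add: field_simps)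
    qed
  qed
qed

section \<open>Completeness of the space of p-integrable functions\<close>

text \<open>If x exceeds t, then (x/t)^(p-1) \<ge> 1. The inequality replaces Hoelder's: it bounds a
  first power by a freely small constant and a multiple of the p-th power.\<close>

lemma le_add_powr:
  fixes x t p :: real
  assumes "0 \<le> x" "0 < t" "1 \<le> p"
  shows "x \<le> t + t powr (1 - p) * x powr p"
proof (cases "x \<le> t")
  case False
  have "x = x powr (1 - p) * x powr p" using False assms by (simp add: powr_add[symmetric])
  also have "\<dots> \<le> t powr (1 - p) * x powr p" using False assms by (intro mult_right_mono powr_mono2') auto
  finally show ?thesis using assms by simp
qed (use assms in \<open>simp add: add_increasing2\<close>)

text \<open>The Riesz-Fischer argument. A rapidly convergent subsequence has almost everywhere
  summable increments and defines g; Fatou's lemma along it then gives convergence of the full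
  sequence.\<close>

lemma Lp_complete:
  fixes D :: "nat \<Rightarrow> 'a::euclidean_space \<Rightarrow> 'b::euclidean_space"
  assumes [measurable]: "\<And>n. D n \<in> borel_measurable borel" and p: "1 \<le> p"
    and cauchy: "\<And>e. 0 < e \<Longrightarrow> \<exists>N. \<forall>n\<ge>N. \<forall>m\<ge>N. energy p (\<lambda>x. D n x - D m x) \<le> ennreal e"
  obtains g r where "g \<in> borel_measurable borel" "strict_mono (r :: nat \<Rightarrow> nat)" "AE x in lborel. (\<lambda>k. D (r k) x) \<longlonglongrightarrow> g x"
    "\<And>e. 0 < e \<Longrightarrow> \<exists>N. \<forall>n\<ge>N. energy p (\<lambda>x. D n x - g x) \<le> ennreal e"
proof -
  define t where "t k = (1/2::real) ^ k" for k :: nat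
  have t: "0 < t k" for k by (simp add: t_def)
  \<comment> \<open>Chosen so that the increments, weighted by t_k^(1-p) as in
    \<open>le_add_powr\<close>, have integral at most t_k, a summable sequence.\<close>
  define e where "e k = t k / t k powr (1 - p)" for k
  have e: "0 < e k" for k using t[of k] by (simp add: e_def)
  have "\<forall>k. \<exists>N. \<forall>n\<ge>N. \<forall>m\<ge>N. energy p (\<lambda>x. D n x - D m x) \<le> ennreal (e k)"
    using cauchy[OF e] by blast
  then obtain M where M: "\<And>k n m. n \<ge> M k \<Longrightarrow> m \<ge> M k \<Longrightarrow> energy p (\<lambda>x. D n x - D m x) \<le> ennreal (e k)"
    by metis
  \<comment> \<open>Summing the successors makes r strictly increasing and at least as large as
    every M k required.\<close>
  define r where "r k = (\<Sum>i\<le>k. Suc (M i))" for k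
  have rS: "r k < r (Suc k)" for k by (simp add: r_def)
  have r: "strict_mono r" using rS by (simp add: strict_mono_Suc_iff)
  have rM: "M k \<le> r k" for k
  proof -
    have "Suc (M k) \<le> r k" unfolding r_def by (rule member_le_sum) auto
    then show ?thesis by simp
  qed
  define dd where "dd k x = norm (D (r (Suc k)) x - D (r k) x)" for k x
  have [measurable]: "dd k \<in> borel_measurable borel" for k unfolding dd_def by measurable
  define S where "S x = (\<Sum>k. ennreal (t k powr (1 - p) * dd k x powr p))" for x
  have [measurable]: "S \<in> borel_measurable borel" unfolding S_def by measurable
  have "(\<integral>\<^sup>+x. S x \<partial>lborel) = (\<Sum>k. \<integral>\<^sup>+x. ennreal (t k powr (1 - p) * dd k x powr p) \<partial>lborel)"
    unfolding S_def by (rule nn_integral_suminf) measurable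
  also have "\<dots> \<le> (\<Sum>k. ennreal (t k))"
  proof (intro suminf_le summableI)
    fix k
    have "(\<integral>\<^sup>+x. ennreal (t k powr (1 - p) * dd k x powr p) \<partial>lborel) = ennreal (t k powr (1 - p)) * (\<integral>\<^sup>+x. ennreal (dd k x powr p) \<partial>lborel)"
      by (subst nn_integral_cmult[symmetric]) (auto simp: ennreal_mult')
    also have "\<dots> \<le> ennreal (t k powr (1 - p)) * ennreal (e k)"
      unfolding dd_def using rM[of k] rS[of k] by (intro mult_left_mono M) auto
    also have "\<dots> = ennreal (t k)" using t[of k] by (simp add: e_def ennreal_mult'[symmetric])
    finally show "(\<integral>\<^sup>+x. ennreal (t k powr (1 - p) * dd k x powr p) \<partial>lborel) \<le> ennreal (t k)" .
  qed
  also have "\<dots> = ennreal (\<Sum>k. t k)"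
    unfolding t_def by (intro suminf_ennreal2 summable_geometric) auto
  finally have "(\<integral>\<^sup>+x. S x \<partial>lborel) \<noteq> \<infinity>" by (auto simp: top_unique)
  then have "AE x in lborel. S x \<noteq> \<infinity>" by (intro nn_integral_PInf_AE) auto
  then have conv: "AE x in lborel. convergent (\<lambda>k. D (r k) x)"
  proof eventually_elim
    case (elim x)
    have "summable (\<lambda>k. t k powr (1 - p) * dd k x powr p)"
      using elim unfolding S_def by (intro summable_suminf_not_top) auto
    moreover have "summable t" unfolding t_def by (intro summable_geometric) auto
    ultimately have "summable (\<lambda>k. t k + t k powr (1 - p) * dd k x powr p)" by (intro summable_add)
    then have "summable (\<lambda>k. dd k x)"
      by (rule summable_comparison_test') (use le_add_powr[OF _ t p] in \<open>auto simp: dd_def\<close>)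
    then have "summable (\<lambda>k. D (r (Suc k)) x - D (r k) x)" unfolding dd_def by (rule summable_norm_cancel)
    then have "(\<lambda>n. \<Sum>k<n. D (r (Suc k)) x - D (r k) x) \<longlonglongrightarrow> (\<Sum>k. D (r (Suc k)) x - D (r k) x)" by (rule summable_LIMSEQ)
    then have "(\<lambda>n. (D (r n) x - D (r 0) x) + D (r 0) x) \<longlonglongrightarrow> (\<Sum>k. D (r (Suc k)) x - D (r k) x) + D (r 0) x"
      unfolding sum_lessThan_telescope[of "\<lambda>k. D (r k) x"] by (intro tendsto_intros)
    then show "convergent (\<lambda>k. D (r k) x)" by (auto simp: convergent_def)
  qed
  define g where "g x = lim (\<lambda>k. D (r k) x)" for x
  have gm[measurable]: "g \<in> borel_measurable borel" unfolding g_def by measurable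
  have lim: "AE x in lborel. (\<lambda>k. D (r k) x) \<longlonglongrightarrow> g x"
    using conv by eventually_elim (simp add: g_def convergent_LIMSEQ_iff)
  show thesis
  proof (rule that[OF gm r lim])
    fix \<epsilon> :: real assume "0 < \<epsilon>"
    then obtain N where N: "\<And>n m. n \<ge> N \<Longrightarrow> m \<ge> N \<Longrightarrow> energy p (\<lambda>x. D n x - D m x) \<le> ennreal \<epsilon>"
      using cauchy[of \<epsilon>] by blast
    show "\<exists>N. \<forall>n\<ge>N. energy p (\<lambda>x. D n x - g x) \<le> ennreal \<epsilon>"
    proof (intro exI allI impI)
      fix n assume n: "N \<le> n"
      have "energy p (\<lambda>x. D n x - g x) = (\<integral>\<^sup>+x. liminf (\<lambda>k. ennreal (norm (D n x - D (r k) x) powr p)) \<partial>lborel)"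
        using lim
      proof (intro nn_integral_cong_AE, eventually_elim)
        case (elim x)
        have "(\<lambda>k. ennreal (norm (D n x - D (r k) x) powr p)) \<longlonglongrightarrow> ennreal (norm (D n x - g x) powr p)"
          using p by (intro tendsto_ennrealI tendsto_powr' tendsto_norm tendsto_diff elim tendsto_const) auto
        then show ?case by (intro lim_imp_Liminf[symmetric]) auto
      qed
      also have "\<dots> \<le> liminf (\<lambda>k. \<integral>\<^sup>+x. ennreal (norm (D n x - D (r k) x) powr p) \<partial>lborel)"
        by (rule nn_integral_liminf) measurable
      also have "\<dots> \<le> ennreal \<epsilon>"
      proof (rule Liminf_le)
        show "\<forall>\<^sub>F k in sequentially. energy p (\<lambda>x. D n x - D (r k) x) \<le> ennreal \<epsilon>"
          using eventually_ge_at_top[of N] by eventually_elim (use n strict_mono_imp_increasing[OF r] in \<open>auto intro!: N elim: order_trans\<close>)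
      qed simp
      finally show "energy p (\<lambda>x. D n x - g x) \<le> ennreal \<epsilon>" .
    qed
  qed
qed

section \<open>The Cauchy property of mollified gradients and the weak gradient\<close>

lemma kernG_odd: "kernG \<eta> (x - y) = - kernG \<eta> (y - x)"
proof -
  have "kernG0 (- z) = - kernG0 z" for z :: 'a by (simp add: kernG0_def)
  from this[of "(y - x) /\<^sub>R \<eta>"] show ?thesis by (simp add: kernG_def scaleR_diff_right)
qed

text \<open>The kernel itself may thus serve as test function in
  \<open>mollifyG_limit\<close>.\<close>

lemma kern_C1c:
  assumes "0 < \<eta>"
  shows "C1c_deriv b (\<lambda>y. kern \<eta> (y - x)) (\<lambda>y. - (kernG \<eta> (y - x) \<bullet> b))"
  unfolding C1c_deriv_def
proof (intro conjI exI[of _ "norm x + \<eta>"] allI impI)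
  show "continuous_on UNIV (\<lambda>y. kern \<eta> (y - x))"
    by (intro continuous_on_compose2[OF kern_cont] continuous_intros) auto
  have "continuous_on UNIV (\<lambda>y. kernG \<eta> (y - x))"
    by (intro continuous_on_compose2[OF kernG_cont] continuous_intros) auto
  then show "continuous_on UNIV (\<lambda>y. - (kernG \<eta> (y - x) \<bullet> b))" by (intro continuous_intros)
  fix y :: 'a
  show "kern \<eta> (y - x) = 0" if "norm x + \<eta> \<le> norm y"
    using that norm_triangle_ineq2[of y x] assms by (intro kern_supp) auto
  show "((\<lambda>t. kern \<eta> (y + t *\<^sub>R b - x)) has_real_derivative - (kernG \<eta> (y - x) \<bullet> b)) (at 0)"
    using kern_deriv[OF assms, of x y b] by (simp add: kern_even[of \<eta> x] kernG_odd[of \<eta> x])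
qed

text \<open>Smoothing ever finer mollified gradients at scale \<tau> recovers the mollified gradient
  at scale \<tau>. It is the weak limit tested with the kernel, one component at a time.\<close>

lemma mollifyG_conv_limit:
  assumes u: "loc_int u" and \<tau>: "0 < \<tau>"
  shows "(\<lambda>n. LINT y|lborel. kern \<tau> (y - x) *\<^sub>R mollifyG (inverse (real (Suc n))) u y) \<longlonglongrightarrow> mollifyG \<tau> u x"
proof (rule tendsto_componentwise_iff[THEN iffD2], intro ballI)
  fix b :: 'a
  have i: "integrable lborel (\<lambda>y. kern \<tau> (y - x) *\<^sub>R mollifyG (inverse (real (Suc n))) u y)" for n
    by (rule kern_shift_integrable[OF \<tau> mollifyG_cont[OF u]]) simp
  have "(LINT y|lborel. kern \<tau> (y - x) *\<^sub>R mollifyG (inverse (real (Suc n))) u y) \<bullet> b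
    = (LINT y|lborel. (mollifyG (inverse (real (Suc n))) u y \<bullet> b) * kern \<tau> (y - x))" for n
    using i[of n] by (subst integral_inner_left[symmetric]) (auto simp: mult.commute)
  moreover have "mollifyG \<tau> u x \<bullet> b = - (LINT y|lborel. u y * - (kernG \<tau> (y - x) \<bullet> b))"
    unfolding mollifyG_def using conv_integrable[OF u kernG_cont kernG_supp[OF \<tau>], where x = x]
    by (subst integral_inner_left[symmetric]) auto
  ultimately show "(\<lambda>n. (LINT y|lborel. kern \<tau> (y - x) *\<^sub>R mollifyG (inverse (real (Suc n))) u y) \<bullet> b) \<longlonglongrightarrow> mollifyG \<tau> u x \<bullet> b"
    using mollifyG_limit[OF u kern_C1c[OF \<tau>, of b x]] by simp
qed

lemma conv_powr_le:
  fixes F :: "'a::euclidean_space \<Rightarrow> 'b::euclidean_space"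
  assumes F: "continuous_on UNIV F" and \<tau>: "0 < \<tau>" and p: "1 \<le> p"
  shows "energy p (\<lambda>x. LINT y|lborel. kern \<tau> (y - x) *\<^sub>R F y) \<le> energy p F"
proof -
  have [measurable]: "F \<in> borel_measurable borel" using F by (rule borel_measurable_continuous_onI)
  have nF: "continuous_on UNIV (\<lambda>x. norm (F x))" by (intro continuous_intros F)
  have "ennreal (norm (LINT y|lborel. kern \<tau> (y - x) *\<^sub>R F y) powr p) \<le> (\<integral>\<^sup>+y. ennreal (kern \<tau> (y - x)) * ennreal (norm (F y) powr p) \<partial>lborel)" for x
  proof -
    have "norm (LINT y|lborel. kern \<tau> (y - x) *\<^sub>R F y) \<le> (LINT y|lborel. kern \<tau> (y - x) * norm (F y))"
      using integral_norm_bound[of lborel "\<lambda>y. kern \<tau> (y - x) *\<^sub>R F y"] by (simp add: kern_nonneg[OF \<tau>])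
    then have "ennreal (norm (LINT y|lborel. kern \<tau> (y - x) *\<^sub>R F y) powr p) \<le> ennreal ((LINT y|lborel. kern \<tau> (y - x) * norm (F y)) powr p)"
      using p by (intro ennreal_leI powr_mono2) auto
    also have "\<dots> \<le> (\<integral>\<^sup>+y. ennreal (kern \<tau> (y - x) * norm (F y) powr p) \<partial>lborel)"
      using kern_shift_integrable[OF \<tau> nF, of x] by (intro kern_jensen p \<tau>) auto
    finally show ?thesis by (simp add: ennreal_mult kern_nonneg[OF \<tau>])
  qed
  then have "energy p (\<lambda>x. LINT y|lborel. kern \<tau> (y - x) *\<^sub>R F y) \<le>
    (\<integral>\<^sup>+x\<in>UNIV. (\<integral>\<^sup>+y. ennreal (kern \<tau> (y - x)) * ennreal (norm (F y) powr p) \<partial>lborel) \<partial>lborel)"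
    by (intro nn_integral_mono) simp
  also have "\<dots> \<le> (\<integral>\<^sup>+x\<in>UNIV. ennreal (norm (F x) powr p) \<partial>lborel)"
    by (rule kern_conv_nn_integral_le[OF \<tau>]) auto
  finally show ?thesis by simp
qed

text \<open>Midpoints of fine gradients, smoothed at scale \<tau>, converge pointwise to
  \<open>mollifyG \<tau> u\<close>; smoothing does not increase the energy, so Fatou's lemma bounds
  the energies of the midpoints from below. A failure for arbitrarily large indices yields sequences
  a and b that contradict this.\<close>

lemma mollifyG_midpoint_lower:
  assumes u: "loc_int u" and \<tau>: "0 < \<tau>" and p: "1 \<le> p" and e: "0 < e"
  defines "D \<equiv> \<lambda>n. mollifyG (inverse (real (Suc n))) u"
  assumes le: "energy p (mollifyG \<tau> u) \<le> ennreal c"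
  shows "\<exists>N. \<forall>n\<ge>N. \<forall>m\<ge>N. energy p (mollifyG \<tau> u) \<le>
     energy p (\<lambda>x. (1/2) *\<^sub>R (D n x + D m x)) + ennreal e"
proof (rule ccontr)
  define J where "J = energy p (mollifyG \<tau> u)"
  define I where "I n m = energy p (\<lambda>x. (1/2) *\<^sub>R (D n x + D m x))" for n m
  assume "\<not> ?thesis"
  then have "\<forall>N. \<exists>n m. n \<ge> N \<and> m \<ge> N \<and> I n m + ennreal e < J"
    unfolding I_def[symmetric] J_def[symmetric] by (simp add: not_le)
  then obtain a b where ab: "\<And>N. a N \<ge> N" "\<And>N. b N \<ge> N" "\<And>N. I (a N) (b N) + ennreal e < J" by metis
  have Dc: "continuous_on UNIV (D n)" for n unfolding D_def by (rule mollifyG_cont[OF u]) simp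
  define T where "T F x = (LINT y|lborel. kern \<tau> (y - x) *\<^sub>R F y)" for F :: "'a \<Rightarrow> 'a" and x
  have a: "filterlim a at_top sequentially" and b: "filterlim b at_top sequentially"
    using ab by (auto intro!: filterlim_at_top_mono[OF filterlim_ident])
  have lim: "(\<lambda>n. T (D n) x) \<longlonglongrightarrow> mollifyG \<tau> u x" for x
    unfolding T_def D_def by (rule mollifyG_conv_limit[OF u \<tau>])
  define G where "G N = (\<lambda>x. (1/2) *\<^sub>R (D (a N) x + D (b N) x))" for N
  have Gc: "continuous_on UNIV (G N)" for N unfolding G_def by (intro continuous_intros Dc)
  have TG: "T (G N) x = (1/2) *\<^sub>R (T (D (a N)) x + T (D (b N)) x)" for N x
  proof -
    have i: "integrable lborel (\<lambda>y. kern \<tau> (y - x) *\<^sub>R D n y)" for n by (rule kern_shift_integrable[OF \<tau> Dc])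
    have "T (G N) x = (LINT y|lborel. (1/2) *\<^sub>R (kern \<tau> (y - x) *\<^sub>R D (a N) y + kern \<tau> (y - x) *\<^sub>R D (b N) y))"
      unfolding T_def G_def by (intro Bochner_Integration.integral_cong refl) (simp add: algebra_simps)
    also have "\<dots> = (1/2) *\<^sub>R (T (D (a N)) x + T (D (b N)) x)"
      unfolding T_def by (simp only: integral_scaleR_right Bochner_Integration.integral_add[OF i i])
    finally show ?thesis .
  qed
  have limG: "(\<lambda>N. T (G N) x) \<longlonglongrightarrow> mollifyG \<tau> u x" for x
  proof -
    have "(\<lambda>N. (1/2) *\<^sub>R (T (D (a N)) x + T (D (b N)) x)) \<longlonglongrightarrow> (1/2) *\<^sub>R (mollifyG \<tau> u x + mollifyG \<tau> u x)"
      by (intro tendsto_intros filterlim_compose[OF lim a] filterlim_compose[OF lim b])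
    then show ?thesis unfolding TG by (simp add: scaleR_add_left[symmetric] scaleR_2[symmetric])
  qed
  have Tm: "T (G N) \<in> borel_measurable borel" for N
    using borel_measurable_continuous_onI[OF Gc[of N]] unfolding T_def by measurable
  have "J = (\<integral>\<^sup>+x. liminf (\<lambda>N. ennreal (norm (T (G N) x) powr p)) \<partial>lborel)"
    unfolding J_def using p
    by (intro nn_integral_cong lim_imp_Liminf[symmetric] tendsto_ennrealI tendsto_powr' tendsto_norm limG tendsto_const) auto
  also have "\<dots> \<le> liminf (\<lambda>N. \<integral>\<^sup>+x. ennreal (norm (T (G N) x) powr p) \<partial>lborel)"
    using Tm by (intro nn_integral_liminf) auto
  also have "\<dots> \<le> J - ennreal e"
  proof (rule Liminf_le)
    show "\<forall>\<^sub>F N in sequentially. energy p (T (G N)) \<le> J - ennreal e"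
    proof (intro always_eventually allI)
      fix N
      have "energy p (T (G N)) \<le> I (a N) (b N)"
        using conv_powr_le[OF Gc \<tau> p, of N] unfolding T_def I_def G_def .
      also have "\<dots> = (I (a N) (b N) + ennreal e) - ennreal e" by simp
      also have "\<dots> \<le> J - ennreal e" by (rule ennreal_minus_mono[OF less_imp_le[OF ab(3)] order_refl])
      finally show "energy p (T (G N)) \<le> J - ennreal e" .
    qed
  qed simp
  finally have "J \<le> J - ennreal e" .
  \<comment> \<open>Subtraction in \<open>ennreal\<close> is truncated at 0 and leaves infinity
    unchanged, so J \<le> J - e is absurd only for finite positive J.\<close>
  moreover have "J \<noteq> top" using le unfolding J_def[symmetric] by (auto simp: top_unique)
  moreover have "0 < J" by (rule le_less_trans[OF _ ab(3)[of 0]]) simp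
  ultimately show False using e by (cases J) (auto simp: ennreal_minus ennreal_le_iff2)
qed

text \<open>Let S be the supremum of the energies. Every D n has energy at most S, and midpoints of
  late terms have energy at least S - 2e, so the convexity defect integrates to at most 4e; uniform
  convexity turns this into smallness of the differences.\<close>

lemma mollifyG_Cauchy:
  fixes u :: "'a::euclidean_space \<Rightarrow> real"
  assumes u: "loc_int u" and p: "1 < p" and c: "0 \<le> c"
  defines "D \<equiv> \<lambda>n. mollifyG (inverse (real (Suc n))) u"
  assumes le: "\<And>n. energy p (D n) \<le> ennreal c" and \<epsilon>: "0 < \<epsilon>"
  shows "\<exists>N. \<forall>n\<ge>N. \<forall>m\<ge>N. energy p (\<lambda>x. D n x - D m x) \<le> ennreal \<epsilon>"
proof -
  \<comment> \<open>Each half of the final bound receives \<epsilon>/2: here \<delta> times two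
    energies of size at most c, and below C times the defect 4e. The added units keep the
    denominators positive when c or C is 0.\<close>
  define \<delta> where "\<delta> = \<epsilon> / (4 * c + 4)"
  have \<delta>: "0 < \<delta>" using \<epsilon> c by (simp add: \<delta>_def)
  obtain C where C: "0 \<le> C" "\<And>a b :: 'a. norm (a - b) powr p \<le> \<delta> * (norm a powr p + norm b powr p)
     + C * (norm a powr p + norm b powr p - 2 * norm ((1/2) *\<^sub>R (a + b)) powr p)"
    using uniform_convexity_powr[OF p \<delta>] by blast
  define e where "e = \<epsilon> / (8 * (C + 1))"
  have e: "0 < e" using \<epsilon> C by (simp add: e_def)
  have [measurable]: "D n \<in> borel_measurable borel" for n
    unfolding D_def by (rule borel_measurable_continuous_onI[OF mollifyG_cont[OF u]]) simp
  define I where "I n = (LINT x|lborel. norm (D n x) powr p)" for n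
  define J where "J n m = (LINT x|lborel. norm ((1/2) *\<^sub>R (D n x + D m x)) powr p)" for n m
  have Di: "integrable lborel (\<lambda>x. norm (D n x) powr p)" for n
    using le[of n] by (intro integrableI_nonneg) (auto simp: less_top[symmetric] top_unique)
  have Ji: "integrable lborel (\<lambda>x. norm ((1/2) *\<^sub>R (D n x + D m x)) powr p)" for n m
  proof (rule Bochner_Integration.integrable_bound[OF Bochner_Integration.integrable_add[OF Di[of n] Di[of m]]])
    show "AE x in lborel. norm (norm ((1/2) *\<^sub>R (D n x + D m x)) powr p) \<le> norm (norm (D n x) powr p + norm (D m x) powr p)"
    proof (intro AE_I2)
      fix x
      have "0 \<le> norm ((1/2) *\<^sub>R (D n x + D m x)) powr p" by simp
      then show "norm (norm ((1/2) *\<^sub>R (D n x + D m x)) powr p) \<le> norm (norm (D n x) powr p + norm (D m x) powr p)"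
        using norm_midpoint_le(1)[OF p, of "D n x" "D m x"] unfolding real_norm_def by linarith
    qed
  qed measurable
  have nnD: "energy p (D n) = ennreal (I n)" for n
    unfolding I_def by (rule nn_integral_eq_integral[OF Di]) auto
  have nnJ: "energy p (\<lambda>x. (1/2) *\<^sub>R (D n x + D m x)) = ennreal (J n m)" for n m
    unfolding J_def by (rule nn_integral_eq_integral[OF Ji]) auto
  have I0: "0 \<le> I n" and J0: "0 \<le> J n m" for n m unfolding I_def J_def by (auto intro!: integral_nonneg_AE)
  have Ic: "I n \<le> c" for n using le[of n] c unfolding nnD by simp
  define S where "S = (SUP n. I n)"
  have bdd: "bdd_above (range I)" using Ic by (intro bdd_aboveI[of _ c]) auto
  have IS: "I n \<le> S" for n unfolding S_def by (rule cSUP_upper[OF _ bdd]) simp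
  \<comment> \<open>A scale whose energy nearly attains the supremum; it plays the role of \<tau> in
    \<open>mollifyG_midpoint_lower\<close>.\<close>
  obtain k where k: "S - e < I k"
    using less_cSUP_iff[OF _ bdd, of "S - e"] e by (auto simp: S_def)
  obtain N where N: "\<And>n m. n \<ge> N \<Longrightarrow> m \<ge> N \<Longrightarrow> ennreal (I k) \<le> ennreal (J n m) + ennreal e"
    using mollifyG_midpoint_lower[OF u _ _ e, of "inverse (real (Suc k))" p c] le[of k] p
    unfolding D_def[symmetric] nnJ[symmetric] nnD[symmetric] by (auto simp: D_def)
  show ?thesis
  proof (intro exI allI impI)
    fix n m assume nm: "N \<le> n" "N \<le> m"
    have "ennreal (I k) \<le> ennreal (J n m + e)" using N[OF nm] e J0 by simp
    then have Ik: "I k \<le> J n m + e" using e J0[of n m] by (subst (asm) ennreal_le_iff) auto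
    have hi: "integrable lborel (\<lambda>x. \<delta> * (norm (D n x) powr p + norm (D m x) powr p)
     + C * (norm (D n x) powr p + norm (D m x) powr p - 2 * norm ((1/2) *\<^sub>R (D n x + D m x)) powr p))"
      using Di Ji[of n m] by (intro Bochner_Integration.integrable_add integrable_mult_right Bochner_Integration.integrable_diff) auto
    have "energy p (\<lambda>x. D n x - D m x) \<le> (\<integral>\<^sup>+x. ennreal (\<delta> * (norm (D n x) powr p + norm (D m x) powr p)
     + C * (norm (D n x) powr p + norm (D m x) powr p - 2 * norm ((1/2) *\<^sub>R (D n x + D m x)) powr p)) \<partial>lborel)"
      by (intro nn_integral_mono ennreal_leI C(2))
    also have "\<dots> = ennreal (LINT x|lborel. \<delta> * (norm (D n x) powr p + norm (D m x) powr p)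
     + C * (norm (D n x) powr p + norm (D m x) powr p - 2 * norm ((1/2) *\<^sub>R (D n x + D m x)) powr p))"
      by (rule nn_integral_eq_integral[OF hi]) (use C(2) in \<open>auto intro!: AE_I2 order_trans[OF powr_ge_zero C(2)] simp del: norm_scaleR\<close>)
    also have "(LINT x|lborel. \<delta> * (norm (D n x) powr p + norm (D m x) powr p)
     + C * (norm (D n x) powr p + norm (D m x) powr p - 2 * norm ((1/2) *\<^sub>R (D n x + D m x)) powr p)) = \<delta> * (I n + I m) + C * (I n + I m - 2 * J n m)"
      using Di[of n] Di[of m] Ji[of n m] unfolding I_def J_def
      by (simp del: norm_scaleR)
    also have "ennreal \<dots> \<le> ennreal \<epsilon>"
    proof (rule ennreal_leI)
      have "I n + I m - 2 * J n m \<le> 4 * e" using IS[of n] IS[of m] k Ik by linarith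
      then have "C * (I n + I m - 2 * J n m) \<le> C * (4 * e)" using C by (intro mult_left_mono) auto
      also have "\<dots> \<le> (C + 1) * (4 * e)" using e by (intro mult_right_mono) auto
      also have "\<dots> = \<epsilon> / 2" using C(1) by (simp add: e_def field_simps)
      finally have 1: "C * (I n + I m - 2 * J n m) \<le> \<epsilon> / 2" .
      have "\<delta> * (I n + I m) \<le> \<delta> * (2 * c + 2)" using \<delta> Ic[of n] Ic[of m] by (intro mult_left_mono) auto
      also have "\<dots> = \<epsilon> / 2" using c by (simp add: \<delta>_def field_simps)
      finally show "\<delta> * (I n + I m) + C * (I n + I m - 2 * J n m) \<le> \<epsilon>" using 1 by simp
    qed
    finally show "energy p (\<lambda>x. D n x - D m x) \<le> ennreal \<epsilon>" .
  qed
qed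

lemma loc_int_powr:
  fixes g :: "'a::euclidean_space \<Rightarrow> 'b::euclidean_space"
  assumes [measurable]: "g \<in> borel_measurable borel" and p: "1 \<le> p"
    and g: "energy p g < \<infinity>"
  shows "loc_int g"
  unfolding loc_int_def
proof safe
  fix R
  have i: "integrable lborel (\<lambda>x. norm (g x) powr p)"
    using g by (intro integrableI_nonneg) auto
  show "integrable lborel (\<lambda>x. indicat_real (cball 0 R) x *\<^sub>R g x)"
  proof (rule Bochner_Integration.integrable_bound[OF Bochner_Integration.integrable_add[OF integrable_indicator_cball[of 1 0 R] i]])
    show "AE x in lborel. norm (indicat_real (cball 0 R) x *\<^sub>R g x) \<le> norm (1 * indicat_real (cball 0 R) x + norm (g x) powr p)"
      using le_add_powr[OF norm_ge_zero[of "g x" for x], of 1 p] p by (intro AE_I2) (auto simp: indicator_def)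
  qed measurable
qed (rule assms)

lemma Lp_lim_test:
  fixes D :: "nat \<Rightarrow> 'a::euclidean_space \<Rightarrow> 'b::euclidean_space"
  assumes D: "\<And>n. loc_int (D n)" and g: "loc_int g" and p: "1 \<le> p" and f: "C1c_deriv b' f f'"
    and lim: "\<And>e. 0 < e \<Longrightarrow> \<exists>N. \<forall>n\<ge>N. energy p (\<lambda>x. D n x - g x) \<le> ennreal e"
  shows "(\<lambda>n. LINT x|lborel. (D n x \<bullet> b) * f x) \<longlonglongrightarrow> (LINT x|lborel. (g x \<bullet> b) * f x)"
proof (rule LIMSEQ_I)
  fix e :: real assume e: "0 < e"
  have [measurable]: "D n \<in> borel_measurable borel" "g \<in> borel_measurable borel" for n
    by (rule loc_int_measurable[OF D], rule loc_int_measurable[OF g])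
  have fc: "continuous_on UNIV f" using f by (simp add: C1c_deriv_def)
  have [measurable]: "f \<in> borel_measurable borel" using fc by (rule borel_measurable_continuous_onI)
  obtain R where R: "\<And>x. norm x \<ge> R \<Longrightarrow> f x = 0" "\<And>x. norm x \<ge> R \<Longrightarrow> f' x = 0"
    using C1c_deriv_supp[OF f] by blast
  obtain B where B: "B \<ge> 0" "\<And>x. norm (f x) \<le> B * indicat_real (cball 0 R) x"
    using continuous_supp_bounded[OF fc R(1)] by blast
  define K where "K = norm b * B + 1"
  have K: "0 < K" using B by (simp add: K_def add_nonneg_pos)
  define v where "v = measure lborel (cball (0::'a) R)"
  have v: "0 \<le> v" by (simp add: v_def)
  \<comment> \<open>The threshold t makes the constant part of \<open>le_add_powr\<close>,
    integrated over the ball, at most e/4. The tolerance d, chosen after t, does the same for the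
    part with the p-th power.\<close>
  define t where "t = e / (4 * K * (v + 1))"
  have t: "0 < t" using e K v by (simp add: t_def)
  define d where "d = e / (4 * K * t powr (1 - p))"
  have d: "0 < d" using e K t by (simp add: d_def)
  obtain N where N: "\<And>n. n \<ge> N \<Longrightarrow> energy p (\<lambda>x. D n x - g x) \<le> ennreal d"
    using lim[OF d] by blast
  have i1: "integrable lborel (\<lambda>x. (h x \<bullet> b) * f x)" if "loc_int h" for h :: "'a \<Rightarrow> 'b"
    using integrable_inner_left[OF C1c_deriv_integrable(1)[OF that f], of b] by (simp add: mult.commute)
  show "\<exists>no. \<forall>n\<ge>no. norm ((LINT x|lborel. (D n x \<bullet> b) * f x) - (LINT x|lborel. (g x \<bullet> b) * f x)) < e"
  proof (intro exI allI impI)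
    fix n assume n: "N \<le> n"
    have fin: "integrable lborel (\<lambda>x. norm (D n x - g x) powr p)"
      using N[OF n] by (intro integrableI_nonneg) (auto simp: less_top[symmetric] top_unique)
    have Id: "(LINT x|lborel. norm (D n x - g x) powr p) \<le> d"
    proof -
      have "ennreal (LINT x|lborel. norm (D n x - g x) powr p) \<le> ennreal d"
        using N[OF n] by (subst nn_integral_eq_integral[OF fin, symmetric]) auto
      then show ?thesis using d by simp
    qed
    have "(LINT x|lborel. (D n x \<bullet> b) * f x) - (LINT x|lborel. (g x \<bullet> b) * f x) = (LINT x|lborel. (D n x \<bullet> b) * f x - (g x \<bullet> b) * f x)"
      by (rule Bochner_Integration.integral_diff[symmetric]) (rule i1[OF D] i1[OF g])+
    also have "norm \<dots> \<le> (LINT x|lborel. K * t * indicat_real (cball 0 R) x + K * t powr (1 - p) * norm (D n x - g x) powr p)"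
    proof (rule Bochner_Integration.integral_norm_bound_integral)
      show "integrable lborel (\<lambda>x. (D n x \<bullet> b) * f x - (g x \<bullet> b) * f x)"
        by (rule Bochner_Integration.integrable_diff[OF i1[OF D] i1[OF g]])
      show "integrable lborel (\<lambda>x. K * t * indicat_real (cball 0 R) x + K * t powr (1 - p) * norm (D n x - g x) powr p)"
        by (rule Bochner_Integration.integrable_add[OF integrable_indicator_cball integrable_mult_right[OF fin]])
      fix x
      show "norm ((D n x \<bullet> b) * f x - (g x \<bullet> b) * f x) \<le> K * t * indicat_real (cball 0 R) x + K * t powr (1 - p) * norm (D n x - g x) powr p"
      proof (cases "x \<in> cball 0 R")
        case True
        have "norm ((D n x \<bullet> b) * f x - (g x \<bullet> b) * f x) = \<bar>(D n x - g x) \<bullet> b\<bar> * \<bar>f x\<bar>"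
          by (simp add: left_diff_distrib[symmetric] inner_diff_left abs_mult)
        also have "\<dots> \<le> (norm (D n x - g x) * norm b) * B"
          using B(2)[of x] True B(1) by (intro mult_mono Cauchy_Schwarz_ineq2) auto
        also have "\<dots> \<le> K * norm (D n x - g x)" by (simp add: K_def algebra_simps)
        also have "\<dots> \<le> K * (t + t powr (1 - p) * norm (D n x - g x) powr p)"
          using K le_add_powr[OF norm_ge_zero t p] by (intro mult_left_mono) auto
        finally show ?thesis using True by (simp add: distrib_left mult.assoc)
      next
        case False
        then have "f x = 0" using B(2)[of x] by simp
        then show ?thesis using K t by simp
      qed
    qed
    also have "\<dots> = K * t * v + K * t powr (1 - p) * (LINT x|lborel. norm (D n x - g x) powr p)"
      by (subst Bochner_Integration.integral_add[OF integrable_indicator_cball integrable_mult_right[OF fin]]) (simp add: v_def)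
    also have "\<dots> \<le> K * t * (v + 1) + K * t powr (1 - p) * d"
      using K t Id by (intro add_mono mult_left_mono) auto
    also have "\<dots> = e / 4 + e / 4"
    proof -
      define w where "w = v + 1"
      have "w \<noteq> 0" "K \<noteq> 0" using K v by (auto simp: w_def)
      then have "K * t * (v + 1) = e / 4" unfolding t_def w_def[symmetric] by simp
      moreover have "K * t powr (1 - p) * d = e / 4" using K t by (simp add: d_def)
      ultimately show ?thesis by simp
    qed
    also have "\<dots> < e" using e by simp
    finally show "norm ((LINT x|lborel. (D n x \<bullet> b) * f x) - (LINT x|lborel. (g x \<bullet> b) * f x)) < e" .
  qed
qed

text \<open>The strong limit of the mollified gradients is the weak gradient: tested against f they
  converge both to g and, by integration by parts, to minus the pairing of u with \<open>f'\<close>.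
  Fatou's lemma along the almost everywhere convergent subsequence keeps the energy bound.\<close>

lemma weak_gradient_exists:
  fixes u :: "'a::euclidean_space \<Rightarrow> real"
  assumes u: "loc_int u" and p: "1 < p" and c: "0 \<le> c"
    and le: "\<And>n. energy p (mollifyG (inverse (real (Suc n))) u) \<le> ennreal c"
  obtains g where "loc_int g" "energy p g \<le> ennreal c"
    "\<And>b f f'. C1c_deriv b f f' \<Longrightarrow> (LINT x|lborel. u x * f' x) = - (LINT x|lborel. (g x \<bullet> b) * f x)"
proof -
  define D where "D n = mollifyG (inverse (real (Suc n))) u" for n
  have Dc: "continuous_on UNIV (D n)" for n unfolding D_def by (rule mollifyG_cont[OF u]) simp
  have Dm[measurable]: "D n \<in> borel_measurable borel" for n using Dc by (rule borel_measurable_continuous_onI)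
  have cau: "\<exists>N. \<forall>n\<ge>N. \<forall>m\<ge>N. energy p (\<lambda>x. D n x - D m x) \<le> ennreal e" if "0 < e" for e
    using mollifyG_Cauchy[OF u p c le that] unfolding D_def .
  obtain g r where g: "g \<in> borel_measurable borel" "strict_mono (r :: nat \<Rightarrow> nat)" "AE x in lborel. (\<lambda>k. D (r k) x) \<longlonglongrightarrow> g x"
    "\<And>e. 0 < e \<Longrightarrow> \<exists>N. \<forall>n\<ge>N. energy p (\<lambda>x. D n x - g x) \<le> ennreal e"
    using Lp_complete[OF Dm less_imp_le[OF p] cau] by blast
  have "energy p g = (\<integral>\<^sup>+x. liminf (\<lambda>k. ennreal (norm (D (r k) x) powr p)) \<partial>lborel)"
    using g(3)
  proof (intro nn_integral_cong_AE, eventually_elim)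
    case (elim x)
    have "(\<lambda>k. ennreal (norm (D (r k) x) powr p)) \<longlonglongrightarrow> ennreal (norm (g x) powr p)"
      using p by (intro tendsto_ennrealI tendsto_powr' tendsto_norm elim tendsto_const) auto
    then show ?case by (intro lim_imp_Liminf[symmetric]) auto
  qed
  also have "\<dots> \<le> liminf (\<lambda>k. \<integral>\<^sup>+x. ennreal (norm (D (r k) x) powr p) \<partial>lborel)"
    by (rule nn_integral_liminf) measurable
  also have "\<dots> \<le> ennreal c" unfolding D_def by (intro Liminf_le always_eventually allI le) simp
  finally have gc: "energy p g \<le> ennreal c" .
  have gl: "loc_int g" using gc p by (intro loc_int_powr[OF g(1), of p]) (auto intro: le_less_trans)
  show thesis
  proof (rule that[OF gl gc])
    fix b :: 'a and f f' assume f: "C1c_deriv b f f'"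
    have "(\<lambda>n. LINT x|lborel. (D n x \<bullet> b) * f x) \<longlonglongrightarrow> (LINT x|lborel. (g x \<bullet> b) * f x)"
      by (rule Lp_lim_test[OF continuous_loc_int[OF Dc] gl _ f g(4)]) (use p in auto)
    moreover have "(\<lambda>n. LINT x|lborel. (D n x \<bullet> b) * f x) \<longlonglongrightarrow> - (LINT x|lborel. u x * f' x)"
      unfolding D_def by (rule mollifyG_limit[OF u f])
    ultimately have "(LINT x|lborel. (g x \<bullet> b) * f x) = - (LINT x|lborel. u x * f' x)" by (rule LIMSEQ_unique)
    then show "(LINT x|lborel. u x * f' x) = - (LINT x|lborel. (g x \<bullet> b) * f x)" by simp
  qed
qed

section \<open>Uniqueness of weak gradients\<close>

text \<open>The functions t^(-m) exp(-1/t), extended by 0. Uniqueness must be tested with smooth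
  functions, for which the kernel is not regular enough. The whole family is defined at once because
  its linear span is closed under differentiation.\<close>

definition flat :: "nat \<Rightarrow> real \<Rightarrow> real" where
  "flat m t = (if 0 < t then inverse t ^ m * exp (- inverse t) else 0)"

lemma flat_tendsto_0: "((\<lambda>t. flat m t) \<longlongrightarrow> 0) (at 0)"
proof -
  have "((\<lambda>x::real. x ^ m / exp x) \<longlongrightarrow> 0) at_top" by (rule tendsto_power_div_exp_0)
  then have "((\<lambda>t::real. inverse t ^ m / exp (inverse t)) \<longlongrightarrow> 0) (at_right 0)"
    by (rule filterlim_compose) (rule filterlim_inverse_at_top_right)
  then have "((\<lambda>t. flat m t) \<longlongrightarrow> 0) (at_right 0)"
    by (rule Lim_transform_eventually)
       (auto simp: eventually_at_filter flat_def exp_minus divide_inverse)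
  moreover have "((\<lambda>t. flat m t) \<longlongrightarrow> 0) (at_left 0)"
    by (rule tendsto_eventually) (auto simp: eventually_at_filter flat_def)
  ultimately show ?thesis by (simp add: filterlim_split_at)
qed

lemma flat_deriv: "(flat m has_real_derivative (flat (m + 2) t - real m * flat (m + 1) t)) (at t)"
proof -
  consider "t < 0" | "t = 0" | "0 < t" by linarith
  then show ?thesis
  proof cases
    case 1
    have "\<forall>\<^sub>F s in nhds t. flat m s = 0"
      using order_tendstoD(2)[OF filterlim_ident 1] by eventually_elim (simp add: flat_def)
    then have "(flat m has_real_derivative 0) (at t) \<longleftrightarrow> ((\<lambda>s. 0) has_real_derivative 0) (at t)"
      by (rule DERIV_cong_ev[OF refl _ refl])
    then show ?thesis using 1 by (simp add: flat_def)
  next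
    case 2
    \<comment> \<open>At the origin the difference quotient of \<open>flat m\<close> is
      \<open>flat (m + 1)\<close>, which tends to 0.\<close>
    have "(flat m has_real_derivative 0) (at 0)" unfolding DERIV_def
    proof (rule Lim_transform_eventually[OF flat_tendsto_0[of "m + 1"]])
      show "\<forall>\<^sub>F h in at 0. flat (m + 1) h = (flat m (0 + h) - flat m 0) / h"
        by (auto simp: eventually_at_filter flat_def field_simps)
    qed
    then show ?thesis using 2 by (simp add: flat_def)
  next
    case 3
    have d: "((\<lambda>s. inverse s ^ m * exp (- inverse s)) has_real_derivative (flat (m + 2) t - real m * flat (m + 1) t)) (at t)"
    proof -
      define i where "i = inverse t"
      have d1: "(inverse has_real_derivative - (i * i)) (at t)"
        using 3 by (auto intro!: derivative_eq_intros simp: i_def)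
      have d2: "((\<lambda>s. inverse s ^ m) has_real_derivative real m * (- (i * i) * i ^ (m - Suc 0))) (at t)"
        using DERIV_power[OF d1, of m] by (simp add: i_def)
      have d3: "((\<lambda>s. exp (- inverse s)) has_real_derivative exp (- i) * (i * i)) (at t)"
        using DERIV_chain2[OF DERIV_exp DERIV_minus[OF d1]] by (simp add: i_def)
      have "real m * (- (i * i) * i ^ (m - Suc 0)) * exp (- i) + exp (- i) * (i * i) * i ^ m
        = flat (m + 2) t - real m * flat (m + 1) t"
        using 3 by (cases m) (simp_all add: flat_def i_def[symmetric] algebra_simps)
      then show ?thesis using DERIV_mult[OF d2 d3] by (simp add: i_def)
    qed
    have "\<forall>\<^sub>F s in nhds t. flat m s = inverse s ^ m * exp (- inverse s)"
      using order_tendstoD(1)[OF filterlim_ident 3] by eventually_elim (simp add: flat_def)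
    then have "(flat m has_real_derivative D) (at t) \<longleftrightarrow> ((\<lambda>s. inverse s ^ m * exp (- inverse s)) has_real_derivative D) (at t)" for D
      by (rule DERIV_cong_ev[OF refl _ refl])
    then show ?thesis using d by blast
  qed
qed

section \<open>Calculus of k times continuously differentiable functions\<close>

lemma Ck_SucI:
  assumes "\<And>x. (f has_derivative f' x) (at x)" "\<And>v. Ck k (\<lambda>x. f' x v)"
  shows "Ck (Suc k) f"
proof -
  have "frechet_derivative f (at x) = f' x" for x using frechet_derivative_at[OF assms(1)] ..
  then show ?thesis using assms by (auto simp: differentiable_def)
qed

lemma Ck_SucD:
  assumes "Ck (Suc k) f"
  shows "(f has_derivative frechet_derivative f (at x)) (at x)" "Ck k (\<lambda>x. frechet_derivative f (at x) v)"
  using assms frechet_derivative_works by auto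

lemma Ck_mono_Suc: "Ck (Suc k) f \<Longrightarrow> Ck k f"
proof (induction k arbitrary: f)
  case 0
  then show ?case by (simp add: continuous_on_eq_continuous_at differentiable_imp_continuous_within)
next
  case (Suc k)
  then show ?case by (intro Ck_SucI[OF Ck_SucD(1)[OF Suc.prems]] Suc.IH Ck_SucD(2)[OF Suc.prems])
qed

lemma Ck_const: "Ck k (\<lambda>x. c)"
proof (induction k arbitrary: c)
  case (Suc k)
  show ?case by (rule Ck_SucI[where f' = "\<lambda>x v. 0"]) (auto intro: Suc)
qed simp

lemma Ck_add: "Ck k f \<Longrightarrow> Ck k g \<Longrightarrow> Ck k (\<lambda>x. f x + g x)"
proof (induction k arbitrary: f g)
  case (Suc k)
  show ?case
    by (rule Ck_SucI[OF has_derivative_add[OF Ck_SucD(1)[OF Suc.prems(1)] Ck_SucD(1)[OF Suc.prems(2)]]])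
       (intro Suc.IH Ck_SucD(2) Suc.prems)
qed (auto intro: continuous_on_add)

lemma Ck_mult:
  fixes f g :: "'a::euclidean_space \<Rightarrow> real"
  shows "Ck k f \<Longrightarrow> Ck k g \<Longrightarrow> Ck k (\<lambda>x. f x * g x)"
proof (induction k arbitrary: f g)
  case (Suc k)
  show ?case
    by (rule Ck_SucI[OF has_derivative_mult[OF Ck_SucD(1)[OF Suc.prems(1)] Ck_SucD(1)[OF Suc.prems(2)]]])
       (rule Ck_add[OF Suc.IH[OF Ck_mono_Suc[OF Suc.prems(1)] Ck_SucD(2)[OF Suc.prems(2)]]
          Suc.IH[OF Ck_SucD(2)[OF Suc.prems(1)] Ck_mono_Suc[OF Suc.prems(2)]]])
qed (auto intro: continuous_on_mult)

lemma Ck_prod: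
  fixes f :: "'i \<Rightarrow> 'a::euclidean_space \<Rightarrow> real"
  assumes "finite I" "\<And>i. i \<in> I \<Longrightarrow> Ck k (f i)"
  shows "Ck k (\<lambda>x. \<Prod>i\<in>I. f i x)"
  using assms by (induction I rule: finite_induct) (auto intro: Ck_const Ck_mult)

text \<open>Differentiation raises m, so the induction on k has to treat all m together.\<close>

lemma Ck_flat: "Ck k (\<lambda>x::'a::euclidean_space. flat m (x \<bullet> a + c))"
proof (induction k arbitrary: m)
  case 0
  have "continuous_on UNIV (flat m)"
    using flat_deriv by (intro DERIV_continuous_on) (auto intro: has_field_derivative_at_within)
  then show ?case by (auto intro!: continuous_on_compose2[of UNIV "flat m"] continuous_intros)
next
  case (Suc k)
  show ?case
  proof (rule Ck_SucI)
    fix x :: 'a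
    let ?D = "\<lambda>x. flat (m + 2) (x \<bullet> a + c) + (- real m) * flat (m + 1) (x \<bullet> a + c)"
    show "((\<lambda>x. flat m (x \<bullet> a + c)) has_derivative (\<lambda>v. ?D x * (v \<bullet> a))) (at x)"
      by (rule has_derivative_eq_rhs[OF DERIV_compose_FDERIV[OF flat_deriv]])
         (auto intro!: derivative_eq_intros simp: fun_eq_iff algebra_simps)
    show "Ck k (\<lambda>x. ?D x * (v \<bullet> a))" for v
      by (intro Ck_add Ck_mult Suc.IH Ck_const)
  qed
qed

section \<open>Smooth approximation of boxes and the fundamental lemma of the calculus of
  variations\<close>

text \<open>Each factor vanishes outside an open half-space bounded by a face of the box, and tends
  to 1 inside it because the argument is stretched by n + 1. The product therefore converges to the
  indicator of the open box.\<close>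

definition box_bump :: "nat \<Rightarrow> 'a::euclidean_space \<Rightarrow> 'a \<Rightarrow> 'a \<Rightarrow> real" where
  "box_bump n a c x = (\<Prod>b\<in>Basis. flat 0 (real (Suc n) * (x \<bullet> b - a \<bullet> b)) * flat 0 (real (Suc n) * (c \<bullet> b - x \<bullet> b)))"

lemma flat0_bounds: "0 \<le> flat 0 t" "flat 0 t \<le> 1" by (auto simp: flat_def)

lemma box_bump_bounds: "0 \<le> box_bump n a c x" "box_bump n a c x \<le> 1"
  unfolding box_bump_def
  by (intro prod_nonneg mult_nonneg_nonneg flat0_bounds, intro prod_le_1 conjI mult_nonneg_nonneg mult_le_one flat0_bounds)

lemma box_bump_supp: "x \<notin> box a c \<Longrightarrow> box_bump n a c x = 0"
proof -
  assume "x \<notin> box a c"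
  then obtain b where "b \<in> Basis" "\<not> (a \<bullet> b < x \<bullet> b \<and> x \<bullet> b < c \<bullet> b)" by (auto simp: mem_box)
  then show ?thesis unfolding box_bump_def
    by (intro prod_zero) (auto simp: flat_def mult_less_0_iff zero_less_mult_iff intro!: bexI[of _ b])
qed

lemma box_bump_test: "test_function (box_bump n a c)"
  unfolding test_function_def
proof safe
  fix k
  have "flat 0 (real (Suc n) * (x \<bullet> b - a \<bullet> b)) = flat 0 (x \<bullet> (real (Suc n) *\<^sub>R b) + (- (real (Suc n) * (a \<bullet> b))))"
    "flat 0 (real (Suc n) * (c \<bullet> b - x \<bullet> b)) = flat 0 (x \<bullet> (- real (Suc n) *\<^sub>R b) + real (Suc n) * (c \<bullet> b))" for x b :: 'a
    by (simp_all add: algebra_simps)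
  then show "Ck k (box_bump n a c)" unfolding box_bump_def[abs_def]
    by (simp only:) (intro Ck_prod Ck_mult Ck_flat finite_Basis)
  have "{x. box_bump n a c x \<noteq> 0} \<subseteq> box a c" using box_bump_supp by blast
  then show "compact (closure {x. box_bump n a c x \<noteq> 0})"
    using bounded_box bounded_subset compact_closure by blast
qed

lemma box_bump_limit: "(\<lambda>n. box_bump n a c x) \<longlonglongrightarrow> indicator (box a c) x"
proof (cases "x \<in> box a c")
  case False then show ?thesis by (simp add: box_bump_supp)
next
  case True
  have f: "(\<lambda>n. flat 0 (real (Suc n) * s)) \<longlonglongrightarrow> 1" if "0 < s" for s
  proof -
    have "(\<lambda>n. exp (- (inverse (real (Suc n)) * inverse s))) \<longlonglongrightarrow> exp (- (0 * inverse s))"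
      by (intro tendsto_intros LIMSEQ_inverse_real_of_nat)
    moreover have "flat 0 (real (Suc n) * s) = exp (- (inverse (real (Suc n)) * inverse s))" for n
      using that by (simp add: flat_def inverse_mult_distrib)
    ultimately show ?thesis by simp
  qed
  have "(\<lambda>n. box_bump n a c x) \<longlonglongrightarrow> (\<Prod>b\<in>(Basis::'a set). 1 * 1)"
    unfolding box_bump_def using True by (intro tendsto_prod tendsto_mult f) (auto simp: mem_box)
  then show ?thesis using True by simp
qed

text \<open>The positive and the negative part of w are densities of two measures that agree on
  boxes and are finite there. Boxes are stable under intersection and generate the Borel sets, so
  the measures coincide, and so do their densities almost everywhere.\<close>

lemma integral_box_zero_imp_AE_zero:
  fixes w :: "'a::euclidean_space \<Rightarrow> real"
  assumes w: "loc_int w" and z: "\<And>a c. (LINT x|lborel. w x * indicator (box a c) x) = 0"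
  shows "AE x in lborel. w x = 0"
proof -
  have [measurable]: "w \<in> borel_measurable borel" using w by (rule loc_int_measurable)
  have fin: "integrable lborel (\<lambda>x. w x * indicator (box a c) x)" for a c
  proof -
    obtain R where "\<And>x. x \<in> box a c \<Longrightarrow> norm x \<le> R"
    using bounded_box[of a c] unfolding bounded_iff by blast
  then have R: "box a c \<subseteq> cball 0 R" by auto
    show ?thesis
      by (rule loc_int_integrable[OF w, of _ 1 R]) (use R in \<open>auto simp: indicator_def\<close>)
  qed
  \<comment> \<open>Coercion to \<open>ennreal\<close> sends negative numbers to 0, so these
    densities are the positive and the negative part of w.\<close>
  define P where "P = density lborel (\<lambda>x. ennreal (w x))"
  define Q where "Q = density lborel (\<lambda>x. ennreal (- w x))"
  have box_eq: "emeasure P (box a c) = emeasure Q (box a c) \<and> emeasure P (box a c) \<noteq> \<infinity>" for a c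
  proof -
    define h where "h x = w x * indicator (box a c) x" for x
    have hi: "integrable lborel h" using fin unfolding h_def .
    have p: "integrable lborel (\<lambda>x. max 0 (h x))" "integrable lborel (\<lambda>x. max 0 (- h x))" using hi by auto
    have P: "emeasure P (box a c) = ennreal (LINT x|lborel. max 0 (h x))"
      unfolding P_def
      by (subst nn_integral_eq_integral[OF p(1), symmetric])
         (auto simp: emeasure_density h_def indicator_def ennreal_max_0 intro!: nn_integral_cong)
    have Q: "emeasure Q (box a c) = ennreal (LINT x|lborel. max 0 (- h x))"
      unfolding Q_def
      by (subst nn_integral_eq_integral[OF p(2), symmetric])
         (auto simp: emeasure_density h_def indicator_def ennreal_max_0 intro!: nn_integral_cong)
    have "(LINT x|lborel. max 0 (h x)) - (LINT x|lborel. max 0 (- h x)) = (LINT x|lborel. max 0 (h x) - max 0 (- h x))"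
      by (rule Bochner_Integration.integral_diff[symmetric, OF p])
    also have "\<dots> = (LINT x|lborel. h x)" by (rule Bochner_Integration.integral_cong) (auto simp: max_def)
    also have "\<dots> = 0" unfolding h_def by (rule z)
    finally show ?thesis unfolding P Q by simp
  qed
  have "P = Q"
  proof (rule measure_eqI_generator_eq)
    let ?E = "range (\<lambda>(a, b). box a b::'a set)"
    show "Int_stable ?E" by (auto simp: Int_stable_def box_Int_box)
    show "?E \<subseteq> Pow UNIV" "sets P = sigma_sets UNIV ?E" "sets Q = sigma_sets UNIV ?E"
      by (simp_all add: borel_eq_box P_def Q_def)
    let ?A = "\<lambda>n::nat. box (- (real n *\<^sub>R One)) (real n *\<^sub>R One) :: 'a set"
    show "range ?A \<subseteq> ?E" "(\<Union>i. ?A i) = UNIV" unfolding UN_box_eq_UNIV by auto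
    show "emeasure P (?A i) \<noteq> \<infinity>" for i using box_eq by blast
    show "emeasure P X = emeasure Q X" if "X \<in> ?E" for X using that box_eq by auto
  qed
  then have "AE x in lborel. ennreal (w x) = ennreal (- w x)"
    unfolding P_def Q_def by (subst (asm) sigma_finite_measure.density_unique_iff[OF sigma_finite_lborel]) auto
  then show ?thesis
  proof eventually_elim
    case (elim x)
    show ?case
    proof (cases "0 \<le> w x")
      case True
      then have "ennreal (w x) = 0" using elim by (simp add: ennreal_neg)
      then show ?thesis using True by (simp add: ennreal_eq_0_iff)
    next
      case False
      then have "ennreal (- w x) = 0" using elim[symmetric] by (simp add: ennreal_neg)
      then show ?thesis using False by (simp add: ennreal_eq_0_iff)
    qed
  qed
qed

lemma test_zero_imp_AE_zero:
  fixes w :: "'a::euclidean_space \<Rightarrow> real"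
  assumes w: "loc_int w" and z: "\<And>\<phi>. test_function \<phi> \<Longrightarrow> (LINT x|lborel. w x * \<phi> x) = 0"
  shows "AE x in lborel. w x = 0"
proof (rule integral_box_zero_imp_AE_zero[OF w])
  fix a c :: 'a
  have [measurable]: "w \<in> borel_measurable borel" using w by (rule loc_int_measurable)
  have "Ck 0 (box_bump n a c)" for n using box_bump_test unfolding test_function_def by blast
  then have [measurable]: "box_bump n a c \<in> borel_measurable borel" for n by (auto intro: borel_measurable_continuous_onI)
  obtain R where "\<And>x. x \<in> box a c \<Longrightarrow> norm x \<le> R"
    using bounded_box[of a c] unfolding bounded_iff by blast
  then have R: "box a c \<subseteq> cball 0 R" by auto
  have "(\<lambda>n. LINT x|lborel. w x * box_bump n a c x) \<longlonglongrightarrow> (LINT x|lborel. w x * indicator (box a c) x)"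
  proof (rule integral_dominated_convergence[OF _ _ loc_int_dom[OF w, of 1 R]])
    show "AE x in lborel. (\<lambda>n. w x * box_bump n a c x) \<longlonglongrightarrow> w x * indicator (box a c) x"
      by (intro AE_I2 tendsto_intros box_bump_limit)
    fix n
    have "norm (w x * box_bump n a c x) \<le> 1 * (indicat_real (cball 0 R) x * norm (w x))" for x
    proof (cases "x \<in> box a c")
      case True
      have "\<bar>w x\<bar> * \<bar>box_bump n a c x\<bar> \<le> \<bar>w x\<bar> * 1" using box_bump_bounds[of n a c x] by (intro mult_left_mono) auto
      then show ?thesis using True R by (auto simp: abs_mult indicator_def)
    qed (simp add: box_bump_supp)
    then show "AE x in lborel. norm (w x * box_bump n a c x) \<le> 1 * (indicat_real (cball 0 R) x * norm (w x))" by (intro AE_I2)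
  qed auto
  then show "(LINT x|lborel. w x * indicator (box a c) x) = 0" using z[OF box_bump_test] by (simp add: LIMSEQ_const_iff)
qed

section \<open>The lower bound\<close>

lemma L1_loc_borel_version:
  fixes u :: "'a::euclidean_space \<Rightarrow> real"
  assumes "L1_loc u"
  obtains v where "loc_int v" "AE x in lborel. u x = v x"
proof -
  have um: "u \<in> borel_measurable lebesgue" using assms by (simp add: L1_loc_def)
  obtain v where v: "v \<in> borel_measurable lborel" "AE x in lborel. u x = v x"
    using completion_ex_borel_measurable_real[OF um] by blast
  then have [measurable]: "v \<in> borel_measurable borel" by simp
  have "loc_int v"
    unfolding loc_int_def
  proof safe
    fix R
    have [measurable]: "cball (0::'a) R \<in> sets lebesgue" by simp
    have "integrable lebesgue (\<lambda>x. indicat_real (cball 0 R) x *\<^sub>R u x)"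
      using assms unfolding L1_loc_def set_integrable_def by auto
    moreover have "AE x in lebesgue. indicat_real (cball 0 R) x *\<^sub>R u x = indicat_real (cball 0 R) x *\<^sub>R v x"
      using AE_completion[OF v(2)] by eventually_elim simp
    moreover have "(\<lambda>x. indicat_real (cball 0 R) x *\<^sub>R v x) \<in> borel_measurable lebesgue"
      by (intro measurable_completion) simp
    ultimately have "integrable lebesgue (\<lambda>x. indicat_real (cball 0 R) x *\<^sub>R v x)"
      by (subst integrable_cong_AE[symmetric, where f = "\<lambda>x. indicat_real (cball 0 R) x *\<^sub>R u x"])
         (use borel_measurable_integrable in auto)
    then show "integrable lborel (\<lambda>x. indicat_real (cball 0 R) x *\<^sub>R v x)"
      by (subst (asm) integrable_completion) auto
  qed measurable
  then show thesis using that v(2) by blast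
qed

lemma loc_int_L1_loc:
  fixes g :: "'a::euclidean_space \<Rightarrow> 'b::euclidean_space"
  assumes "loc_int g"
  shows "L1_loc g"
  unfolding L1_loc_def set_integrable_def
proof (intro conjI allI impI)
  have [measurable]: "g \<in> borel_measurable borel" using assms by (rule loc_int_measurable)
  show "g \<in> borel_measurable lebesgue" by (intro measurable_completion) simp
  fix K :: "'a set" assume "compact K"
  then have [measurable]: "K \<in> sets borel" and "bounded K" by (auto intro: borel_compact compact_imp_bounded)
  then obtain R where "\<And>x. x \<in> K \<Longrightarrow> norm x \<le> R" unfolding bounded_iff by blast
  then have "integrable lborel (\<lambda>x. indicat_real K x *\<^sub>R g x)"
    by (intro loc_int_integrable[OF assms, of _ 1 R]) (auto simp: indicator_def)
  then show "integrable lebesgue (\<lambda>x. indicat_real K x *\<^sub>R g x)"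
    by (subst integrable_completion) auto
qed

lemma integral_lebesgue_version:
  fixes u v F :: "'a::euclidean_space \<Rightarrow> real"
  assumes u: "u \<in> borel_measurable lebesgue" and v: "v \<in> borel_measurable borel"
    and uv: "AE x in lborel. u x = v x" and F: "F \<in> borel_measurable borel"
  shows "(LINT x|lebesgue. u x * F x) = (LINT x|lborel. v x * F x)"
proof -
  have m: "F \<in> borel_measurable lebesgue" "v \<in> borel_measurable lebesgue"
    using F v by (auto intro: measurable_completion)
  have "(LINT x|lebesgue. u x * F x) = (LINT x|lebesgue. v x * F x)"
    using AE_completion[OF uv] u m by (intro integral_cong_AE) auto
  also have "\<dots> = (LINT x|lborel. v x * F x)" using F v by (intro integral_completion) auto
  finally show ?thesis .
qed

lemma total_variation_cong_AE:
  fixes u v :: "'a::euclidean_space \<Rightarrow> real"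
  assumes u: "u \<in> borel_measurable lebesgue" and v: "v \<in> borel_measurable borel"
    and uv: "AE x in lborel. u x = v x"
  shows "total_variation u = total_variation v"
  unfolding total_variation_def
proof (intro SUP_cong refl)
  fix \<phi> :: "'a \<Rightarrow> 'a" assume "\<phi> \<in> {\<phi>. test_function \<phi> \<and> (AE x in lebesgue. norm (\<phi> x) \<le> 1)}"
  then have "test_function \<phi>" by simp
  then have [measurable]: "(\<lambda>x. frechet_derivative \<phi> (at x) b \<bullet> b) \<in> borel_measurable borel" for b
    using test_function_C1c[of \<phi> b b] by (auto simp: C1c_deriv_def intro: borel_measurable_continuous_onI)
  have d: "divergence \<phi> \<in> borel_measurable borel" unfolding divergence_def[abs_def] by measurable
  have "v \<in> borel_measurable lebesgue" using v by (auto intro: measurable_completion)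
  then show "ennreal \<bar>LINT x|lebesgue. u x * divergence \<phi> x\<bar> = ennreal \<bar>LINT x|lebesgue. v x * divergence \<phi> x\<bar>"
    using integral_lebesgue_version[OF u v uv d] integral_lebesgue_version[OF _ v _ d, of v] by simp
qed

lemma test_function_real_C1c:
  assumes "test_function (\<phi> :: 'a::euclidean_space \<Rightarrow> real)"
  shows "C1c_deriv b \<phi> (\<lambda>x. frechet_derivative \<phi> (at x) b)"
  using test_function_C1c[OF assms, of b 1] by simp

text \<open>\<open>Phi\<close> integrates a gradient picked by \<open>SOME\<close>; uniqueness up to
  null sets carries the energy bound of the constructed gradient over to the one that was
  picked.\<close>

lemma distributional_gradient_unique:
  fixes u :: "'a::euclidean_space \<Rightarrow> real"
  assumes g: "distributional_gradient u g" and h: "distributional_gradient u h"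
  shows "AE x in lebesgue. g x = h x"
proof -
  have comp: "AE x in lebesgue. g x \<bullet> b = h x \<bullet> b" if b: "b \<in> Basis" for b
  proof -
    have gl: "L1_loc g" and hl: "L1_loc h" using g h by (auto simp: distributional_gradient_def)
    have inner: "L1_loc (\<lambda>x. f x \<bullet> b)" if "L1_loc f" for f :: "'a \<Rightarrow> 'a"
      using that integrable_inner_left[of b lebesgue "\<lambda>x. indicat_real K x *\<^sub>R f x" for K]
      unfolding L1_loc_def set_integrable_def by auto
    obtain g' where g': "loc_int g'" "AE x in lborel. g x \<bullet> b = g' x"
      using L1_loc_borel_version[OF inner[OF gl]] by blast
    obtain h' where h': "loc_int h'" "AE x in lborel. h x \<bullet> b = h' x"
      using L1_loc_borel_version[OF inner[OF hl]] by blast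
    have "AE x in lborel. g' x - h' x = 0"
    proof (rule test_zero_imp_AE_zero)
      show "loc_int (\<lambda>x. g' x - h' x)"
        using g'(1) h'(1) unfolding loc_int_def by (auto simp: right_diff_distrib)
      fix \<phi> :: "'a \<Rightarrow> real" assume \<phi>: "test_function \<phi>"
      note C = test_function_real_C1c[OF \<phi>, of b]
      have \<phi>m: "\<phi> \<in> borel_measurable borel" using C by (auto simp: C1c_deriv_def intro: borel_measurable_continuous_onI)
      have "(LINT x|lborel. g' x * \<phi> x) = (LINT x|lebesgue. (g x \<bullet> b) * \<phi> x)"
        using inner[OF gl] g' \<phi>m by (intro integral_lebesgue_version[symmetric]) (auto simp: L1_loc_def loc_int_def)
      also have "\<dots> = (LINT x|lebesgue. (h x \<bullet> b) * \<phi> x)"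
      proof -
        have "(LINT x|lebesgue. u x * frechet_derivative \<phi> (at x) b) = - (LINT x|lebesgue. (f x \<bullet> b) * \<phi> x)"
          if "distributional_gradient u f" for f
          using that \<phi> b unfolding distributional_gradient_def by blast
        from this[OF g] this[OF h] show ?thesis by linarith
      qed
      also have "\<dots> = (LINT x|lborel. h' x * \<phi> x)"
        using inner[OF hl] h' \<phi>m by (intro integral_lebesgue_version) (auto simp: L1_loc_def loc_int_def)
      finally have eq: "(LINT x|lborel. g' x * \<phi> x) = (LINT x|lborel. h' x * \<phi> x)" .
      have "integrable lborel (\<lambda>x. g' x * \<phi> x)" "integrable lborel (\<lambda>x. h' x * \<phi> x)"
        using C1c_deriv_integrable(1)[OF g'(1) C] C1c_deriv_integrable(1)[OF h'(1) C] by (simp_all add: mult.commute)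
      then show "(LINT x|lborel. (g' x - h' x) * \<phi> x) = 0"
        using eq by (simp add: left_diff_distrib)
    qed
    then have "AE x in lborel. g x \<bullet> b = h x \<bullet> b" using g'(2) h'(2) by eventually_elim simp
    then show ?thesis by (rule AE_completion)
  qed
  then have "AE x in lebesgue. \<forall>b\<in>Basis. g x \<bullet> b = h x \<bullet> b" by (intro AE_finite_allI finite_Basis)
  then show ?thesis by eventually_elim (rule euclidean_eqI, blast)
qed

lemma mollifyG_bound_of_Limsup:
  fixes u :: "'a::euclidean_space \<Rightarrow> real"
  assumes p: "1 \<le> p" and \<gamma>: "0 < \<gamma>" and u: "loc_int u" and e: "norm (e::'a) = 1" and \<eta>: "0 < \<eta>"
    and L: "Limsup at_top (\<lambda>l. Phi_lambda p \<gamma> l u) = ennreal M" and M: "0 \<le> M"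
  shows "K_const e p * energy p (mollifyG \<eta> u) \<le> ennreal ((p + \<gamma>) * M)"
proof (rule ennreal_le_epsilon)
  fix d :: real assume d: "0 < d"
  \<comment> \<open>A value strictly above the limsup bounds all late \<open>Phi_lambda\<close>, and
    this excess costs exactly d after multiplication by p + \<gamma>.\<close>
  define M' where "M' = M + d / (p + \<gamma>)"
  have M': "M < M'" "0 \<le> M'" using d p \<gamma> M by (auto simp: M'_def)
  have "Limsup at_top (\<lambda>l. Phi_lambda p \<gamma> l u) < ennreal M'" unfolding L using M' M by (simp add: ennreal_lessI)
  then have "\<forall>\<^sub>F l in at_top. Phi_lambda p \<gamma> l u < ennreal M'" by (rule Limsup_lessD)
  then obtain \<Lambda> where \<Lambda>: "\<And>l. \<Lambda> \<le> l \<Longrightarrow> Phi_lambda p \<gamma> l u < ennreal M'" by (auto simp: eventually_at_top_linorder)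
  have "K_const e p * energy p (mollifyG \<eta> u) \<le> ennreal ((p + \<gamma>) * M')"
  proof (rule mollifyG_energy_le[OF u p \<gamma> \<eta> _ M'(2) _ e, of "max 1 \<Lambda>"])
    show "0 < max 1 \<Lambda>" by simp
    show "superlevel_mass p \<gamma> l u \<le> ennreal M'" if "max 1 \<Lambda> \<le> l" for l
      using \<Lambda>[of l] that unfolding Phi_lambda_eq[OF loc_int_measurable[OF u]] by (simp add: less_imp_le)
  qed
  also have "(p + \<gamma>) * M' = (p + \<gamma>) * M + d" using p \<gamma> by (simp add: M'_def distrib_left)
  also have "ennreal \<dots> = ennreal ((p + \<gamma>) * M) + ennreal d" using p \<gamma> M d by (intro ennreal_plus) auto
  finally show "K_const e p * energy p (mollifyG \<eta> u) \<le> ennreal ((p + \<gamma>) * M) + ennreal d" .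
qed

lemma Phi_bound:
  fixes u :: "'a::euclidean_space \<Rightarrow> real"
  assumes p: "1 \<le> p" and \<gamma>: "0 < \<gamma>" and u: "L1_loc u" and e: "norm (e::'a) = 1"
    and fin: "Limsup at_top (\<lambda>l. Phi_lambda p \<gamma> l u) < \<infinity>"
  shows "K_const e p / ennreal (\<gamma> + p) * Phi p u \<le> Limsup at_top (\<lambda>l. Phi_lambda p \<gamma> l u)"
    and "p = 1 \<Longrightarrow> total_variation u < \<infinity>"
    and "p > 1 \<Longrightarrow> \<exists>g. distributional_gradient u g \<and> Lp p g"
proof -
  obtain v where v: "loc_int v" "AE x in lborel. u x = v x" using L1_loc_borel_version[OF u] by blast
  have um: "u \<in> borel_measurable lebesgue" using u by (simp add: L1_loc_def)
  have vm: "v \<in> borel_measurable borel" using v(1) by (rule loc_int_measurable)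
  obtain M where M: "Limsup at_top (\<lambda>l. Phi_lambda p \<gamma> l u) = ennreal M" "0 \<le> M"
    using fin by (cases "Limsup at_top (\<lambda>l. Phi_lambda p \<gamma> l u)") auto
  have Mv: "Limsup at_top (\<lambda>l. Phi_lambda p \<gamma> l v) = ennreal M"
    using M(1) by (simp add: Phi_lambda_cong_AE[OF v(2)])
  have "K_const e p \<noteq> top" "K_const e p \<noteq> 0"
    using K_ball_finite[OF e p] K_ball_pos[OF e, of p] by (auto simp: K_const_eq ennreal_mult_eq_top_iff)
  then obtain k where k: "K_const e p = ennreal k" "0 < k"
    by (cases "K_const e p") (auto simp: order_less_le)
  \<comment> \<open>The bound for the energy after division by K; it satisfies k / (\<gamma> + p) *
    c = M, so the constant of the theorem comes out exactly.\<close>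
  define c where "c = (p + \<gamma>) * M / k"
  have c: "0 \<le> c" using p \<gamma> M k by (simp add: c_def)
  have bd: "energy p (mollifyG \<eta> v) \<le> ennreal c" if \<eta>: "0 < \<eta>" for \<eta>
  proof -
    let ?I = "\<integral>\<^sup>+x. ennreal (norm (mollifyG \<eta> v x) powr p) \<partial>lborel"
    have "?I = ennreal (1 / k) * (ennreal k * ?I)"
      using k by (simp add: mult.assoc[symmetric] ennreal_mult'[symmetric])
    also have "\<dots> \<le> ennreal (1 / k) * ennreal ((p + \<gamma>) * M)"
      using mollifyG_bound_of_Limsup[OF p \<gamma> v(1) e \<eta> Mv M(2)] unfolding k(1) by (intro mult_left_mono) auto
    also have "\<dots> = ennreal c" using k by (simp add: c_def ennreal_mult'[symmetric])
    finally show ?thesis .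
  qed
  have tv: "total_variation u \<le> ennreal c" if "p = 1"
    unfolding total_variation_cong_AE[OF um vm v(2)]
    using bd that by (intro total_variation_le v(1) c) simp
  then show "p = 1 \<Longrightarrow> total_variation u < \<infinity>" by (auto intro: le_less_trans)
  have grad: "\<exists>g. distributional_gradient u g \<and> Lp p g \<and> (\<integral>\<^sup>+x. ennreal (norm (g x) powr p) \<partial>lebesgue) \<le> ennreal c" if p1: "1 < p"
  proof -
    obtain g where g: "loc_int g" "energy p g \<le> ennreal c"
      "\<And>b f f'. C1c_deriv b f f' \<Longrightarrow> (LINT x|lborel. v x * f' x) = - (LINT x|lborel. (g x \<bullet> b) * f x)"
      by (rule weak_gradient_exists[OF v(1) p1 c bd]) auto
    have gm[measurable]: "g \<in> borel_measurable borel" using g(1) by (rule loc_int_measurable)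
    have "distributional_gradient u g"
      unfolding distributional_gradient_def
    proof (intro conjI allI impI ballI)
      show "L1_loc g" by (rule loc_int_L1_loc[OF g(1)])
      fix \<phi> :: "'a \<Rightarrow> real" and b :: 'a assume \<phi>: "test_function \<phi>" and "b \<in> Basis"
      note C = test_function_real_C1c[OF \<phi>, of b]
      have m[measurable]: "\<phi> \<in> borel_measurable borel" "(\<lambda>x. frechet_derivative \<phi> (at x) b) \<in> borel_measurable borel"
        using C by (auto simp: C1c_deriv_def intro: borel_measurable_continuous_onI)
      have "(LINT x|lebesgue. u x * frechet_derivative \<phi> (at x) b) = (LINT x|lborel. v x * frechet_derivative \<phi> (at x) b)"
        by (rule integral_lebesgue_version[OF um vm v(2) m(2)])
      also have "\<dots> = - (LINT x|lborel. (g x \<bullet> b) * \<phi> x)" by (rule g(3)[OF C])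
      also have "(LINT x|lborel. (g x \<bullet> b) * \<phi> x) = (LINT x|lebesgue. (g x \<bullet> b) * \<phi> x)"
        by (rule integral_completion[symmetric]) measurable
      finally show "(LINT x|lebesgue. u x * frechet_derivative \<phi> (at x) b) = - (LINT x|lebesgue. (g x \<bullet> b) * \<phi> x)" .
    qed
    moreover have "Lp p g"
      unfolding Lp_def
    proof
      show "g \<in> borel_measurable lebesgue" by (intro measurable_completion) simp
      have "integrable lborel (\<lambda>x. norm (g x) powr p)"
        using g(2) by (intro integrableI_nonneg) (auto simp: less_top[symmetric] top_unique)
      then show "integrable lebesgue (\<lambda>x. norm (g x) powr p)" by (subst integrable_completion) auto
    qed
    ultimately show ?thesis using g(2) by (auto simp: nn_integral_completion)
  qed
  then show "p > 1 \<Longrightarrow> \<exists>g. distributional_gradient u g \<and> Lp p g" by blast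
  have "Phi p u \<le> ennreal c"
  proof (cases "p > 1")
    case True
    obtain g where g: "distributional_gradient u g" "Lp p g" "(\<integral>\<^sup>+x. ennreal (norm (g x) powr p) \<partial>lebesgue) \<le> ennreal c"
      using grad[OF True] by blast
    define h where "h = (SOME g. distributional_gradient u g \<and> Lp p g)"
    have h: "distributional_gradient u h \<and> Lp p h"
      using someI_ex[OF exI[of "\<lambda>g. distributional_gradient u g \<and> Lp p g", OF conjI[OF g(1,2)]]] unfolding h_def .
    have "Phi p u = (\<integral>\<^sup>+x. ennreal (norm (h x) powr p) \<partial>lebesgue)"
      unfolding Phi_def h_def[symmetric] using True h by auto
    also have "\<dots> = (\<integral>\<^sup>+x. ennreal (norm (g x) powr p) \<partial>lebesgue)"
      using distributional_gradient_unique[OF conjunct1[OF h] g(1)] by (intro nn_integral_cong_AE) auto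
    finally show ?thesis using g(3) by simp
  next
    case False
    then show ?thesis using p tv by (simp add: Phi_def)
  qed
  then have "K_const e p / ennreal (\<gamma> + p) * Phi p u \<le> ennreal k / ennreal (\<gamma> + p) * ennreal c"
    unfolding k(1) by (rule mult_left_mono) simp
  also have "ennreal k / ennreal (\<gamma> + p) = ennreal (k / (\<gamma> + p))"
    using p \<gamma> k by (intro divide_ennreal) auto
  also have "ennreal (k / (\<gamma> + p)) * ennreal c = ennreal (k / (\<gamma> + p) * c)"
    using p \<gamma> k by (intro ennreal_mult'[symmetric]) auto
  also have "k / (\<gamma> + p) * c = M"
  proof -
    have "\<gamma> + p \<noteq> 0" using p \<gamma> by simp
    then show ?thesis using k unfolding c_def add.commute[of p] by simp
  qed
  finally show "K_const e p / ennreal (\<gamma> + p) * Phi p u \<le> Limsup at_top (\<lambda>l. Phi_lambda p \<gamma> l u)"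
    unfolding M(1) .
qed

theorem theorem2p4:
  fixes u :: "'a::euclidean_space \<Rightarrow> real" and p \<gamma> :: real
  assumes "1 \<le> p" and "\<gamma> > 0" and "L1_loc u"
  shows "(\<forall>e \<in> sphere (0::'a) 1.
            K_const e p / ennreal (\<gamma> + p) * Phi p u \<le> Limsup at_top (\<lambda>l. Phi_lambda p \<gamma> l u)) \<and>
         (Lp p u \<and> Limsup at_top (\<lambda>l. Phi_lambda p \<gamma> l u) < \<infinity> \<longrightarrow>
            (p > 1 \<longrightarrow> W1p p u) \<and> (p = 1 \<longrightarrow> BV u))"
proof (intro conjI ballI impI; (elim conjE)?)
  fix e :: 'a assume "e \<in> sphere 0 1"
  \<comment> \<open>An infinite limsup leaves nothing to prove; otherwise \<open>Phi_bound\<close>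
    applies.\<close>
  then show "K_const e p / ennreal (\<gamma> + p) * Phi p u \<le> Limsup at_top (\<lambda>l. Phi_lambda p \<gamma> l u)"
    using Phi_bound(1)[OF assms, of e] by (cases "Limsup at_top (\<lambda>l. Phi_lambda p \<gamma> l u) = \<infinity>") (auto simp: less_top)
next
  assume Lp: "Lp p u" and fin: "Limsup at_top (\<lambda>l. Phi_lambda p \<gamma> l u) < \<infinity>"
  obtain e :: 'a where e: "norm e = 1" using norm_Basis SOME_Basis by blast
  {
    assume "p > 1"
    then show "W1p p u" using Phi_bound(3)[OF assms e fin] Lp by (simp add: W1p_def)
  next
    assume "p = 1"
    then have "integrable lebesgue u"
      using Lp by (auto simp: Lp_def integrable_norm_iff integrable_abs_iff)
    then show "BV u" using Phi_bound(2)[OF assms e fin] \<open>p = 1\<close> by (simp add: BV_def)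
  }
qed

end
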